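(* If the limit $$\lim_{\text{odd } x\to\infty}\left(\frac{l(x)\ln^2 x}{x}\prod_{\substack{p\mid x\\ p \text{ odd prime}}}\frac{p-2}{p-1}\right)$$ exists, then it equals $C_{tw}$.
   Context: For an odd positive integer $n$, $l(n)$ denotes the number of pairs $(p,q)$ of primes such that $n=p+2q$. $C_{tw}$ is the twin prime constant $C_{tw}=\prod_{p \text{ odd prime}}\frac{p(p-2)}{(p-1)^2}=0.66016\ldots$. *)

theory Defs
  imports "HOL-Analysis.Analysis" "HOL-Computational_Algebra.Primes"
begin

definition l :: "nat \<Rightarrow> nat" where
  "l n = card {(p :: nat, q :: nat). prime p \<and> prime q \<and> n = p + 2 * q}"

definition C_tw :: real where
  "C_tw = (\<Prod>p. if prime p \<and> odd p
                  then real p * (real p - 2) / (real p - 1)^2 else 1)"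

definition F :: "nat \<Rightarrow> real" where
  "F x = real (l x) * (ln (real x))^2 / real x *
         (\<Prod>p\<in>{p. prime p \<and> p dvd x \<and> odd p}. (real p - 2) / (real p - 1))"

end

theory Submission
  imports Defs "HOL-Number_Theory.Prime_Powers" "HOL-Real_Asymp.Real_Asymp"
begin

text \<open>
  Put $P(s) = \sum_p \ln p\, e^{-ps}$. Replacing $l(n) \ln^2 n$ by
  $\sum_{p + 2q = n} \ln p \ln q$ costs only $o(n)$ per $n$, so if the limit $L$ exists,
  averaging the singular series with weights $e^{-ns}$ over odd $n$ gives
  $sP(s) \cdot 2sP(2s) \to L / C_{tw}$ as $s \to 0$; it remains to see that this limit is $1$.

  The full prime number theorem is not needed for this. The product formula makes $h(s) = sP(s)$
  asymptotically invariant under $s \mapsto 4s$. On the other hand,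
  $\sum_{n \le x} (\Lambda(n) - 1) n^{-1-it} = O_t(1)$ for every real $t$: for $t \ne 0$ these sums
  are either bounded or equal to $-\ln x + O(1)$, according to whether $\zeta(1+it) \ne 0$, and the
  3-4-1 inequality excludes the second case. By the Stone--Weierstrass theorem on the circle, the
  boundedness extends, up to $\epsilon \ln x$, from the characters $n^{-it}$ to all functions
  that are periodic in $\ln n$. Applied to the periodization of $x e^{-x}$ under
  $x \mapsto 4x$, it shows that $h(s) - 1$ has mean $0$ along
  $s, s/4, s/16, \dots$ on all long blocks; since $h$ hardly changes from one term to the next,
  $h(s/4^k) \to 1$.
\<close>

subsection \<open>Chebyshev and Mertens bounds\<close>

text \<open>The base 4 comes from p + 2q: comparing the product formula at s and at 2s eliminates
  h(2s) and leaves h(s) against h(4s). This division requires h to be bounded away from 0, whereas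
  the Chebyshev estimate proved below bounds h only from above. The lower bound comes from the block
  means: a block over which h - 1 averages to nearly 0 contains a scale where h is not small, and
  monotonicity of P carries this to nearby scales. Exponential weights are used because the
  generating function of p + 2q factorizes exactly. No uniformity in t is needed for the twisted
  sums: a trigonometric polynomial has finitely many frequencies, and its approximation error is
  multiplied by the mass of |Lambda(n) - 1|/n over J scales, which is O(J). Nothing is continued
  analytically. zeta(1+it) enters only as the constant in an Euler-Maclaurin formula; if it
  vanishes, the twisted sum behaves as it would at a simple zero.\<close>

lemma sum_dvd_swap:
  fixes g :: "nat \<Rightarrow> nat \<Rightarrow> 'a::comm_monoid_add"
  shows "(\<Sum>k=1..N. \<Sum>d | d dvd k. g d (k div d)) = (\<Sum>d=1..N. \<Sum>m=1..N div d. g d m)"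
proof -
  have "(\<Sum>k=1..N. \<Sum>d | d dvd k. g d (k div d))
      = (\<Sum>(k, d)\<in>(SIGMA k:{1..N}. {d. d dvd k}). g d (k div d))"
    by (subst sum.Sigma) auto
  also have "\<dots> = (\<Sum>(d, m)\<in>(SIGMA d:{1..N}. {1..N div d}). g d m)"
  proof (rule sum.reindex_bij_witness[where i = "\<lambda>(d, m). (d * m, d)" and j = "\<lambda>(k, d). (d, k div d)"], goal_cases)
    case (2 a)
    then obtain k d where a: "a = (k, d)" "1 \<le> k" "k \<le> N" "d dvd k" by auto
    then obtain m where m: "k = d * m" by auto
    have "d > 0" "m > 0" using a m by auto
    moreover have "m \<le> N div d"
      using a m \<open>d > 0\<close> by (simp add: less_eq_div_iff_mult_less_eq mult.commute)
    moreover have "d \<le> N" using a m \<open>m > 0\<close> by (metis dvd_imp_le le_trans dvd_triv_left a(2) less_le_trans zero_less_one)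
    ultimately show ?case using a m by auto
  next
    case (4 b)
    then show ?case by (auto simp: less_eq_div_iff_mult_less_eq mult.commute)
  qed auto
  also have "\<dots> = (\<Sum>d=1..N. \<Sum>m=1..N div d. g d m)"
    by (subst sum.Sigma) auto
  finally show ?thesis .
qed

abbreviation Lam :: "nat \<Rightarrow> real" where "Lam \<equiv> mangoldt"

definition psi :: "nat \<Rightarrow> real" where "psi N = (\<Sum>n=1..N. Lam n)"

lemma sum_ln_conv_mangoldt: "(\<Sum>n=1..N. ln (real n)) = (\<Sum>d=1..N. Lam d * real (N div d))"
proof -
  have "(\<Sum>n=1..N. ln (real n)) = (\<Sum>n=1..N. \<Sum>d | d dvd n. Lam d)"
    by (intro sum.cong refl) (subst mangoldt_sum, auto)
  also have "\<dots> = (\<Sum>d=1..N. \<Sum>m=1..N div d. Lam d)"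
    using sum_dvd_swap[of "\<lambda>d m. Lam d" N] by simp
  finally show ?thesis by (simp add: mult.commute)
qed

lemma ln_fact_conv_sum: "ln (fact N) = (\<Sum>n=1..N. ln (real n))"
  unfolding fact_prod of_nat_prod by (subst ln_prod) auto

text \<open>Chebyshev's argument: the logarithm of the central binomial coefficient is the sum of
  \<open>Lam d\<close> times floor(2n/d) - 2 floor(n/d). This factor is never negative and is at
  least 1 for n < d <= 2n, while the coefficient itself is at most 4^n.\<close>

lemma psi_double: "psi (2 * n) - psi n \<le> 2 * real n * ln 2"
proof -
  let ?N = "2 * n"
  have ext: "(\<Sum>d=1..n. Lam d * real (n div d)) = (\<Sum>d=1..?N. Lam d * real (n div d))"
    by (intro sum.mono_neutral_left) auto
  have "psi ?N - psi n = (\<Sum>d\<in>{1..?N}. if n < d then Lam d else 0)"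
  proof -
    have "psi ?N - psi n = sum Lam ({1..?N} - {1..n})"
      unfolding psi_def by (subst sum_diff) auto
    also have "\<dots> = (\<Sum>d\<in>{1..?N}. if n < d then Lam d else 0)"
      by (subst sum.inter_filter[symmetric]) (auto intro!: sum.cong)
    finally show ?thesis .
  qed
  also have "\<dots> \<le> (\<Sum>d=1..?N. Lam d * (real (?N div d) - 2 * real (n div d)))"
  proof (intro sum_mono)
    fix d assume d: "d \<in> {1..?N}"
    have "2 * (n div d) \<le> ?N div d"
      using d by (simp add: less_eq_div_iff_mult_less_eq)
    hence 1: "real (?N div d) - 2 * real (n div d) \<ge> 0"
      by linarith
    have 2: "n div d = 0" "?N div d \<ge> 1" if "n < d"
      using that d by (auto simp: less_eq_div_iff_mult_less_eq)
    show "(if n < d then Lam d else 0) \<le> Lam d * (real (?N div d) - 2 * real (n div d))"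
    proof (cases "n < d")
      case True
      have "Lam d * 1 \<le> Lam d * (real (?N div d) - 2 * real (n div d))"
        using 2[OF True] mangoldt_nonneg[of d] by (intro mult_left_mono) auto
      thus ?thesis using True by simp
    qed (use 1 mangoldt_nonneg[of d] in auto)
  qed
  also have "\<dots> = ln (fact ?N) - 2 * ln (fact n)"
    unfolding ln_fact_conv_sum sum_ln_conv_mangoldt ext
    by (simp add: algebra_simps sum_subtractf sum_distrib_left)
  also have "\<dots> = ln (fact ?N / (fact n * fact n))"
    by (simp add: ln_div ln_mult)
  also have "fact ?N / (fact n * fact n) = real (?N choose n)"
    by (subst binomial_fact) (auto simp: mult_2)
  also have "ln (real (?N choose n)) \<le> ln (2 ^ ?N)"
  proof -
    have "real (?N choose n) \<le> real (2 ^ ?N)"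
      using binomial_le_pow2[of ?N n] by (intro of_nat_mono)
    moreover have "?N choose n > 0" by simp
    ultimately show ?thesis by simp
  qed
  also have "\<dots> = 2 * real n * ln 2" by (simp add: ln_realpow)
  finally show ?thesis .
qed

lemma psi_mono: "m \<le> n \<Longrightarrow> psi m \<le> psi n"
  unfolding psi_def by (intro sum_mono2) (auto intro: mangoldt_nonneg)

lemma psi_le: "psi N \<le> 4 * real N"
proof (induction N rule: less_induct)
  case (less N)
  show ?case
  proof (cases "N \<le> 1")
    case True
    hence "N = 0 \<or> N = 1" by auto
    thus ?thesis by (auto simp: psi_def)
  next
    case False
    define n where "n = (N + 1) div 2"
    have n: "N \<le> 2 * n" "2 * n \<le> N + 1" "n < N" using False by (auto simp: n_def)
    have "psi N \<le> psi (2 * n)" by (intro psi_mono n)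
    also have "\<dots> \<le> psi n + 2 * real n * ln 2" using psi_double[of n] by simp
    also have "2 * real n * ln 2 \<le> 2 * real n * (7 / 10)"
      using ln2_le_25_over_36 by (intro mult_left_mono) auto
    also have "psi n \<le> 4 * real n" using less n by auto
    \<comment> \<open>The left side is at most 2.7 (N + 1), which lies below 4 N only from N = 3 on;
      hence the separate case N = 2.\<close>
    also have "4 * real n + 2 * real n * (7 / 10) \<le> 4 * real N"
    proof -
      have "2 * real n \<le> real N + 1" using n by linarith
      moreover have "N = 2 \<and> n = 1 \<or> real N \<ge> 3" using False n by auto
      ultimately show ?thesis by auto
    qed
    finally show ?thesis by simp
  qed
qed

lemma ln_fact_ge: "N \<ge> 1 \<Longrightarrow> ln (fact N) \<ge> real N * ln (real N) - real N"
proof (induction N rule: nat_induct_at_least)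
  case (Suc N)
  have "ln (1 + 1 / real N) \<le> 1 / real N"
    using Suc by (intro ln_add_one_self_le_self) auto
  also have "1 + 1 / real N = (real N + 1) / real N" using Suc by (simp add: field_simps)
  also have "ln \<dots> = ln (real N + 1) - ln (real N)" using Suc by (subst ln_div) auto
  finally have "real N * (ln (real N + 1) - ln (real N)) \<le> 1"
    using Suc by (simp add: field_simps)
  moreover have "ln (fact (Suc N)) = ln (real N + 1) + ln (fact N)"
    by (simp add: ln_mult add.commute del: of_nat_Suc)
  ultimately show ?case using Suc.IH
    by (simp add: algebra_simps del: fact_Suc)
qed auto

text \<open>ln N! is both N ln N + O(N) and the sum of \<open>Lam d\<close> times floor(N/d).
  Dropping the floors costs at most \<open>psi N\<close>, and dividing by N leaves a bounded error;
  the constant 4 is the one of \<open>psi_le\<close>.\<close>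

theorem mertens_first:
  assumes "N \<ge> 1"
  shows "\<bar>(\<Sum>d=1..N. Lam d / real d) - ln (real N)\<bar> \<le> 4"
proof -
  let ?M = "\<Sum>d=1..N. Lam d / real d"
  have T: "ln (fact N) = (\<Sum>d=1..N. Lam d * real (N div d))"
    by (simp only: ln_fact_conv_sum sum_ln_conv_mangoldt)
  have "ln (fact N) \<le> ln (real (N ^ N))"
    using fact_le_power[of N, where ?'a = real] assms by simp
  hence T_le: "ln (fact N) \<le> real N * ln (real N)" using assms by (simp add: ln_realpow)
  have "ln (fact N) \<le> (\<Sum>d=1..N. Lam d * (real N / real d))"
    unfolding T by (intro sum_mono mult_left_mono mangoldt_nonneg) (rule of_nat_div_le_of_nat)
  also have "\<dots> = real N * ?M" by (simp add: sum_distrib_left field_simps)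
  finally have "real N * ln (real N) - real N \<le> real N * ?M" using ln_fact_ge[OF assms] by simp
  hence "real N * (ln (real N) - 1) \<le> real N * ?M" by (simp add: algebra_simps)
  hence 1: "ln (real N) - 1 \<le> ?M" using assms by simp
  have "real N * ?M - psi N = (\<Sum>d=1..N. Lam d * (real N / real d - 1))"
    by (simp add: sum_distrib_left psi_def sum_subtractf right_diff_distrib mult.commute)
  also have "\<dots> \<le> ln (fact N)"
    unfolding T
  proof (intro sum_mono mult_left_mono mangoldt_nonneg)
    fix d assume "d \<in> {1..N}"
    then show "real N / real d - 1 \<le> real (N div d)"
      using real_of_int_div3[of "int N" "int d"] by (simp flip: zdiv_int)
  qed
  finally have "real N * ?M \<le> real N * (ln (real N) + 4)"
    using T_le psi_le[of N] by (simp add: algebra_simps)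
  hence "?M \<le> ln (real N) + 4" using assms by simp
  with 1 show ?thesis by linarith
qed

subsection \<open>Sums of complex powers\<close>

text \<open>The power x^s for x > 0, with the exponent first so that \<open>E s\<close> is a curve
  in the complex plane that can be differentiated along the reals.\<close>

definition E :: "complex \<Rightarrow> real \<Rightarrow> complex" where "E s x = exp (s * of_real (ln x))"

lemma E_mult: "x > 0 \<Longrightarrow> y > 0 \<Longrightarrow> E s (x * y) = E s x * E s y"
  by (simp add: E_def ln_mult ring_distribs exp_add)

lemma E_divide: "x > 0 \<Longrightarrow> y > 0 \<Longrightarrow> E s (x / y) = E s x / E s y"
  by (simp add: E_def ln_div ring_distribs exp_diff)

lemma E_add: "E (s + t) x = E s x * E t x"
  by (simp add: E_def ring_distribs exp_add)

lemma E_0 [simp]: "E 0 x = 1" and E_1_right [simp]: "E s 1 = 1" and E_nonzero [simp]: "E s x \<noteq> 0"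
  by (simp_all add: E_def)

lemma norm_E: "norm (E s x) = exp (Re s * ln x)"
  by (simp add: E_def)

lemma E_1: "x > 0 \<Longrightarrow> E 1 x = of_real x"
  by (simp add: E_def exp_of_real)

lemma E_minus: "E (-s) x = inverse (E s x)"
  by (simp add: E_def exp_minus)

lemma norm_E_imag [simp]: "norm (E (- (\<i> * of_real t)) x) = 1"
  by (simp add: norm_E)

lemma E_minus_1_minus: "x > 0 \<Longrightarrow> E (-1 - s) x = E (-s) x / of_real x"
  using E_add[of "-1" "-s" x] by (simp add: E_minus[of 1] E_1 field_simps)

lemma E_uminus_diff_1: "E (-s - 1) x = E (-1 - s) x"
  by (rule arg_cong[where f = "\<lambda>s. E s x"]) simp

lemma E_minus_1_diff_1: "E (-1 - s - 1) x = E (-2 - s) x"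
  by (rule arg_cong[where f = "\<lambda>s. E s x"]) simp

lemma E_1_minus: "x > 0 \<Longrightarrow> E (1 - s) x = E (-s) x * of_real x"
  using E_add[of "1" "-s" x] by (simp add: E_1 field_simps)

lemma has_vector_derivative_E:
  assumes "x > 0"
  shows "(E s has_vector_derivative s * E (s - 1) x) (at x within S)"
proof -
  have "((\<lambda>x. exp (s * of_real (ln x))) has_vector_derivative
         (s * of_real (inverse x)) * exp (s * of_real (ln x))) (at x within S)"
  proof -
    have "((\<lambda>x. of_real (ln x) :: complex) has_vector_derivative of_real (inverse x)) (at x within S)"
      using assms DERIV_ln[of x]
      by (intro has_vector_derivative_of_real)
         (auto simp flip: has_real_derivative_iff_has_vector_derivative intro: DERIV_subset)
    hence "((\<lambda>x. s * of_real (ln x)) has_vector_derivative s * of_real (inverse x)) (at x within S)"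
      by (rule has_vector_derivative_mult_right)
    from field_vector_diff_chain_within[OF this DERIV_subset[OF DERIV_exp]] show ?thesis
      by (simp add: o_def)
  qed
  also have "(s * of_real (inverse x)) * exp (s * of_real (ln x)) = s * E (s - 1) x"
    using E_add[of s "-1" x] assms by (simp add: E_minus E_1) (simp add: E_def field_simps)
  finally show ?thesis by (simp add: E_def[abs_def])
qed

lemma norm_diff_le_vector_derivative:
  fixes f :: "real \<Rightarrow> 'a::real_normed_vector"
  assumes "\<And>u. u \<in> {a..b} \<Longrightarrow> (f has_vector_derivative f' u) (at u within {a..b})"
    and "\<And>u. u \<in> {a..b} \<Longrightarrow> norm (f' u) \<le> M" and "x \<in> {a..b}" "y \<in> {a..b}"
  shows "norm (f x - f y) \<le> M * \<bar>x - y\<bar>"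
proof -
  have "norm (f x - f y) \<le> M * norm (x - y)"
  proof (rule differentiable_bound[where S = "{a..b}" and f' = "\<lambda>u h. h *\<^sub>R f' u"])
    fix u assume u: "u \<in> {a..b}"
    show "onorm (\<lambda>h. h *\<^sub>R f' u) \<le> M"
    proof (rule onorm_le)
      fix h :: real
      have "\<bar>h\<bar> * norm (f' u) \<le> \<bar>h\<bar> * M" by (intro mult_left_mono assms(2) u) auto
      thus "norm (h *\<^sub>R f' u) \<le> M * norm h" by (simp add: mult.commute)
    qed
  qed (use assms in \<open>auto simp: has_vector_derivative_def\<close>)
  thus ?thesis by simp
qed

text \<open>Compares one summand with the integral of \<open>phi\<close> over the unit interval to
  its left. The integral is written as the increment of an antiderivative \<open>Psi\<close>, so the
  mean value inequality is enough: on the interval \<open>phi\<close> differs from its right end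
  value by at most M.\<close>

lemma euler_maclaurin_step:
  fixes phi Psi :: "real \<Rightarrow> complex"
  assumes "\<And>u. u \<in> {a..a+1} \<Longrightarrow> (Psi has_vector_derivative phi u) (at u within {a..a+1})"
    and "\<And>u. u \<in> {a..a+1} \<Longrightarrow> (phi has_vector_derivative phi' u) (at u within {a..a+1})"
    and "\<And>u. u \<in> {a..a+1} \<Longrightarrow> norm (phi' u) \<le> M"
  shows "norm (phi (a + 1) - (Psi (a + 1) - Psi a)) \<le> M"
proof -
  have M: "M \<ge> 0" using order_trans[OF norm_ge_zero assms(3)[of a]] by simp
  have "norm (Psi (a + 1) - Psi a - ((a + 1) - a) *\<^sub>R phi (a + 1)) \<le> norm ((a + 1) - a) * M"
  proof (rule vector_differentiable_bound_linearization[where S = "{a..a+1}"])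
    fix x assume x: "x \<in> {a..a+1}"
    have "norm (phi x - phi (a + 1)) \<le> M * \<bar>x - (a + 1)\<bar>"
      by (rule norm_diff_le_vector_derivative[OF assms(2,3)]) (use x in auto)
    also have "\<dots> \<le> M * 1" using x M by (intro mult_left_mono) auto
    finally show "norm (phi x - phi (a + 1)) \<le> M" by simp
  qed (use assms(1) in \<open>auto simp: closed_segment_eq_real_ivl\<close>)
  thus ?thesis by (simp add: norm_minus_commute)
qed

text \<open>The tail of C/n^2 telescopes against 2C/n. The rate matters, not only the limit: summed
  against \<open>Lam d\<close>, an error K/y at y = N/d stays bounded by Chebyshev's
  estimate.\<close>

lemma converges_with_rate:
  fixes a :: "nat \<Rightarrow> complex"
  assumes "\<And>n. n \<ge> 1 \<Longrightarrow> norm (a (Suc n) - a n) \<le> C / real n ^ 2" and C: "C \<ge> 0"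
  obtains L where "\<And>n. n \<ge> 1 \<Longrightarrow> norm (a n - L) \<le> 2 * C / real n"
proof -
  have step: "norm (a (n + k) - a n) \<le> 2 * C / real n - 2 * C / real (n + k)" if n: "n \<ge> 1" for n k
  proof (induction k)
    case (Suc k)
    have "norm (a (n + Suc k) - a n) \<le> norm (a (Suc (n + k)) - a (n + k)) + norm (a (n + k) - a n)"
      using norm_triangle_ineq[of "a (Suc (n + k)) - a (n + k)" "a (n + k) - a n"] by simp
    also have "\<dots> \<le> C / real (n + k) ^ 2 + (2 * C / real n - 2 * C / real (n + k))"
      using n Suc by (intro add_mono assms) auto
    also have "C / real (n + k) ^ 2 \<le> 2 * C / real (n + k) - 2 * C / real (Suc (n + k))"
    proof -
      have "1 / x ^ 2 \<le> 2 / x - 2 / (x + 1)" if "x \<ge> 1" for x :: real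
      proof -
        have "1 / x ^ 2 = 2 / (x * (x + x))" using that by (simp add: power2_eq_square)
        also have "\<dots> \<le> 2 / (x * (x + 1))"
          using that by (intro divide_left_mono mult_left_mono mult_pos_pos) auto
        also have "\<dots> = 2 / x - 2 / (x + 1)" using that by (simp add: field_simps)
        finally show ?thesis .
      qed
      from this[of "real (n + k)"] have "1 / real (n + k) ^ 2 \<le> 2 / real (n + k) - 2 / (real (n + k) + 1)"
        using n by simp
      from mult_left_mono[OF this C] show ?thesis by (simp add: algebra_simps)
    qed
    finally show ?case by simp
  qed simp
  have "Cauchy a"
  proof (rule metric_CauchyI)
    fix e :: real assume e: "e > 0"
    show "\<exists>M. \<forall>m\<ge>M. \<forall>n\<ge>M. dist (a m) (a n) < e"
    proof (intro exI allI impI)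
      fix m n assume "m \<ge> nat \<lceil>4 * C / e\<rceil> + 1" "n \<ge> nat \<lceil>4 * C / e\<rceil> + 1"
      hence mn: "m \<ge> 1" "n \<ge> 1" "4 * C / e < real m" "4 * C / e < real n" by linarith+
      have *: "dist (a m) (a n) < e" if "m \<le> n" "m \<ge> 1" "4 * C / e < real m" for m n
      proof -
        have "2 * C / real m < e" using that e C by (simp add: field_simps)
        thus ?thesis using step[of m "n - m"] that C
          by (simp add: dist_norm norm_minus_commute) (smt (verit) divide_nonneg_nonneg of_nat_0_le_iff)
      qed
      show "dist (a m) (a n) < e" 
        using *[of m n] *[of n m] mn by (cases "m \<le> n") (auto simp: dist_commute)
    qed
  qed
  then obtain L where L: "a \<longlonglongrightarrow> L" using Cauchy_convergent_iff convergent_def by blast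
  show ?thesis
  proof
    fix n :: nat assume n: "n \<ge> 1"
    have "(\<lambda>k. norm (a (n + k) - a n)) \<longlonglongrightarrow> norm (L - a n)"
      using LIMSEQ_ignore_initial_segment[OF L, of n]
      by (intro tendsto_intros) (simp add: add.commute)
    moreover have "norm (a (n + k) - a n) \<le> 2 * C / real n" for k
      using step[OF n, of k] C by (smt (verit) divide_nonneg_nonneg of_nat_0_le_iff)
    ultimately have "norm (L - a n) \<le> 2 * C / real n"
      by (intro tendsto_upperbound[of _ "norm (L - a n)" sequentially]) auto
    thus "norm (a n - L) \<le> 2 * C / real n" by (simp add: norm_minus_commute)
  qed
qed

text \<open>Z is zeta(1 + it), met here as a limit of partial sums, and the second term is the
  antiderivative of u^(-1-it). The real variable y is free in [n, n + 1) because the formula is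
  applied with n = \<open>N div d\<close> and y = N/d.\<close>

lemma zeta_partial_sums:
  fixes t :: real
  assumes t: "t \<noteq> 0"
  defines "\<tau> \<equiv> \<i> * of_real t"
  obtains Z K where "K \<ge> 0"
    "\<And>n y. 1 \<le> n \<Longrightarrow> real n \<le> y \<Longrightarrow> y < real n + 1 \<Longrightarrow>
       norm ((\<Sum>m=1..n. E (-1 - \<tau>) (real m)) - (Z + \<i> / of_real t * E (-\<tau>) y)) \<le> K / y"
proof -
  define Psi where "Psi u = \<i> / of_real t * E (-\<tau>) u" for u
  define phi where "phi u = E (-1 - \<tau>) u" for u
  define C where "C = norm (-1 - \<tau>)"
  have C: "C \<ge> 0" by (simp add: C_def)
  have dPsi: "(Psi has_vector_derivative phi u) (at u within S)" if "u > 0" for u S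
  proof -
    have "(Psi has_vector_derivative \<i> / of_real t * (-\<tau> * E (-\<tau> - 1) u)) (at u within S)"
      unfolding Psi_def by (intro has_vector_derivative_mult_right has_vector_derivative_E that)
    also have "\<i> / of_real t * (-\<tau> * E (-\<tau> - 1) u) = phi u"
      using t by (simp add: E_uminus_diff_1) (simp add: phi_def \<tau>_def field_simps)
    finally show ?thesis .
  qed
  have dphi: "(phi has_vector_derivative (-1 - \<tau>) * E (-2 - \<tau>) u) (at u within S)" if "u > 0" for u S
    using has_vector_derivative_E[OF that, of "-1 - \<tau>" S] unfolding E_minus_1_diff_1 by (simp add: phi_def[abs_def])
  have norm_phi: "norm (phi u) = 1 / u" if "u > 0" for u
    using that by (simp add: phi_def norm_E \<tau>_def exp_minus field_simps)
  have norm_dphi: "norm ((-1 - \<tau>) * E (-2 - \<tau>) u) = C / u ^ 2" if "u > 0" for u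
  proof -
    have "exp (ln u * 2) = u ^ 2" using that exp_add[of "ln u" "ln u"] by (simp add: power2_eq_square mult.commute)
    thus ?thesis unfolding norm_mult C_def norm_E using that by (simp add: \<tau>_def exp_minus field_simps)
  qed
  define a where "a n = (\<Sum>m=1..n. phi (real m)) - Psi (real n)" for n
  have "norm (a (Suc n) - a n) \<le> C / real n ^ 2" if n: "n \<ge> 1" for n
  proof -
    have "a (Suc n) - a n = phi (real n + 1) - (Psi (real n + 1) - Psi (real n))"
      by (simp add: a_def add.commute)
    also have "norm \<dots> \<le> C / real n ^ 2"
    proof (rule euler_maclaurin_step[OF dPsi dphi])
      fix u assume u: "u \<in> {real n..real n + 1}"
      have "norm ((-1 - \<tau>) * E (-2 - \<tau>) u) = C / u ^ 2" using u n by (intro norm_dphi) auto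
      also have "\<dots> \<le> C / real n ^ 2"
        using u n C by (intro divide_left_mono power_mono mult_pos_pos zero_less_power) auto
      finally show "norm ((-1 - \<tau>) * E (-2 - \<tau>) u) \<le> C / real n ^ 2" .
    qed (use n in auto)
    finally show ?thesis .
  qed
  then obtain Z where Z: "\<And>n. n \<ge> 1 \<Longrightarrow> norm (a n - Z) \<le> 2 * C / real n"
    using converges_with_rate[of a C] C by blast
  show ?thesis
  proof (rule that[of "4 * C + 2" Z])
    fix n :: nat and y :: real assume n: "1 \<le> n" "real n \<le> y" "y < real n + 1"
    have "norm (Psi (real n) - Psi y) \<le> 1 / real n * \<bar>real n - y\<bar>"
    proof (rule norm_diff_le_vector_derivative[where a = "real n" and b = y])
      fix u assume u: "u \<in> {real n..y}"
      show "(Psi has_vector_derivative phi u) (at u within {real n..y})" using u n by (intro dPsi) auto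
      show "norm (phi u) \<le> 1 / real n" using u n by (subst norm_phi) (auto simp: frac_le)
    qed (use n in auto)
    also have "\<dots> \<le> 1 / real n * 1" using n by (intro mult_left_mono) auto
    finally have P: "norm (Psi (real n) - Psi y) \<le> 1 / real n" by simp
    have "norm ((\<Sum>m=1..n. phi (real m)) - (Z + Psi y)) = norm ((a n - Z) + (Psi (real n) - Psi y))"
      by (simp add: a_def algebra_simps)
    also have "\<dots> \<le> 2 * C / real n + 1 / real n"
      using norm_triangle_ineq[of "a n - Z" "Psi (real n) - Psi y"] Z[OF n(1)] P by linarith
    also have "\<dots> = (2 * C + 1) / real n" by (simp add: add_divide_distrib)
    also have "\<dots> = (4 * C + 2) / (2 * real n)" using n by (simp add: field_simps)
    also have "\<dots> \<le> (4 * C + 2) / y" using n C by (intro divide_left_mono mult_pos_pos) auto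
    finally show "norm ((\<Sum>m=1..n. E (-1 - \<tau>) (real m)) - (Z + \<i> / of_real t * E (-\<tau>) y)) \<le> (4 * C + 2) / y"
      by (simp add: phi_def Psi_def)
  qed (use C in auto)
qed

lemma norm_le_sum_increments:
  fixes a :: "nat \<Rightarrow> complex"
  assumes "\<And>n. n \<ge> 1 \<Longrightarrow> norm (a (Suc n) - a n) \<le> c n" and "n \<ge> 1"
  shows "norm (a n) \<le> norm (a 1) + (\<Sum>k=1..<n. c k)"
  using \<open>n \<ge> 1\<close>
proof (induction n rule: nat_induct_at_least)
  case (Suc n)
  have "norm (a (Suc n)) \<le> norm (a (Suc n) - a n) + norm (a n)"
    using norm_triangle_ineq[of "a (Suc n) - a n" "a n"] by simp
  thus ?case using Suc assms(1)[of n] by simp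
qed auto

lemma sum_inverse_le: "n \<ge> 1 \<Longrightarrow> (\<Sum>k=1..n. 1 / real k) \<le> 1 + ln (real n)"
  using decseqD[OF decseq_harm_diff_ln, of 0 "n - 1"] by (simp add: harm_def field_simps)

text \<open>The companion of the previous formula with exponent -it, for the case of a vanishing
  zeta value. The increments are now of size |t|/n and no longer summable, which is why the error is
  logarithmic.\<close>

lemma sum_imaginary_powers:
  fixes t :: real
  defines "\<tau> \<equiv> \<i> * of_real t"
  obtains K where "K \<ge> 0"
    "\<And>n y. 1 \<le> n \<Longrightarrow> real n \<le> y \<Longrightarrow> y < real n + 1 \<Longrightarrow>
       norm ((\<Sum>m=1..n. E (-\<tau>) (real m)) - E (1 - \<tau>) y / (1 - \<tau>)) \<le> K * (1 + ln y)"
proof -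
  have nz: "1 - \<tau> \<noteq> 0" by (simp add: \<tau>_def complex_eq_iff)
  define Psi where "Psi u = E (1 - \<tau>) u / (1 - \<tau>)" for u
  define phi where "phi u = E (-\<tau>) u" for u
  have dPsi: "(Psi has_vector_derivative phi u) (at u within S)" if "u > 0" for u S
  proof -
    have "((\<lambda>u. 1 / (1 - \<tau>) * E (1 - \<tau>) u) has_vector_derivative
            1 / (1 - \<tau>) * ((1 - \<tau>) * E (1 - \<tau> - 1) u)) (at u within S)"
      by (intro has_vector_derivative_mult_right has_vector_derivative_E that)
    thus ?thesis using nz by (simp add: Psi_def[abs_def] phi_def)
  qed
  have dphi: "(phi has_vector_derivative -\<tau> * E (-1 - \<tau>) u) (at u within S)" if "u > 0" for u S
    using has_vector_derivative_E[OF that, of "-\<tau>" S] unfolding E_uminus_diff_1 by (simp add: phi_def[abs_def])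
  have norm_phi: "norm (phi u) = 1" for u by (simp add: phi_def \<tau>_def)
  have norm_dphi: "norm (-\<tau> * E (-1 - \<tau>) u) = \<bar>t\<bar> / u" if "u > 0" for u
    using that by (simp add: norm_mult norm_E \<tau>_def exp_minus field_simps)
  define a where "a n = (\<Sum>m=1..n. phi (real m)) - Psi (real n)" for n
  have inc: "norm (a (Suc n) - a n) \<le> \<bar>t\<bar> / real n" if n: "n \<ge> 1" for n
  proof -
    have "a (Suc n) - a n = phi (real n + 1) - (Psi (real n + 1) - Psi (real n))"
      by (simp add: a_def add.commute)
    also have "norm \<dots> \<le> \<bar>t\<bar> / real n"
    proof (rule euler_maclaurin_step[OF dPsi dphi])
      fix u assume u: "u \<in> {real n..real n + 1}"
      show "norm (-\<tau> * E (-1 - \<tau>) u) \<le> \<bar>t\<bar> / real n"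
        using u n by (subst norm_dphi) (auto intro!: divide_left_mono mult_pos_pos)
    qed (use n in auto)
    finally show ?thesis .
  qed
  define K where "K = norm (a 1) + \<bar>t\<bar> + 1"
  show ?thesis
  proof (rule that[of K])
    show "K \<ge> 0" by (simp add: K_def)
    fix n :: nat and y :: real assume n: "1 \<le> n" "real n \<le> y" "y < real n + 1"
    have "norm (Psi (real n) - Psi y) \<le> 1 * \<bar>real n - y\<bar>"
    proof (rule norm_diff_le_vector_derivative[where a = "real n" and b = y])
      fix u assume u: "u \<in> {real n..y}"
      show "(Psi has_vector_derivative phi u) (at u within {real n..y})" using u n by (intro dPsi) auto
    qed (use n norm_phi in auto)
    hence P: "norm (Psi (real n) - Psi y) \<le> 1" using n by simp
    have "norm (a n) \<le> norm (a 1) + (\<Sum>k=1..<n. \<bar>t\<bar> / real k)"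
      using inc n(1) by (rule norm_le_sum_increments)
    also have "(\<Sum>k=1..<n. \<bar>t\<bar> / real k) \<le> (\<Sum>k=1..n. \<bar>t\<bar> / real k)"
      by (intro sum_mono2) auto
    also have "\<dots> = \<bar>t\<bar> * (\<Sum>k=1..n. 1 / real k)" by (simp add: sum_distrib_left)
    also have "\<dots> \<le> \<bar>t\<bar> * (1 + ln (real n))" by (intro mult_left_mono sum_inverse_le n) auto
    also have "\<dots> \<le> \<bar>t\<bar> * (1 + ln y)" using n by (intro mult_left_mono) auto
    finally have A: "norm (a n) \<le> norm (a 1) + \<bar>t\<bar> * (1 + ln y)" by simp
    have y: "1 + ln y \<ge> 1" using n by simp
    have "norm ((\<Sum>m=1..n. phi (real m)) - Psi y) = norm (a n + (Psi (real n) - Psi y))"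
      by (simp add: a_def)
    also have "\<dots> \<le> (norm (a 1) + 1) * 1 + \<bar>t\<bar> * (1 + ln y)"
      using norm_triangle_ineq[of "a n" "Psi (real n) - Psi y"] A P by simp
    also have "\<dots> \<le> (norm (a 1) + 1) * (1 + ln y) + \<bar>t\<bar> * (1 + ln y)"
      using y by (intro add_mono mult_left_mono) auto
    also have "\<dots> = K * (1 + ln y)" by (simp add: K_def algebra_simps)
    finally show "norm ((\<Sum>m=1..n. E (-\<tau>) (real m)) - E (1 - \<tau>) y / (1 - \<tau>)) \<le> K * (1 + ln y)"
      by (simp add: phi_def Psi_def)
  qed
qed

lemma sum_ln_powers:
  fixes t :: real
  assumes t: "t \<noteq> 0"
  defines "\<tau> \<equiv> \<i> * of_real t"
  obtains K where
    "\<And>n. 1 \<le> n \<Longrightarrow>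
       norm ((\<Sum>m=1..n. of_real (ln (real m)) * E (-1 - \<tau>) (real m)) -
         \<i> / of_real t * E (-\<tau>) (real n) * of_real (ln (real n))) \<le> K"
proof -
  \<comment> \<open>Integration by parts: differentiating the first term leaves a surplus of (i/t)
    u^(-1-it), which the second term removes. The second term has modulus 1/t^2 on the positive axis
    and goes into the constant.\<close>
  define Psi where "Psi u = \<i> / of_real t * (of_real (ln u) * E (-\<tau>) u) + 1 / of_real t ^ 2 * E (-\<tau>) u" for u
  define phi where "phi u = of_real (ln u) * E (-1 - \<tau>) u" for u
  define phi' where "phi' u = of_real (ln u) * ((-1 - \<tau>) * E (-2 - \<tau>) u) + of_real (1 / u) * E (-1 - \<tau>) u" for u
  define C where "C = norm (-1 - \<tau>)"
  have C: "C \<ge> 0" by (simp add: C_def)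
  have dln: "((\<lambda>u. of_real (ln u) :: complex) has_vector_derivative of_real (1 / u)) (at u within S)"
    if "u > 0" for u S
    using that DERIV_ln_divide[of u]
    by (intro has_vector_derivative_of_real)
       (auto simp flip: has_real_derivative_iff_has_vector_derivative intro: DERIV_subset)
  have dPsi: "(Psi has_vector_derivative phi u) (at u within S)" if u: "u > 0" for u S
  proof -
    have "(Psi has_vector_derivative
       \<i> / of_real t * (of_real (ln u) * (-\<tau> * E (-\<tau> - 1) u) + of_real (1 / u) * E (-\<tau>) u)
       + 1 / of_real t ^ 2 * (-\<tau> * E (-\<tau> - 1) u)) (at u within S)"
      unfolding Psi_def
      by (intro has_vector_derivative_mult_right has_vector_derivative_E
            has_vector_derivative_add has_vector_derivative_mult dln u)
    also have "E (-\<tau>) u = of_real u * E (-\<tau> - 1) u"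
      using E_minus_1_minus[of u \<tau>] u unfolding E_uminus_diff_1 by simp
    also have "\<i> / of_real t * (of_real (ln u) * (-\<tau> * E (-\<tau> - 1) u) + of_real (1 / u) * (of_real u * E (-\<tau> - 1) u))
       + 1 / of_real t ^ 2 * (-\<tau> * E (-\<tau> - 1) u) = phi u"
      using t u unfolding E_uminus_diff_1 by (simp add: phi_def \<tau>_def field_simps power2_eq_square)
    finally show ?thesis .
  qed
  have dphi: "(phi has_vector_derivative phi' u) (at u within S)" if u: "u > 0" for u S
  proof -
    have "(phi has_vector_derivative of_real (ln u) * ((-1 - \<tau>) * E (-1 - \<tau> - 1) u) + of_real (1 / u) * E (-1 - \<tau>) u) (at u within S)"
      unfolding phi_def by (intro has_vector_derivative_E has_vector_derivative_mult dln u)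
    thus ?thesis unfolding E_minus_1_diff_1 by (simp add: phi'_def)
  qed
  have norm_dphi: "norm (phi' u) \<le> (ln u * C + 1) / u ^ 2" if u: "u \<ge> 1" for u
  proof -
    have "exp (ln u * 2) = u ^ 2" using u exp_add[of "ln u" "ln u"] by (simp add: power2_eq_square mult.commute)
    hence "norm (E (-2 - \<tau>) u) = 1 / u ^ 2" "norm (E (-1 - \<tau>) u) = 1 / u"
      using u by (simp_all add: norm_E \<tau>_def exp_minus field_simps)
    hence "norm (phi' u) \<le> ln u * (C * (1 / u ^ 2)) + 1 / u * (1 / u)"
      unfolding phi'_def using u
      by (intro order_trans[OF norm_triangle_ineq] add_mono) (auto simp: norm_mult C_def norm_divide)
    also have "\<dots> = (ln u * C + 1) / u ^ 2" using u by (simp add: field_simps power2_eq_square)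
    finally show ?thesis .
  qed
  define c where "c n = (ln (real n + 1) * C + 1) / real n ^ 2" for n :: nat
  have c_nonneg: "c n \<ge> 0" for n using C by (simp add: c_def)
  define a where "a n = (\<Sum>m=1..n. phi (real m)) - Psi (real n)" for n
  have inc: "norm (a (Suc n) - a n) \<le> c n" if n: "n \<ge> 1" for n
  proof -
    have "a (Suc n) - a n = phi (real n + 1) - (Psi (real n + 1) - Psi (real n))"
      by (simp add: a_def add.commute)
    also have "norm \<dots> \<le> c n"
    proof (rule euler_maclaurin_step[OF dPsi dphi])
      fix u assume u: "u \<in> {real n..real n + 1}"
      have "norm (phi' u) \<le> (ln u * C + 1) / u ^ 2" using u n by (intro norm_dphi) auto
      also have "\<dots> \<le> c n"
        unfolding c_def using u n C
        by (intro frac_le power_mono add_mono mult_right_mono add_nonneg_nonneg mult_nonneg_nonneg) auto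
      finally show "norm (phi' u) \<le> c n" .
    qed (use n in auto)
    finally show ?thesis .
  qed
  have "summable c"
  proof (rule summable_comparison_test[OF exI, of 1])
    show "summable (\<lambda>n. (2 * C + 1) * (real n powr (-3/2)))"
      by (intro summable_mult) (simp add: summable_real_powr_iff)
    show "\<forall>n\<ge>1. norm (c n) \<le> (2 * C + 1) * (real n powr (-3/2))"
    proof (intro allI impI)
      fix n :: nat assume n: "n \<ge> 1"
      \<comment> \<open>With n = r^2 the logarithm is at most 2 ln(1 + r) <= 2r, so
        \<open>c n\<close> is O(r^(-3)), that is O(n^(-3/2)).\<close>
      define r where "r = sqrt (real n)"
      have r: "r \<ge> 1" "real n = r ^ 2" using n by (auto simp: r_def)
      have "ln (real n + 1) \<le> ln ((1 + r) ^ 2)" using r by (simp add: power2_eq_square algebra_simps)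
      also have "\<dots> = 2 * ln (1 + r)" using r by (simp add: ln_realpow)
      also have "\<dots> \<le> 2 * r" using r ln_add_one_self_le_self[of r] by simp
      finally have "ln (real n + 1) * C + 1 \<le> 2 * r * C + 1 * r"
        using r C by (intro add_mono mult_right_mono) auto
      hence "c n \<le> (2 * r * C + 1 * r) / real n ^ 2"
        unfolding c_def by (intro divide_right_mono) auto
      also have "\<dots> = (2 * C + 1) * (1 / r ^ 3)"
        using r by (simp add: field_simps eval_nat_numeral)
      also have "1 / r ^ 3 = real n powr (-3/2)"
      proof -
        have "r = real n powr (1/2)" using n by (simp add: r_def powr_half_sqrt)
        hence "r ^ 3 = real n powr (3/2)" using n by (simp add: powr_power)
        thus ?thesis by (simp add: powr_minus field_simps)
      qed
      finally show "norm (c n) \<le> (2 * C + 1) * (real n powr (-3/2))" using c_nonneg[of n] by simp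
    qed
  qed
  define K where "K = norm (a 1) + suminf c + 1 / t ^ 2"
  show ?thesis
  proof (rule that[of K])
    fix n :: nat assume n: "1 \<le> n"
    have "norm (a n) \<le> norm (a 1) + (\<Sum>k=1..<n. c k)" using inc n by (rule norm_le_sum_increments)
    also have "(\<Sum>k=1..<n. c k) \<le> suminf c"
      by (intro sum_le_suminf \<open>summable c\<close> c_nonneg) auto
    finally have A: "norm (a n) \<le> norm (a 1) + suminf c" by simp
    have "norm ((\<Sum>m=1..n. phi (real m)) - \<i> / of_real t * E (-\<tau>) (real n) * of_real (ln (real n))) =
          norm (a n + 1 / of_real t ^ 2 * E (-\<tau>) (real n))"
      by (simp add: a_def Psi_def algebra_simps)
    also have "\<dots> \<le> norm (a n) + norm (1 / of_real t ^ 2 * E (-\<tau>) (real n))"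
      by (rule norm_triangle_ineq)
    also have "norm (1 / of_real t ^ 2 * E (-\<tau>) (real n)) = 1 / t ^ 2"
      by (simp add: norm_mult norm_divide \<tau>_def norm_power)
    finally show "norm ((\<Sum>m=1..n. of_real (ln (real m)) * E (-1 - \<tau>) (real m)) -
         \<i> / of_real t * E (-\<tau>) (real n) * of_real (ln (real n))) \<le> K"
      using A by (simp add: K_def phi_def)
  qed
qed

subsection \<open>Multiplicative functions on squarefree numbers\<close>

text \<open>\<open>prime_factors n\<close> is a set, so its product is the radical of n and equals n
  exactly for squarefree n; 0 is excluded because the empty product is 1. One encoding serves both
  the Moebius function and the coefficients of the singular series.\<close>

definition sqf_mult :: "(nat \<Rightarrow> real) \<Rightarrow> nat \<Rightarrow> real" where
  "sqf_mult f n = (if \<Prod>(prime_factors n) = n then \<Prod>p\<in>prime_factors n. f p else 0)"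

lemma prime_factors_prod_primes:
  fixes A :: "nat set"
  assumes "finite A" "\<And>p. p \<in> A \<Longrightarrow> prime p"
  shows "prime_factors (\<Prod>A) = A"
proof -
  have "prime_factors (\<Prod>A) = (\<Union>p\<in>A. prime_factors p)"
    using assms by (subst prime_factors_prod) (force simp: o_def)+
  also have "\<dots> = (\<Union>p\<in>A. {p})"
    using assms by (intro SUP_cong) (auto simp: prime_prime_factors)
  finally show ?thesis by simp
qed

lemma prod_primes_dvd:
  fixes A :: "nat set"
  assumes "finite A" "\<And>p. p \<in> A \<Longrightarrow> prime p" "\<And>p. p \<in> A \<Longrightarrow> p dvd n"
  shows "\<Prod>A dvd n"
  using assms
proof (induction A rule: finite_induct)
  case (insert q A)
  have "coprime q (\<Prod>A)"
    using insert by (intro prod_coprime_right) (metis insert_iff primes_coprime)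
  thus ?case using insert by (auto intro: divides_mult)
qed auto

text \<open>Expanding the product gives one term per set of primes dividing n, and these sets
  correspond to the squarefree divisors by taking products.\<close>

lemma sum_sqf_mult:
  assumes "n > 0"
  shows "(\<Sum>d | d dvd n. sqf_mult f d) = (\<Prod>p\<in>prime_factors n. 1 + f p)"
proof -
  have "(\<Prod>p\<in>prime_factors n. f p + 1) = (\<Sum>X\<in>Pow (prime_factors n). (\<Prod>p\<in>X. f p))"
    by (subst prod_add) auto
  also have "\<dots> = (\<Sum>d\<in>{d. d dvd n \<and> \<Prod>(prime_factors d) = d}. \<Prod>p\<in>prime_factors d. f p)"
  proof (rule sum.reindex_bij_witness[where i = prime_factors and j = Prod], goal_cases)
    case (1 A)
    thus ?case by (intro prime_factors_prod_primes) (auto intro: finite_subset)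
  next
    case (2 A)
    hence "prime_factors (\<Prod>A) = A"
      by (intro prime_factors_prod_primes) (auto intro: finite_subset)
    moreover have "\<Prod>A dvd n"
      using 2 by (intro prod_primes_dvd) (auto intro: finite_subset)
    ultimately show ?case by simp
  next
    case (4 d)
    thus ?case using assms dvd_prime_factors by auto
  next
    case (5 A)
    hence "prime_factors (\<Prod>A) = A"
      by (intro prime_factors_prod_primes) (auto intro: finite_subset)
    thus ?case by simp
  qed auto
  also have "\<dots> = (\<Sum>d | d dvd n. sqf_mult f d)"
    unfolding sqf_mult_def using assms by (subst sum.inter_filter[symmetric]) (auto intro!: sum.cong)
  finally show ?thesis by (simp add: add.commute)
qed

definition mu :: "nat \<Rightarrow> real" where "mu = sqf_mult (\<lambda>_. -1)"

lemma abs_mu_le: "\<bar>mu n\<bar> \<le> 1"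
  by (simp add: mu_def sqf_mult_def power_abs)

lemma sum_mu: "n > 0 \<Longrightarrow> (\<Sum>d | d dvd n. mu d) = (if n = 1 then 1 else 0)"
proof (cases "n = 1")
  case False
  moreover assume "n > 0"
  ultimately have "prime_factors n \<noteq> {}"
    using prime_factor_nat[of n] by (auto simp: prime_factors_dvd)
  thus ?thesis using \<open>n > 0\<close> False by (simp add: mu_def sum_sqf_mult card_gt_0_iff)
qed (simp add: mu_def sqf_mult_def)

text \<open>Moebius inversion of \<open>mangoldt_sum\<close>: expand ln(n/d) as a divisor sum of
  \<open>Lam\<close> and exchange the order, so that the inner sum of \<open>mu\<close> vanishes
  unless e = n.\<close>

lemma sum_mu_ln:
  assumes "n > 0"
  shows "(\<Sum>d | d dvd n. mu d * ln (real n / real d)) = Lam n"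
proof -
  have "(\<Sum>d | d dvd n. mu d * ln (real n / real d)) = (\<Sum>d | d dvd n. \<Sum>e | e dvd n div d. mu d * Lam e)"
  proof (intro sum.cong refl)
    fix d assume d: "d \<in> {d. d dvd n}"
    hence "n div d > 0" using assms by (auto elim!: dvdE)
    hence "(\<Sum>e | e dvd n div d. Lam e) = ln (real (n div d))" by (simp add: mangoldt_sum)
    also have "real (n div d) = real n / real d" using d by (simp add: real_of_nat_div)
    finally show "mu d * ln (real n / real d) = (\<Sum>e | e dvd n div d. mu d * Lam e)"
      by (simp flip: sum_distrib_left)
  qed
  also have "\<dots> = (\<Sum>e | e dvd n. \<Sum>d | d dvd n div e. mu d * Lam e)"
  proof -
    have fin: "finite {e. e dvd n div d}" if "d dvd n" for d
      using assms that by (intro finite_divisors_nat) (auto elim!: dvdE)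
    have "(\<Sum>d | d dvd n. \<Sum>e | e dvd n div d. mu d * Lam e)
        = (\<Sum>(d, e)\<in>(SIGMA d:{d. d dvd n}. {e. e dvd n div d}). mu d * Lam e)"
      using assms fin by (subst sum.Sigma) auto
    also have "\<dots> = (\<Sum>(e, d)\<in>(SIGMA e:{e. e dvd n}. {d. d dvd n div e}). mu d * Lam e)"
    proof (rule sum.reindex_bij_witness[where i = "\<lambda>(a, b). (b, a)" and j = "\<lambda>(a, b). (b, a)"], goal_cases)
      case (2 a)
      then show ?case using assms by (auto elim!: dvdE)
    next
      case (4 a)
      then show ?case using assms by (auto elim!: dvdE)
    qed auto
    also have "\<dots> = (\<Sum>e | e dvd n. \<Sum>d | d dvd n div e. mu d * Lam e)"
      using assms fin by (subst sum.Sigma) auto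
    finally show ?thesis .
  qed
  also have "\<dots> = (\<Sum>e | e dvd n. if e = n then Lam e else 0)"
  proof (intro sum.cong refl)
    fix e assume "e \<in> {e. e dvd n}"
    hence "n div e > 0" and eq: "n div e = 1 \<longleftrightarrow> e = n" using assms by (auto elim!: dvdE)
    hence "(\<Sum>d | d dvd n div e. mu d) = (if e = n then 1 else 0)"
      by (subst sum_mu) auto
    thus "(\<Sum>d | d dvd n div e. mu d * Lam e) = (if e = n then Lam e else 0)"
      by (simp flip: sum_distrib_right)
  qed
  also have "\<dots> = Lam n" using assms by (subst sum.delta) auto
  finally show ?thesis .
qed

subsection \<open>Twisted Mertens sums\<close>

definition mangoldt_twist :: "real \<Rightarrow> nat \<Rightarrow> complex" where
  "mangoldt_twist t N = (\<Sum>d=1..N. of_real (Lam d) * E (-1 - \<i> * of_real t) (real d))"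

text \<open>Exactly the conditions under which the partial sum formulas apply with n =
  \<open>N div d\<close> and y = N/d.\<close>

lemma div_bounds:
  assumes "1 \<le> d" "d \<le> (N::nat)"
  shows "1 \<le> N div d" "real (N div d) \<le> real N / real d" "real N / real d < real (N div d) + 1"
proof -
  show "1 \<le> N div d" using assms by (simp add: less_eq_div_iff_mult_less_eq)
  show "real (N div d) \<le> real N / real d" by (rule of_nat_div_le_of_nat)
  have "N < d * (N div d + 1)" using assms by (simp add: dividend_less_times_div)
  hence "real N < real (d * (N div d + 1))" by (simp only: of_nat_less_iff)
  thus "real N / real d < real (N div d) + 1" using assms by (simp add: field_simps)
qed

text \<open>Write ln as the divisor sum of \<open>Lam\<close> in the sum of ln(n) n^(-1-it). The
  inner sums are Z + (i/t)(N/d)^(-it) + O(d/N), so the total is Z times the twisted sum plus (i/t)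
  N^(-it) times the Mertens sum, up to O(1). By \<open>sum_ln_powers\<close> it also equals (i/t)
  N^(-it) ln N + O(1). The logarithms cancel, and it remains to divide by Z.\<close>

lemma mangoldt_twist_bounded_if_nonzero:
  fixes t K :: real and Z :: complex
  assumes t: "t \<noteq> 0" and Z: "Z \<noteq> 0" and K: "K \<ge> 0"
    and bound: "\<And>n y. 1 \<le> n \<Longrightarrow> real n \<le> y \<Longrightarrow> y < real n + 1 \<Longrightarrow>
       norm ((\<Sum>m=1..n. E (-1 - \<i> * of_real t) (real m)) - (Z + \<i> / of_real t * E (-(\<i> * of_real t)) y)) \<le> K / y"
  obtains B where "\<And>N. N \<ge> 1 \<Longrightarrow> norm (mangoldt_twist t N) \<le> B"
proof -
  define \<tau> where "\<tau> = \<i> * of_real t"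
  obtain K3 where K3: "\<And>n. 1 \<le> n \<Longrightarrow>
       norm ((\<Sum>m=1..n. of_real (ln (real m)) * E (-1 - \<tau>) (real m)) -
         \<i> / of_real t * E (-\<tau>) (real n) * of_real (ln (real n))) \<le> K3"
    using sum_ln_powers[OF t] unfolding \<tau>_def by blast
  define B where "B = (K3 + 4 / \<bar>t\<bar> + 4 * K) / norm Z"
  show ?thesis
  proof (rule that[of B])
    fix N :: nat assume N: "N \<ge> 1"
    define M where "M = (\<Sum>d=1..N. Lam d / real d)"
    define T where "T = (\<Sum>n=1..N. of_real (ln (real n)) * E (-1 - \<tau>) (real n))"
    define c where "c = \<i> / of_real t * E (-\<tau>) (real N)"
    define S where "S d = (\<Sum>m=1..N div d. E (-1 - \<tau>) (real m))" for d
    have norm_c: "norm c = 1 / \<bar>t\<bar>" by (simp add: c_def norm_mult norm_divide \<tau>_def)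
    have "T = (\<Sum>n=1..N. \<Sum>d | d dvd n. of_real (Lam d) * E (-1 - \<tau>) (real d) * E (-1 - \<tau>) (real (n div d)))"
      unfolding T_def
    proof (intro sum.cong refl)
      fix n assume n: "n \<in> {1..N}"
      have "(\<Sum>d | d dvd n. of_real (Lam d) * E (-1 - \<tau>) (real d) * E (-1 - \<tau>) (real (n div d)))
          = (\<Sum>d | d dvd n. of_real (Lam d) * E (-1 - \<tau>) (real n))"
      proof (intro sum.cong refl)
        fix d assume "d \<in> {d. d dvd n}"
        then obtain m where m: "n = d * m" by auto
        hence "d > 0" "m > 0" using n by auto
        thus "of_real (Lam d) * E (-1 - \<tau>) (real d) * E (-1 - \<tau>) (real (n div d)) = of_real (Lam d) * E (-1 - \<tau>) (real n)"
          by (simp add: m E_mult del: of_real_mangoldt)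
      qed
      also have "\<dots> = of_real (\<Sum>d | d dvd n. Lam d) * E (-1 - \<tau>) (real n)"
        by (simp add: sum_distrib_right del: of_real_mangoldt)
      finally show "of_real (ln (real n)) * E (-1 - \<tau>) (real n) =
        (\<Sum>d | d dvd n. of_real (Lam d) * E (-1 - \<tau>) (real d) * E (-1 - \<tau>) (real (n div d)))"
        using n by (subst (asm) mangoldt_sum) auto
    qed
    also have "\<dots> = (\<Sum>d=1..N. \<Sum>m=1..N div d. of_real (Lam d) * E (-1 - \<tau>) (real d) * E (-1 - \<tau>) (real m))"
      by (rule sum_dvd_swap[of "\<lambda>d m. of_real (Lam d) * E (-1 - \<tau>) (real d) * E (-1 - \<tau>) (real m)"])
    also have "\<dots> = (\<Sum>d=1..N. of_real (Lam d) * E (-1 - \<tau>) (real d) * S d)"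
      unfolding S_def by (simp add: sum_distrib_left del: of_real_mangoldt)
    finally have T: "T = (\<Sum>d=1..N. of_real (Lam d) * E (-1 - \<tau>) (real d) * S d)" .
    have "norm (T - (Z * mangoldt_twist t N + c * of_real M)) =
          norm (\<Sum>d=1..N. of_real (Lam d) * E (-1 - \<tau>) (real d) * (S d - (Z + \<i> / of_real t * E (-\<tau>) (real N / real d))))"
    proof -
      have c: "E (-1 - \<tau>) (real d) * (\<i> / of_real t * E (-\<tau>) (real N / real d)) = c / of_real (real d)"
        if "d \<in> {1..N}" for d
        using that N by (simp add: c_def E_minus_1_minus E_divide)
      have "T - (Z * mangoldt_twist t N + c * of_real M) =
         (\<Sum>d=1..N. of_real (Lam d) * E (-1 - \<tau>) (real d) * S d
            - of_real (Lam d) * E (-1 - \<tau>) (real d) * Z - of_real (Lam d) * (c / of_real (real d)))"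
        unfolding T M_def mangoldt_twist_def
        by (simp add: sum_subtractf sum_distrib_left sum_distrib_right \<tau>_def mult_ac del: of_real_mangoldt)
      also have "\<dots> = (\<Sum>d=1..N. of_real (Lam d) * E (-1 - \<tau>) (real d) * (S d - (Z + \<i> / of_real t * E (-\<tau>) (real N / real d))))"
        by (intro sum.cong refl) (subst c[symmetric], simp_all add: algebra_simps del: of_real_mangoldt)
      finally show ?thesis by simp
    qed
    \<comment> \<open>The factor 1/d of the summand cancels the d in the error K d/N, so Chebyshev's
      bound applies to the plain sum of \<open>Lam\<close>.\<close>
    also have "\<dots> \<le> (\<Sum>d=1..N. Lam d * (K / real N))"
    proof (intro order_trans[OF norm_sum] sum_mono)
      fix d assume d: "d \<in> {1..N}"
      have nE: "norm (E (-1 - \<tau>) (real d)) = 1 / real d"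
        using d by (simp add: E_minus_1_minus norm_divide \<tau>_def)
      have "norm (S d - (Z + \<i> / of_real t * E (-\<tau>) (real N / real d))) \<le> K / (real N / real d)"
        unfolding S_def \<tau>_def using d by (intro bound div_bounds) auto
      hence "Lam d * (1 / real d) * norm (S d - (Z + \<i> / of_real t * E (-\<tau>) (real N / real d)))
          \<le> Lam d * (1 / real d) * (K / (real N / real d))"
        by (intro mult_left_mono) (auto simp: mangoldt_nonneg)
      also have "\<dots> = Lam d * (K / real N)" using d by (simp add: field_simps)
      finally show "norm (of_real (Lam d) * E (-1 - \<tau>) (real d) * (S d - (Z + \<i> / of_real t * E (-\<tau>) (real N / real d))))
          \<le> Lam d * (K / real N)"
        by (simp add: norm_mult nE)
    qed
    also have "\<dots> = psi N * (K / real N)" by (simp only: psi_def sum_distrib_right)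
    also have "\<dots> \<le> 4 * real N * (K / real N)"
      using K by (intro mult_right_mono psi_le) auto
    also have "\<dots> = 4 * K" using N by simp
    finally have 1: "norm (T - (Z * mangoldt_twist t N + c * of_real M)) \<le> 4 * K" .
    have 2: "norm (T - c * of_real (ln (real N))) \<le> K3" using K3[OF N] by (simp add: T_def c_def)
    have "norm (c * of_real (ln (real N) - M)) = 1 / \<bar>t\<bar> * \<bar>ln (real N) - M\<bar>"
      by (simp only: norm_mult norm_c norm_of_real)
    also have "\<dots> \<le> 1 / \<bar>t\<bar> * 4"
      using mertens_first[OF N] by (intro mult_left_mono) (auto simp: M_def)
    finally have 3: "norm (c * of_real (ln (real N) - M)) \<le> 4 / \<bar>t\<bar>" by simp
    have eq: "Z * mangoldt_twist t N = (T - c * of_real (ln (real N))) + c * of_real (ln (real N) - M)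
            - (T - (Z * mangoldt_twist t N + c * of_real M))"
      by (simp add: algebra_simps)
    have "norm (Z * mangoldt_twist t N) \<le> K3 + 4 / \<bar>t\<bar> + 4 * K"
      by (subst eq) (use norm_triangle_ineq4[of "(T - c * of_real (ln (real N))) + c * of_real (ln (real N) - M)"
            "T - (Z * mangoldt_twist t N + c * of_real M)"]
        norm_triangle_ineq[of "T - c * of_real (ln (real N))" "c * of_real (ln (real N) - M)"] 1 2 3
      in linarith)
    thus "norm (mangoldt_twist t N) \<le> B" using Z by (simp add: B_def norm_mult field_simps)
  qed
qed

lemma sum_inverse_sqrt_le: "(\<Sum>n=1..N. 1 / sqrt (real n)) \<le> 2 * sqrt (real N)"
proof (induction N)
  case (Suc N)
  define a b where "a = sqrt (real N)" and "b = sqrt (real (Suc N))"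
  have ab: "0 \<le> a" "a \<le> b" "0 < b" "b ^ 2 = a ^ 2 + 1" by (auto simp: a_def b_def)
  have "1 \<le> 2 * b * (b - a)"
  proof -
    have "1 = (b + a) * (b - a)" using ab by (simp add: power2_eq_square algebra_simps)
    also have "\<dots> \<le> (2 * b) * (b - a)" using ab by (intro mult_right_mono) auto
    finally show ?thesis .
  qed
  hence "1 / b \<le> 2 * b - 2 * a" using ab by (simp add: field_simps)
  thus ?case using Suc by (simp add: a_def b_def)
qed auto

text \<open>Any exponent below 1 would do: what counts is that summing (N/n)^(1/2) over n <= N gives
  O(N) and not O(N ln N).\<close>

lemma ln_mult_le_sqrt:
  assumes "y \<ge> (1::real)"
  shows "ln y * (1 + ln y) \<le> 16 * sqrt y"
proof -
  define q where "q = sqrt (sqrt y)"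
  have q: "q \<ge> 1" "sqrt y = q ^ 2" using assms by (auto simp: q_def)
  have "y = q ^ 4"
    using q assms by (metis power2_eq_square power4_eq_xxxx mult.assoc real_sqrt_pow2 zero_le_one order_trans)
  hence "ln y = 4 * ln q" using q by (simp add: ln_realpow)
  moreover have "ln q \<le> q - 1" using q by (intro ln_le_minus_one) auto
  ultimately have "ln y \<le> 4 * q" "1 + ln y \<le> 4 * q" using q by auto
  hence "ln y * (1 + ln y) \<le> (4 * q) * (4 * q)" using assms q by (intro mult_mono) auto
  thus ?thesis using q by (simp add: power2_eq_square)
qed

text \<open>If the zeta value vanishes, the Tatuzawa--Iseki identity with weight $F(x) = x - \kappa$
  determines the twisted Mertens sum up to a bounded error; $\kappa$ is chosen such that
  $\sum_{m \le x} m^{-it} F(x/m)$ has no main term.\<close>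

lemma mangoldt_twist_if_zero:
  fixes t K :: real
  assumes t: "t \<noteq> 0" and K: "K \<ge> 0"
    and bound: "\<And>n y. 1 \<le> n \<Longrightarrow> real n \<le> y \<Longrightarrow> y < real n + 1 \<Longrightarrow>
       norm ((\<Sum>m=1..n. E (-1 - \<i> * of_real t) (real m)) - \<i> / of_real t * E (-(\<i> * of_real t)) y) \<le> K / y"
  obtains B where "\<And>N. N \<ge> 1 \<Longrightarrow> norm (mangoldt_twist t N + of_real (ln (real N))) \<le> B"
proof -
  define \<tau> where "\<tau> = \<i> * of_real t"
  have nz: "1 - \<tau> \<noteq> 0" by (simp add: \<tau>_def complex_eq_iff)
  define \<kappa> where "\<kappa> = \<i> / of_real t * (1 - \<tau>)"
  obtain K2 where K2: "K2 \<ge> 0" "\<And>n y. 1 \<le> n \<Longrightarrow> real n \<le> y \<Longrightarrow> y < real n + 1 \<Longrightarrow>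
       norm ((\<Sum>m=1..n. E (-\<tau>) (real m)) - E (1 - \<tau>) y / (1 - \<tau>)) \<le> K2 * (1 + ln y)"
    using sum_imaginary_powers[of t] unfolding \<tau>_def by blast
  define K4 where "K4 = K + norm \<kappa> * K2"
  have K4: "K4 \<ge> 0" using K K2 by (simp add: K4_def)
  define W where "W n y = (\<Sum>m=1..n. E (-\<tau>) (real m) * (of_real (y / real m) - \<kappa>))" for n y
  have W: "norm (W n y) \<le> K4 * (1 + ln y)" if n: "1 \<le> n" "real n \<le> y" "y < real n + 1" for n y
  proof -
    have y: "y \<ge> 1" using n by linarith
    define a where "a = (\<Sum>m=1..n. E (-1 - \<tau>) (real m)) - \<i> / of_real t * E (-\<tau>) y"
    define b where "b = (\<Sum>m=1..n. E (-\<tau>) (real m)) - E (1 - \<tau>) y / (1 - \<tau>)"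
    have "W n y = (\<Sum>m=1..n. of_real y * E (-1 - \<tau>) (real m) - \<kappa> * E (-\<tau>) (real m))"
      unfolding W_def by (intro sum.cong refl) (auto simp: E_minus_1_minus algebra_simps)
    also have "\<dots> = of_real y * (\<Sum>m=1..n. E (-1 - \<tau>) (real m)) - \<kappa> * (\<Sum>m=1..n. E (-\<tau>) (real m))"
      by (simp add: sum_subtractf sum_distrib_left)
    also have "\<dots> = of_real y * a - \<kappa> * b"
    proof -
      have "\<kappa> * (E (1 - \<tau>) y / (1 - \<tau>)) = of_real y * (\<i> / of_real t * E (-\<tau>) y)"
        using nz t y by (simp add: \<kappa>_def E_1_minus)
      thus ?thesis by (simp add: a_def b_def right_diff_distrib)
    qed
    finally have "norm (W n y) \<le> norm (of_real y * a) + norm (\<kappa> * b)"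
      by (simp add: norm_triangle_ineq4)
    also have "norm (of_real y * a) = y * norm a" using y by (simp add: norm_mult)
    also have "\<dots> \<le> y * (K / y)" using bound[OF n] y by (intro mult_left_mono) (auto simp: a_def \<tau>_def)
    also have "\<dots> = K * 1" using y by simp
    also have "\<dots> \<le> K * (1 + ln y)" using y K by (intro mult_left_mono) auto
    also have "norm (\<kappa> * b) \<le> norm \<kappa> * (K2 * (1 + ln y))"
      unfolding norm_mult b_def by (intro mult_left_mono K2 n) auto
    finally show ?thesis by (simp add: K4_def algebra_simps)
  qed
  define B where "B = 32 * K4 + 5 * norm \<kappa>"
  show ?thesis
  proof (rule that[of B])
    fix N :: nat assume N: "N \<ge> 1"
    define g where "g n m = of_real (mu n * ln (real N / real n)) * E (-\<tau>) (real n) *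
                     (E (-\<tau>) (real m) * (of_real (real N / real n / real m) - \<kappa>))" for n m :: nat
    \<comment> \<open>R is computed by collecting the terms with nm = k and writing ln(N/n) =
      ln(N/k) + ln(k/n). The first part meets the sum of \<open>mu\<close> over divisors and
      survives only at k = 1, where it gives ln N; the second part gives
      \<open>Lam k\<close>.\<close>
    define R where "R = (\<Sum>n=1..N. \<Sum>m=1..N div n. g n m)"
    define Q where "Q = (\<Sum>k=1..N. of_real (Lam k) * E (-\<tau>) (real k))"
    have "R = (\<Sum>k=1..N. \<Sum>n | n dvd k. g n (k div n))"
      unfolding R_def by (rule sum_dvd_swap[symmetric])
    also have "\<dots> = (\<Sum>k=1..N. E (-\<tau>) (real k) * (of_real (real N / real k) - \<kappa>) *
                     of_real ((if k = 1 then ln (real N) else 0) + Lam k))"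
    proof (intro sum.cong refl)
      fix k assume k: "k \<in> {1..N}"
      have "(\<Sum>n | n dvd k. g n (k div n)) =
        (\<Sum>n | n dvd k. E (-\<tau>) (real k) * (of_real (real N / real k) - \<kappa>) *
             of_real (mu n * ln (real N / real k) + mu n * ln (real k / real n)))"
      proof (intro sum.cong refl)
        fix n assume "n \<in> {n. n dvd k}"
        then obtain m where m: "k = n * m" by auto
        hence pos: "n > 0" "m > 0" using k by auto
        have 1: "ln (real N / real n) = ln (real N / real k) + ln (real k / real n)"
          using pos N m by (simp add: ln_div ln_mult)
        have 2: "E (-\<tau>) (real k) = E (-\<tau>) (real n) * E (-\<tau>) (real m)"
          "real N / real n / real m = real N / real k" "k div n = m"
          using pos by (simp_all add: m E_mult)
        show "g n (k div n) = E (-\<tau>) (real k) * (of_real (real N / real k) - \<kappa>) *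
             of_real (mu n * ln (real N / real k) + mu n * ln (real k / real n))"
          unfolding g_def 2 1 by (simp only: of_real_mult of_real_add algebra_simps)
      qed
      also have "\<dots> = E (-\<tau>) (real k) * (of_real (real N / real k) - \<kappa>) *
             of_real ((\<Sum>n | n dvd k. mu n) * ln (real N / real k) + (\<Sum>n | n dvd k. mu n * ln (real k / real n)))"
        by (simp only: sum_distrib_left[symmetric] of_real_sum[symmetric] sum.distrib sum_distrib_right)
      also have "\<dots> = E (-\<tau>) (real k) * (of_real (real N / real k) - \<kappa>) *
             of_real ((if k = 1 then ln (real N) else 0) + Lam k)"
        using k by (subst sum_mu, simp, subst sum_mu_ln) auto
      finally show "(\<Sum>n | n dvd k. g n (k div n)) = \<dots>" .
    qed
    also have "\<dots> = (\<Sum>k=1..N. (if k = 1 then (of_real (real N) - \<kappa>) * of_real (ln (real N)) else 0) +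
                    of_real (real N) * (of_real (Lam k) * E (-1 - \<tau>) (real k)) - \<kappa> * (of_real (Lam k) * E (-\<tau>) (real k)))"
      by (intro sum.cong refl) (auto simp: E_minus_1_minus algebra_simps simp del: of_real_mangoldt)
    also have "\<dots> = (of_real (real N) - \<kappa>) * of_real (ln (real N)) + of_real (real N) * mangoldt_twist t N - \<kappa> * Q"
      unfolding sum_subtractf sum.distrib sum_distrib_left[symmetric] using N
      by (simp add: mangoldt_twist_def Q_def \<tau>_def del: of_real_mangoldt)
    finally have R: "of_real (real N) * (mangoldt_twist t N + of_real (ln (real N))) = R + \<kappa> * (of_real (ln (real N)) + Q)"
      by (simp add: algebra_simps)
    \<comment> \<open>For the same R, absolute values suffice: after the cancellation in
      \<open>W\<close> the inner sum is O(1 + ln(N/n)), and with the weight ln(N/n) the total is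
      O(N).\<close>
    have "norm R \<le> (\<Sum>n=1..N. 16 * K4 * sqrt (real N) * (1 / sqrt (real n)))"
      unfolding R_def
    proof (rule order_trans[OF norm_sum sum_mono])
      fix n assume n: "n \<in> {1..N}"
      define y where "y = real N / real n"
      have y: "y \<ge> 1" using n by (simp add: y_def)
      have "(\<Sum>m=1..N div n. g n m) = of_real (mu n * ln y) * E (-\<tau>) (real n) * W (N div n) y"
        by (simp add: g_def W_def y_def sum_distrib_left)
      also have "norm \<dots> = \<bar>mu n\<bar> * (ln y * norm (W (N div n) y))"
        using y by (simp add: norm_mult \<tau>_def abs_mult)
      also have "\<dots> \<le> 1 * (ln y * (K4 * (1 + ln y)))"
        using y n K4 unfolding y_def
        by (intro mult_mono abs_mu_le mult_left_mono W div_bounds mult_nonneg_nonneg) auto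
      also have "\<dots> = K4 * (ln y * (1 + ln y))" by (simp add: algebra_simps)
      also have "\<dots> \<le> K4 * (16 * sqrt y)" by (intro mult_left_mono ln_mult_le_sqrt y K4)
      also have "\<dots> = 16 * K4 * sqrt (real N) * (1 / sqrt (real n))" by (simp add: y_def real_sqrt_divide)
      finally show "norm (\<Sum>m=1..N div n. g n m) \<le> \<dots>" .
    qed
    also have "\<dots> = 16 * K4 * sqrt (real N) * (\<Sum>n=1..N. 1 / sqrt (real n))"
      by (simp add: sum_distrib_left)
    also have "\<dots> \<le> 16 * K4 * sqrt (real N) * (2 * sqrt (real N))"
      using K4 by (intro mult_left_mono sum_inverse_sqrt_le) auto
    also have "\<dots> = 32 * K4 * real N" by simp
    finally have nR: "norm R \<le> 32 * K4 * real N" .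
    have "norm Q \<le> (\<Sum>k=1..N. Lam k)"
      unfolding Q_def by (intro order_trans[OF norm_sum] sum_mono) (simp add: norm_mult \<tau>_def)
    hence "norm Q \<le> 4 * real N" using psi_le[of N] by (simp add: psi_def)
    moreover have "norm (of_real (ln (real N)) :: complex) \<le> real N"
      using N ln_le_minus_one[of "real N"] by simp
    ultimately have "norm (of_real (ln (real N)) + Q) \<le> 5 * real N"
      using norm_triangle_ineq[of "of_real (ln (real N))" Q] by linarith
    hence "norm (\<kappa> * (of_real (ln (real N)) + Q)) \<le> norm \<kappa> * (5 * real N)"
      unfolding norm_mult by (intro mult_left_mono) auto
    hence "norm (of_real (real N) * (mangoldt_twist t N + of_real (ln (real N)))) \<le> B * real N"
      unfolding R using nR norm_triangle_ineq[of R "\<kappa> * (of_real (ln (real N)) + Q)"]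
      by (simp add: B_def algebra_simps)
    hence "real N * norm (mangoldt_twist t N + of_real (ln (real N))) \<le> real N * B"
      by (simp add: norm_mult mult.commute del: of_real_of_nat_eq)
    thus "norm (mangoldt_twist t N + of_real (ln (real N))) \<le> B" using N by simp
  qed
qed

lemma E_imag: "E (-(\<i> * of_real t)) x = cis (-(t * ln x))"
  unfolding E_def cis_conv_exp
  by (simp only: of_real_minus of_real_mult mult_minus_left mult_minus_right mult.assoc)

lemma Re_E_twist:
  assumes "x > 0"
  shows "Re (E (-1 - \<i> * of_real t) x) = cos (t * ln x) / x"
  using assms by (simp add: E_minus_1_minus E_imag)

lemma mangoldt_twist_dichotomy:
  fixes t :: real
  assumes "t \<noteq> 0"
  shows "(\<exists>B. \<forall>N\<ge>1. norm (mangoldt_twist t N) \<le> B) \<or>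
         (\<exists>B. \<forall>N\<ge>1. norm (mangoldt_twist t N + of_real (ln (real N))) \<le> B)"
proof -
  obtain Z K where K: "K \<ge> 0" and bound: "\<And>n y. 1 \<le> n \<Longrightarrow> real n \<le> y \<Longrightarrow> y < real n + 1 \<Longrightarrow>
       norm ((\<Sum>m=1..n. E (-1 - \<i> * of_real t) (real m)) - (Z + \<i> / of_real t * E (-(\<i> * of_real t)) y)) \<le> K / y"
    by (rule zeta_partial_sums[OF assms]) (rule that, auto)
  show ?thesis
  proof (cases "Z = 0")
    case False
    from mangoldt_twist_bounded_if_nonzero[OF assms False K bound] show ?thesis by metis
  next
    case True
    have "norm ((\<Sum>m=1..n. E (-1 - \<i> * of_real t) (real m)) - \<i> / of_real t * E (-(\<i> * of_real t)) y) \<le> K / y"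
      if "1 \<le> n" "real n \<le> y" "y < real n + 1" for n y
      using bound[OF that] True by simp
    from mangoldt_twist_if_zero[OF assms K this] show ?thesis by metis
  qed
qed

text \<open>If the sum at t were -ln N + O(1), the nonnegative combination 3 + 4 cos x + cos 2x = 2
  (1 + cos x)^2 would give 0 <= 3 ln N - 4 ln N + O(1), since the contribution of 2t is bounded
  above.\<close>

theorem mangoldt_twist_bounded:
  fixes t :: real
  assumes t: "t \<noteq> 0"
  shows "\<exists>B. \<forall>N\<ge>1. norm (mangoldt_twist t N) \<le> B"
proof (rule ccontr)
  assume "\<not> ?thesis"
  then obtain B1 where B1: "\<And>N. N \<ge> 1 \<Longrightarrow> norm (mangoldt_twist t N + of_real (ln (real N))) \<le> B1"
    using mangoldt_twist_dichotomy[OF t] by blast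
  \<comment> \<open>At 2t only an upper bound on the real part is used, and both alternatives of the
    dichotomy supply one.\<close>
  have "\<exists>B2. \<forall>N\<ge>1. Re (mangoldt_twist (2 * t) N) \<le> B2"
  proof -
    from t have "2 * t \<noteq> 0" by simp
    from mangoldt_twist_dichotomy[OF this] show ?thesis
    proof
      assume "\<exists>B. \<forall>N\<ge>1. norm (mangoldt_twist (2 * t) N) \<le> B"
      then obtain B where "\<forall>N\<ge>1. norm (mangoldt_twist (2 * t) N) \<le> B" ..
      thus ?thesis by (intro exI[of _ B]) (meson complex_Re_le_cmod order_trans)
    next
      assume "\<exists>B. \<forall>N\<ge>1. norm (mangoldt_twist (2 * t) N + of_real (ln (real N))) \<le> B"
      then obtain B where B: "\<forall>N\<ge>1. norm (mangoldt_twist (2 * t) N + of_real (ln (real N))) \<le> B" ..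
      have "Re (mangoldt_twist (2 * t) N) \<le> B" if "N \<ge> 1" for N
      proof -
        have "Re (mangoldt_twist (2 * t) N + of_real (ln (real N))) \<le> B"
          using B that complex_Re_le_cmod order_trans by blast
        moreover have "ln (real N) \<ge> 0" using that by simp
        ultimately show ?thesis by simp
      qed
      thus ?thesis by blast
    qed
  qed
  then obtain B2 where B2: "\<And>N. N \<ge> 1 \<Longrightarrow> Re (mangoldt_twist (2 * t) N) \<le> B2" by blast
  have le: "ln (real N) \<le> 12 + 4 * B1 + B2" if N: "N \<ge> 1" for N
  proof -
    have Re: "Re (mangoldt_twist u N) = (\<Sum>d=1..N. Lam d / real d * cos (u * ln (real d)))" for u
      unfolding mangoldt_twist_def Re_sum
      by (intro sum.cong refl) (auto simp: Re_E_twist simp del: of_real_mangoldt)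
    have "0 \<le> (\<Sum>d=1..N. Lam d / real d * (2 * (1 + cos (t * ln (real d))) ^ 2))"
      by (intro sum_nonneg mult_nonneg_nonneg divide_nonneg_nonneg mangoldt_nonneg) auto
    also have "\<dots> = (\<Sum>d=1..N. 3 * (Lam d / real d) + 4 * (Lam d / real d * cos (t * ln (real d)))
                     + Lam d / real d * cos (2 * t * ln (real d)))"
    proof (intro sum.cong refl)
      fix d
      have eq: "cos (2 * t * ln (real d)) = 2 * cos (t * ln (real d)) ^ 2 - 1"
        using cos_double_cos[of "t * ln (real d)"] by (simp add: mult.assoc)
      show "Lam d / real d * (2 * (1 + cos (t * ln (real d))) ^ 2) =
         3 * (Lam d / real d) + 4 * (Lam d / real d * cos (t * ln (real d)))
                     + Lam d / real d * cos (2 * t * ln (real d))"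
        unfolding eq by (simp add: power2_eq_square ring_distribs) (simp add: algebra_simps)
    qed
    also have "\<dots> = 3 * (\<Sum>d=1..N. Lam d / real d) + 4 * Re (mangoldt_twist t N) + Re (mangoldt_twist (2 * t) N)"
      by (simp add: sum.distrib Re sum_distrib_left)
    finally have "0 \<le> 3 * (\<Sum>d=1..N. Lam d / real d) + 4 * Re (mangoldt_twist t N) + Re (mangoldt_twist (2 * t) N)" .
    moreover have "Re (mangoldt_twist t N) \<le> B1 - ln (real N)"
      using B1[OF N] complex_Re_le_cmod[of "mangoldt_twist t N + of_real (ln (real N))"] by simp
    ultimately show ?thesis using mertens_first[OF N] B2[OF N] by linarith
  qed
  define N where "N = nat \<lceil>exp (12 + 4 * B1 + B2)\<rceil> + 1"
  have "real N > exp (12 + 4 * B1 + B2)" unfolding N_def by linarith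
  hence "ln (real N) > 12 + 4 * B1 + B2"
    by (metis exp_gt_zero exp_less_cancel_iff exp_ln less_trans)
  thus False using le[of N] by (simp add: N_def)
qed

section \<open>From prime powers to primes\<close>

definition plog :: "nat \<Rightarrow> real" where "plog n = (if prime n then ln (real n) else 0)"

lemma plog_nonneg: "plog n \<ge> 0"
  using prime_ge_1_nat[of n] by (auto simp: plog_def)

lemma plog_le_mangoldt: "plog n \<le> Lam n"
  using mangoldt_nonneg[of n] unfolding plog_def by (cases "prime n") simp_all

lemma summable_ln_over_square: "summable (\<lambda>n. ln (real n) / real n ^ 2)"
proof (rule summable_comparison_test[OF exI, of 1])
  show "summable (\<lambda>n. 2 * (real n powr (-3/2)))"
    by (intro summable_mult) (simp add: summable_real_powr_iff)
  show "\<forall>n\<ge>1. norm (ln (real n) / real n ^ 2) \<le> 2 * (real n powr (-3/2))"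
  proof (intro allI impI)
    fix n :: nat assume n: "n \<ge> 1"
    have "ln (real n) = 2 * ln (sqrt (real n))" using n by (simp add: ln_sqrt)
    also have "ln (sqrt (real n)) \<le> sqrt (real n)"
      using n ln_le_minus_one[of "sqrt (real n)"] by simp
    finally have "ln (real n) / real n ^ 2 \<le> 2 * sqrt (real n) / real n ^ 2"
      by (intro divide_right_mono) auto
    also have "\<dots> = 2 * (real n powr (1/2 - 2))"
      unfolding powr_diff using n by (simp add: powr_half_sqrt)
    finally show "norm (ln (real n) / real n ^ 2) \<le> 2 * (real n powr (-3/2))" using n by simp
  qed
qed

text \<open>The proper prime powers inject, through base and exponent, into pairs (p, k) with k >=
  2. For each p the geometric series in k is at most 2/p^2, as 1/p <= 1/2.\<close>

lemma prime_powers_bounded: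
  obtains B where "\<And>N. (\<Sum>n=1..N. (Lam n - plog n) / real n) \<le> B"
proof (rule that)
  fix N :: nat
  define S where "S = {n \<in> {1..N}. primepow n \<and> \<not> prime n}"
  define j where "j n = (aprimedivisor n, multiplicity (aprimedivisor n) n)" for n :: nat
  have j: "fst (j n) ^ snd (j n) = n" "prime (fst (j n))" "snd (j n) \<ge> 2" "fst (j n) \<le> N" "snd (j n) \<le> N"
    "fst (j n) \<ge> 2" if "n \<in> S" for n
  proof -
    have pn: "primepow n" "\<not> prime n" "n \<le> N" using that by (auto simp: S_def)
    show eq: "fst (j n) ^ snd (j n) = n" using pn by (simp add: j_def primepow_decompose)
    show p: "prime (fst (j n))" using pn(1) by (auto simp: j_def primepow_def aprimedivisor_prime_power)
    have "n > 1" using pn(1) primepow_gt_Suc_0 by auto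
    show ge: "snd (j n) \<ge> 2"
    proof (rule ccontr)
      assume "\<not> snd (j n) \<ge> 2"
      hence "snd (j n) = 0 \<or> snd (j n) = 1" by auto
      thus False using eq p pn \<open>n > 1\<close> by auto
    qed
    show "fst (j n) \<ge> 2" using p prime_ge_2_nat by blast
    have "fst (j n) ^ 1 \<le> fst (j n) ^ snd (j n)"
      using ge p prime_ge_1_nat by (intro power_increasing) auto
    thus "fst (j n) \<le> N" using eq pn by simp
    have "snd (j n) < fst (j n) ^ snd (j n)"
      using p prime_gt_1_nat by (intro power_gt_expt) auto
    thus "snd (j n) \<le> N" using eq pn by simp
  qed
  have "inj_on j S" by (intro inj_onI) (metis j(1))
  have "(\<Sum>n=1..N. (Lam n - plog n) / real n) = (\<Sum>n\<in>S. Lam n / real n)"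
  proof (intro sum.mono_neutral_cong_right ballI)
    fix n assume "n \<in> {1..N} - S"
    thus "(Lam n - plog n) / real n = 0"
      by (cases "prime n") (auto simp: S_def plog_def mangoldt_def[of n])
  qed (auto simp: S_def plog_def)
  also have "\<dots> = (\<Sum>n\<in>S. (\<lambda>(p, k). ln (real p) / real p ^ k) (j n))"
  proof (intro sum.cong refl)
    fix n assume n: "n \<in> S"
    have "Lam n = ln (real (fst (j n)))" using n by (simp add: mangoldt_def S_def j_def)
    moreover have "real n = real (fst (j n)) ^ snd (j n)" using j(1)[OF n] by (metis of_nat_power)
    ultimately show "Lam n / real n = (\<lambda>(p, k). ln (real p) / real p ^ k) (j n)"
      by (simp add: case_prod_beta)
  qed
  also have "\<dots> = (\<Sum>(p, k)\<in>j ` S. ln (real p) / real p ^ k)"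
    using \<open>inj_on j S\<close> by (simp add: sum.reindex)
  also have "\<dots> \<le> (\<Sum>(p, k)\<in>{2..N}\<times>{2..N}. ln (real p) / real p ^ k)"
  proof (intro sum_mono2)
    show "j ` S \<subseteq> {2..N} \<times> {2..N}"
    proof safe
      fix a b n assume "n \<in> S" "(a, b) = j n"
      thus "a \<in> {2..N}" "b \<in> {2..N}" using j[of n] by (metis atLeastAtMost_iff fst_conv snd_conv)+
    qed
  qed auto
  also have "\<dots> = (\<Sum>p=2..N. \<Sum>k=2..N. ln (real p) / real p ^ k)" by (simp add: sum.cartesian_product)
  also have "\<dots> \<le> (\<Sum>p=2..N. 2 * (ln (real p) / real p ^ 2))"
  proof (intro sum_mono)
    fix p assume p: "p \<in> {2..N}"
    define x where "x = 1 / real p"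
    have x: "0 < x" "x \<le> 1 / 2" using p by (auto simp: x_def)
    have geo: "(\<Sum>k=2..N. x ^ k) \<le> 2 * x ^ 2"
    proof -
      have "(\<Sum>k=2..N. x ^ k) \<le> 2 * x ^ 2 - x ^ N" if "N \<ge> 2"
        using that
      proof (induction N rule: nat_induct_at_least)
        case (Suc n)
        have "2 * x ^ Suc n \<le> x ^ n" using x mult_left_mono[of "2 * x" 1 "x ^ n"] by (simp add: mult_ac)
        moreover have "(\<Sum>k=2..Suc n. x ^ k) = (\<Sum>k=2..n. x ^ k) + x ^ Suc n" using Suc by simp
        ultimately show ?case using Suc.IH by linarith
      qed auto
      thus ?thesis using x by (cases "N \<ge> 2") (auto intro: order_trans)
    qed
    have "(\<Sum>k=2..N. ln (real p) / real p ^ k) = ln (real p) * (\<Sum>k=2..N. x ^ k)"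
      by (simp add: sum_distrib_left x_def power_divide)
    also have "\<dots> \<le> ln (real p) * (2 * x ^ 2)" using p by (intro mult_left_mono geo) auto
    finally show "(\<Sum>k=2..N. ln (real p) / real p ^ k) \<le> 2 * (ln (real p) / real p ^ 2)"
      by (simp add: x_def power_divide mult.commute)
  qed
  also have "\<dots> = 2 * (\<Sum>p=2..N. ln (real p) / real p ^ 2)" by (simp add: sum_distrib_left)
  also have "(\<Sum>p=2..N. ln (real p) / real p ^ 2) \<le> (\<Sum>p. ln (real p) / real p ^ 2)"
  proof (intro sum_le_suminf summable_ln_over_square)
    fix p :: nat show "ln (real p) / real p ^ 2 \<ge> 0" by (cases "p = 0") auto
  qed auto
  finally show "(\<Sum>n=1..N. (Lam n - plog n) / real n) \<le> 2 * (\<Sum>p. ln (real p) / real p ^ 2)" by simp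
qed

text \<open>At t = 0 the Mertens sum and the harmonic sum both equal ln N up to O(1) and cancel; for
  other t each of the two sums is bounded separately. Replacing \<open>Lam\<close> by
  \<open>plog\<close> costs the convergent sum over proper prime powers.\<close>

theorem prime_twist_bounded:
  obtains B where "\<And>N. norm (\<Sum>n=1..N. of_real (plog n - 1) * E (-1 - \<i> * of_real t) (real n)) \<le> B"
proof -
  define e where "e n = E (-1 - \<i> * of_real t) (real n)" for n
  have ne: "norm (e n) = 1 / real n" if "n \<ge> 1" for n
    using that by (simp add: e_def E_minus_1_minus norm_divide)
  obtain B0 where B0: "\<And>N. (\<Sum>n=1..N. (Lam n - plog n) / real n) \<le> B0"
    using prime_powers_bounded by blast
  have P: "norm (\<Sum>n=1..N. of_real (plog n - Lam n) * e n) \<le> B0" for N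
  proof -
    have "norm (\<Sum>n=1..N. of_real (plog n - Lam n) * e n) \<le> (\<Sum>n=1..N. (Lam n - plog n) / real n)"
      using plog_le_mangoldt
      by (intro order_trans[OF norm_sum] sum_mono) (auto simp: norm_mult ne simp del: of_real_mangoldt of_real_diff)
    with B0 show ?thesis using order_trans by blast
  qed
  obtain B1 where B1: "\<And>N. N \<ge> 1 \<Longrightarrow> norm (\<Sum>n=1..N. of_real (Lam n - 1) * e n) \<le> B1"
  proof (cases "t = 0")
    case True
    have "norm (\<Sum>n=1..N. of_real (Lam n - 1) * e n) \<le> 5" if N: "N \<ge> 1" for N
    proof -
      have "(\<Sum>n=1..N. of_real (Lam n - 1) * e n) = of_real ((\<Sum>n=1..N. Lam n / real n) - (\<Sum>n=1..N. 1 / real n))"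
        unfolding of_real_diff of_real_sum sum_subtractf[symmetric]
        by (intro sum.cong refl)
           (auto simp: e_def True E_minus_1_minus[of _ 0, simplified] field_simps simp del: of_real_mangoldt)
      also have "norm \<dots> \<le> 5"
      proof -
        have "ln (real N) \<le> ln (real N + 1)" using N by simp
        also have "\<dots> \<le> (\<Sum>n=1..N. 1 / real n)"
          using ln_le_harm[of N] by (simp add: harm_def inverse_eq_divide)
        finally show ?thesis
          unfolding norm_of_real using mertens_first[OF N] sum_inverse_le[OF N] by linarith
      qed
      finally show ?thesis .
    qed
    thus ?thesis using that by blast
  next
    case False
    obtain B2 where B2: "\<And>N. N \<ge> 1 \<Longrightarrow> norm (mangoldt_twist t N) \<le> B2"
      using mangoldt_twist_bounded[OF False] by blast
    obtain Z K where K: "K \<ge> 0" and bound: "\<And>n y. 1 \<le> n \<Longrightarrow> real n \<le> y \<Longrightarrow> y < real n + 1 \<Longrightarrow>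
       norm ((\<Sum>m=1..n. E (-1 - \<i> * of_real t) (real m)) - (Z + \<i> / of_real t * E (-(\<i> * of_real t)) y)) \<le> K / y"
      by (rule zeta_partial_sums[OF False]) (rule that, auto)
    have "norm (\<Sum>n=1..N. of_real (Lam n - 1) * e n) \<le> B2 + (K + norm Z + 1 / \<bar>t\<bar>)" if N: "N \<ge> 1" for N
    proof -
      let ?w = "\<i> / of_real t * E (-(\<i> * of_real t)) (real N)"
      have "norm (\<Sum>n=1..N. e n) \<le> norm ((\<Sum>n=1..N. e n) - (Z + ?w)) + (norm Z + norm ?w)"
        using norm_triangle_ineq[of "(\<Sum>n=1..N. e n) - (Z + ?w)" "Z + ?w"] norm_triangle_ineq[of Z ?w] by simp
      also have "norm ((\<Sum>n=1..N. e n) - (Z + ?w)) \<le> K / real N"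
        unfolding e_def using N by (intro bound) auto
      also have "\<dots> \<le> K / 1" using K N by (intro divide_left_mono) auto
      also have "norm ?w = 1 / \<bar>t\<bar>" by (simp add: norm_mult norm_divide)
      finally have "norm (\<Sum>n=1..N. e n) \<le> K + norm Z + 1 / \<bar>t\<bar>" by simp
      moreover have "(\<Sum>n=1..N. of_real (Lam n - 1) * e n) = mangoldt_twist t N - (\<Sum>n=1..N. e n)"
        by (simp add: mangoldt_twist_def e_def sum_subtractf left_diff_distrib del: of_real_mangoldt)
      ultimately show ?thesis
        using norm_triangle_ineq4[of "mangoldt_twist t N" "\<Sum>n=1..N. e n"] B2[OF N] by simp
    qed
    thus ?thesis using that by blast
  qed
  show ?thesis
  proof (rule that)
    fix N
    show "norm (\<Sum>n=1..N. of_real (plog n - 1) * E (-1 - \<i> * of_real t) (real n)) \<le> B0 + \<bar>B1\<bar>"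
    proof (cases "N \<ge> 1")
      case True
      have "(\<Sum>n=1..N. of_real (plog n - 1) * e n) =
         (\<Sum>n=1..N. of_real (plog n - Lam n) * e n) + (\<Sum>n=1..N. of_real (Lam n - 1) * e n)"
        by (simp add: sum.distrib[symmetric] algebra_simps del: of_real_mangoldt)
      thus ?thesis using P[of N] B1[OF True] norm_triangle_ineq[of "(\<Sum>n=1..N. of_real (plog n - Lam n) * e n)"
            "(\<Sum>n=1..N. of_real (Lam n - 1) * e n)"] by (simp add: e_def)
    next
      case False
      thus ?thesis using B0[of 0] by auto
    qed
  qed
qed

subsection \<open>Equidistribution of prime logarithms modulo a period\<close>

text \<open>The quantifier over all $u$ makes this class a module over the trigonometric polynomials in $\ln n$.\<close>

definition twist_bounded :: "(nat \<Rightarrow> complex) \<Rightarrow> bool" where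
  "twist_bounded g \<longleftrightarrow> (\<forall>u::real. \<exists>B. \<forall>N.
     norm (\<Sum>n=1..N. of_real (plog n - 1) * E (-1 - \<i> * of_real u) (real n) * g n) \<le> B)"

lemma twist_bounded_1: "twist_bounded (\<lambda>_. 1)"
  unfolding twist_bounded_def
proof
  fix u :: real
  obtain B where "\<And>N. norm (\<Sum>n=1..N. of_real (plog n - 1) * E (-1 - \<i> * of_real u) (real n)) \<le> B"
    using prime_twist_bounded by blast
  thus "\<exists>B. \<forall>N. norm (\<Sum>n=1..N. of_real (plog n - 1) * E (-1 - \<i> * of_real u) (real n) * 1) \<le> B"
    by auto
qed

lemma twist_bounded_add:
  assumes "twist_bounded f" "twist_bounded g"
  shows "twist_bounded (\<lambda>n. f n + g n)"
  unfolding twist_bounded_def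
proof
  fix u :: real
  let ?s = "\<lambda>g N. \<Sum>n=1..N. of_real (plog n - 1) * E (-1 - \<i> * of_real u) (real n) * g n"
  obtain A B where AB: "\<And>N. norm (?s f N) \<le> A" "\<And>N. norm (?s g N) \<le> B"
    using assms unfolding twist_bounded_def by meson
  have "norm (?s (\<lambda>n. f n + g n) N) \<le> A + B" for N
  proof -
    have eq: "?s (\<lambda>n. f n + g n) N = ?s f N + ?s g N" by (simp only: distrib_left sum.distrib)
    show ?thesis unfolding eq using norm_triangle_ineq[of "?s f N" "?s g N"] AB[of N] by linarith
  qed
  thus "\<exists>B. \<forall>N. norm (?s (\<lambda>n. f n + g n) N) \<le> B" by blast
qed

text \<open>A factor n^(iw) only shifts the frequency u to u - w, and the definition covers all
  frequencies.\<close>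

lemma twist_bounded_mult_E:
  assumes "twist_bounded g"
  shows "twist_bounded (\<lambda>n. c * E (\<i> * of_real w) (real n) * g n)"
  unfolding twist_bounded_def
proof
  fix u :: real
  obtain B where B: "\<And>N. norm (\<Sum>n=1..N. of_real (plog n - 1) * E (-1 - \<i> * of_real (u - w)) (real n) * g n) \<le> B"
    using assms unfolding twist_bounded_def by meson
  have "norm (\<Sum>n=1..N. of_real (plog n - 1) * E (-1 - \<i> * of_real u) (real n) * (c * E (\<i> * of_real w) (real n) * g n))
        \<le> norm c * B" for N
  proof -
    have "E (-1 - \<i> * of_real (u - w)) x = E (-1 - \<i> * of_real u) x * E (\<i> * of_real w) x" for x
      by (simp add: algebra_simps flip: E_add)
    hence "(\<Sum>n=1..N. of_real (plog n - 1) * E (-1 - \<i> * of_real u) (real n) * (c * E (\<i> * of_real w) (real n) * g n))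
      = c * (\<Sum>n=1..N. of_real (plog n - 1) * E (-1 - \<i> * of_real (u - w)) (real n) * g n)"
      by (simp only: sum_distrib_left mult_ac)
    thus ?thesis using B[of N] by (simp only: norm_mult mult_left_mono norm_ge_zero)
  qed
  thus "\<exists>B. \<forall>N. norm (\<Sum>n=1..N. of_real (plog n - 1) * E (-1 - \<i> * of_real u) (real n) *
             (c * E (\<i> * of_real w) (real n) * g n)) \<le> B" by blast
qed

text \<open>A real linear form is a combination of z and its conjugate, which at z = n^(iw) are two
  frequency shifts. The sequence g must be arbitrary in the induction: a product of polynomials is
  handled by absorbing one factor into g.\<close>

lemma twist_bounded_mult_polynomial:
  fixes p :: "complex \<Rightarrow> real"
  assumes "real_polynomial_function p" "twist_bounded g"
  shows "twist_bounded (\<lambda>n. of_real (p (E (\<i> * of_real w) (real n))) * g n)"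
  using assms
proof (induction arbitrary: g rule: real_polynomial_function.induct)
  case (linear f)
  let ?e = "\<lambda>n::nat. E (\<i> * of_real w) (real n)"
  have f: "of_real (f z) = (of_real (f 1) - \<i> * of_real (f \<i>)) / 2 * z + (of_real (f 1) + \<i> * of_real (f \<i>)) / 2 * cnj z" for z
  proof -
    have lin: "linear f" using linear(1) by (rule bounded_linear.linear)
    have "f z = f (Re z *\<^sub>R 1 + Im z *\<^sub>R \<i>)" by (rule arg_cong[where f = f]) (simp add: complex_eq_iff)
    also have "\<dots> = Re z * f 1 + Im z * f \<i>"
      by (simp only: linear_add[OF lin] linear_scale[OF lin] real_scaleR_def)
    finally have "f z = Re z * f 1 + Im z * f \<i>" .
    thus ?thesis by (simp add: complex_eq_iff field_simps)
  qed
  have cnj: "cnj (?e n) = E (\<i> * of_real (-w)) (real n)" for n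
    unfolding E_def exp_cnj by simp
  have "twist_bounded (\<lambda>n. (of_real (f 1) - \<i> * of_real (f \<i>)) / 2 * E (\<i> * of_real w) (real n) * g n
          + (of_real (f 1) + \<i> * of_real (f \<i>)) / 2 * E (\<i> * of_real (-w)) (real n) * g n)"
    by (intro twist_bounded_add twist_bounded_mult_E linear)
  moreover have "of_real (f (?e n)) * g n = (of_real (f 1) - \<i> * of_real (f \<i>)) / 2 * E (\<i> * of_real w) (real n) * g n
          + (of_real (f 1) + \<i> * of_real (f \<i>)) / 2 * E (\<i> * of_real (-w)) (real n) * g n" for n
    unfolding f[of "?e n"] cnj by (rule distrib_right)
  ultimately show ?case by (simp only:)
next
  case (const c)
  from twist_bounded_mult_E[OF const, of "of_real c" 0] show ?case by simp
next
  case (add f h)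
  thus ?case using twist_bounded_add[of "\<lambda>n. of_real (f (E (\<i> * of_real w) (real n))) * g n"
      "\<lambda>n. of_real (h (E (\<i> * of_real w) (real n))) * g n"] by (simp add: ring_distribs)
next
  case (mult f h)
  thus ?case by (simp add: mult.assoc)
qed

lemma periodic_of_int:
  fixes q :: "real \<Rightarrow> real"
  assumes "\<And>v. q (v + 1) = q v"
  shows "q (v + of_int k) = q v"
proof (induction k rule: int_induct[where k = 0])
  case (step1 i)
  thus ?case using assms[of "v + of_int i"] by (simp add: add_ac)
next
  case (step2 i)
  thus ?case using assms[of "v + of_int (i - 1)"] by (simp add: add_ac)
qed simp

text \<open>A function of period 1 at ln(n)/lam is a function on the circle at the point n^(2 pi
  i/lam). The approximating polynomial depends on \<open>\<epsilon>\<close> but not on M and N;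
  since a window is a difference of two partial sums, K is the same for all windows.\<close>

lemma periodic_twisted_sum_bound:
  fixes q :: "real \<Rightarrow> real"
  assumes cont: "continuous_on UNIV q" and per: "\<And>v. q (v + 1) = q v" and "\<epsilon> > 0" and "lam > 0"
  obtains K where "\<And>M N. M \<le> N \<Longrightarrow> \<bar>\<Sum>n\<in>{M<..N}. (plog n - 1) / real n * q (ln (real n) / lam)\<bar>
                      \<le> \<epsilon> * (\<Sum>n\<in>{M<..N}. \<bar>plog n - 1\<bar> / real n) + K"
proof -
  define h where "h = q \<circ> (\<lambda>z. Arg2pi z / (2 * pi))"
  \<comment> \<open>\<open>Arg2pi\<close> jumps at the positive axis. That \<open>h\<close> is
    nevertheless continuous there follows from the passage from loops to maps of the circle, applied
    to the trivial homotopy from \<open>q\<close> to itself.\<close>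
  have "path q" using cont by (auto simp: path_def intro: continuous_on_subset)
  hence "homotopic_loops UNIV q q"
    using per[of 0] by (simp add: homotopic_loops_refl pathstart_def pathfinish_def)
  from homotopic_loops_imp_homotopic_circlemaps[OF this]
  have "continuous_on (sphere 0 1) h"
    unfolding h_def by (auto dest: homotopic_with_imp_continuous)
  then obtain p where p: "real_polynomial_function p" "\<And>z. z \<in> sphere 0 1 \<Longrightarrow> \<bar>h z - p z\<bar> < \<epsilon>"
    using Stone_Weierstrass_real_polynomial_function[of "sphere 0 1" h \<epsilon>] \<open>\<epsilon> > 0\<close> by (metis compact_sphere)
  define w where "w = 2 * pi / lam"
  define e where "e n = E (\<i> * of_real w) (real n)" for n
  have h: "h (e n) = q (ln (real n) / lam)" for n
  proof -
    define z where "z = e n"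
    have z: "z = cis (2 * pi * (ln (real n) / lam))"
      unfolding z_def e_def using E_imag[of "-w" "real n"] by (simp add: w_def)
    hence "norm z = 1" by simp
    hence "z = cis (Arg2pi z)"
      using Arg2pi[of z] by (simp add: cis_conv_exp is_Arg_def)
    with z have "cis (2 * pi * (ln (real n) / lam)) = cis (Arg2pi z)" by simp
    then obtain k :: int where "2 * pi * (ln (real n) / lam) = Arg2pi z + 2 * pi * of_int k"
      using sin_cos_eq_iff[of "2 * pi * (ln (real n) / lam)" "Arg2pi z"] by (auto simp: complex_eq_iff)
    hence "2 * pi * (ln (real n) / lam) = 2 * pi * (Arg2pi z / (2 * pi) + of_int k)"
      by (simp add: field_simps)
    hence "ln (real n) / lam = Arg2pi z / (2 * pi) + of_int k" by (simp only: mult_cancel_left) auto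
    thus ?thesis using periodic_of_int[of q, OF per] by (simp add: h_def z_def)
  qed
  have "norm (e n) = 1" for n by (simp add: e_def norm_E)
  hence close: "\<bar>q (ln (real n) / lam) - p (e n)\<bar> \<le> \<epsilon>" for n
    using p(2)[of "e n"] h[of n] by (simp add: less_imp_le)
  have "twist_bounded (\<lambda>n. of_real (p (e n)) * 1)"
    unfolding e_def by (intro twist_bounded_mult_polynomial p twist_bounded_1)
  then obtain B where B: "\<And>N. norm (\<Sum>n=1..N. of_real (plog n - 1) * E (-1 - \<i> * of_real 0) (real n) * (of_real (p (e n)) * 1)) \<le> B"
    unfolding twist_bounded_def by meson
  have B': "\<bar>\<Sum>n=1..N. (plog n - 1) / real n * p (e n)\<bar> \<le> B" for N
  proof -
    have "(\<Sum>n=1..N. of_real (plog n - 1) * E (-1 - \<i> * of_real 0) (real n) * (of_real (p (e n)) * 1))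
       = of_real (\<Sum>n=1..N. (plog n - 1) / real n * p (e n))"
      unfolding of_real_sum by (intro sum.cong refl) (auto simp: E_minus_1_minus[of _ 0, simplified])
    thus ?thesis using B[of N] by (metis norm_of_real)
  qed
  show ?thesis
  proof (rule that)
    fix M N :: nat assume MN: "M \<le> N"
    let ?b = "\<lambda>n. (plog n - 1) / real n"
    have "(\<Sum>n\<in>{M<..N}. ?b n * p (e n)) = (\<Sum>n=1..N. ?b n * p (e n)) - (\<Sum>n=1..M. ?b n * p (e n))"
    proof -
      have "{1..N} = {1..M} \<union> {M<..N}" using MN by auto
      thus ?thesis by (simp only:) (subst sum.union_disjoint, auto)
    qed
    hence 1: "\<bar>\<Sum>n\<in>{M<..N}. ?b n * p (e n)\<bar> \<le> 2 * B" using B'[of N] B'[of M] by linarith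
    have "\<bar>\<Sum>n\<in>{M<..N}. ?b n * (q (ln (real n) / lam) - p (e n))\<bar> \<le> (\<Sum>n\<in>{M<..N}. \<epsilon> * (\<bar>plog n - 1\<bar> / real n))"
    proof (intro order_trans[OF sum_abs] sum_mono)
      fix n
      have "\<bar>?b n\<bar> * \<bar>q (ln (real n) / lam) - p (e n)\<bar> \<le> \<bar>?b n\<bar> * \<epsilon>"
        by (intro mult_left_mono close) auto
      thus "\<bar>?b n * (q (ln (real n) / lam) - p (e n))\<bar> \<le> \<epsilon> * (\<bar>plog n - 1\<bar> / real n)"
        by (simp add: abs_mult mult.commute)
    qed
    also have "\<dots> = \<epsilon> * (\<Sum>n\<in>{M<..N}. \<bar>plog n - 1\<bar> / real n)" by (simp add: sum_distrib_left)
    also have "(\<Sum>n\<in>{M<..N}. ?b n * (q (ln (real n) / lam) - p (e n)))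
        = (\<Sum>n\<in>{M<..N}. ?b n * q (ln (real n) / lam)) - (\<Sum>n\<in>{M<..N}. ?b n * p (e n))"
      by (simp only: right_diff_distrib sum_subtractf)
    finally show "\<bar>\<Sum>n\<in>{M<..N}. ?b n * q (ln (real n) / lam)\<bar> \<le> \<epsilon> * (\<Sum>n\<in>{M<..N}. \<bar>plog n - 1\<bar> / real n) + 2 * B"
      using 1 by linarith
  qed
qed

subsection \<open>Laplace transforms\<close>

lemma sum_exp_le:
  assumes "s > (0::real)"
  shows "(\<Sum>n=1..N. exp (-(s * real n))) \<le> 1 / s"
proof -
  define q where "q = exp (-s)"
  have q: "0 < q" "q < 1" using assms by (auto simp: q_def)
  have e: "exp (-(s * real n)) = q ^ n" for n by (simp add: q_def mult.commute flip: exp_of_nat_mult)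
  have "(\<Sum>n=1..N. q ^ n) * (1 - q) = q - q ^ Suc N"
  proof (induction N)
    case (Suc N)
    have "(\<Sum>n=1..Suc N. q ^ n) * (1 - q) = (\<Sum>n=1..N. q ^ n) * (1 - q) + q ^ Suc N * (1 - q)"
      by (simp add: distrib_right)
    also have "\<dots> = q - q ^ Suc N + q ^ Suc N * (1 - q)" by (simp only: Suc)
    also have "\<dots> = q - q ^ Suc (Suc N)" by (simp add: algebra_simps)
    finally show ?case .
  qed simp
  hence "(\<Sum>n=1..N. q ^ n) * (1 - q) \<le> q" using q by simp
  moreover have "q * s \<le> 1 - q"
  proof -
    have "q * (1 + s) \<le> q * exp s" using q exp_ge_add_one_self[of s] by (intro mult_left_mono) auto
    also have "\<dots> = 1" by (simp add: q_def flip: exp_add)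
    finally show ?thesis by (simp add: algebra_simps)
  qed
  ultimately have "(\<Sum>n=1..N. q ^ n) * (1 - q) * s \<le> 1 - q"
    using assms by (meson mult_right_mono order_trans less_imp_le)
  hence "(\<Sum>n=1..N. q ^ n) * s * (1 - q) \<le> 1 * (1 - q)" by (simp add: mult_ac)
  hence "(\<Sum>n=1..N. q ^ n) * s \<le> 1" using q by (simp only: mult_le_cancel_right)
  thus ?thesis using assms by (simp add: e field_simps)
qed

text \<open>Partial summation against decreasing weights whose sum is at most 1/s. This turns a
  Chebyshev bound into a bound on the normalized Laplace transform.\<close>

lemma laplace_bound:
  fixes c :: "nat \<Rightarrow> real"
  assumes c: "\<And>n. c n \<ge> 0" "c 0 = 0" and C: "\<And>N. (\<Sum>n=1..N. c n) \<le> C * real N" and s: "s > 0"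
  shows "summable (\<lambda>n. c n * exp (-(s * real n)))" "s * (\<Sum>n. c n * exp (-(s * real n))) \<le> C"
proof -
  define w where "w n = exp (-(s * real n))" for n
  have w: "w n > 0" "w (Suc n) \<le> w n" for n using s by (auto simp: w_def algebra_simps)
  have C0: "C \<ge> 0" using C[of 1] c(1)[of 1] by simp
  \<comment> \<open>The boundary term is what makes the induction close; it is nonnegative and is
    dropped afterwards.\<close>
  have abel: "(\<Sum>n=1..N. c n * w n) \<le> C * (\<Sum>n=1..N. w n) - (C * real N - (\<Sum>n=1..N. c n)) * w N" for N
  proof (induction N)
    case (Suc N)
    have "(C * real N - (\<Sum>n=1..N. c n)) * w (Suc N) \<le> (C * real N - (\<Sum>n=1..N. c n)) * w N"
      using C[of N] w by (intro mult_left_mono) auto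
    thus ?case using Suc by (simp add: algebra_simps)
  qed simp
  have le: "(\<Sum>n=1..N. c n * w n) \<le> C / s" for N
  proof -
    have "(\<Sum>n=1..N. c n * w n) \<le> C * (\<Sum>n=1..N. w n)"
      using abel[of N] C[of N] w(1)[of N] mult_nonneg_nonneg[of "C * real N - (\<Sum>n=1..N. c n)" "w N"] by linarith
    also have "\<dots> \<le> C * (1 / s)" unfolding w_def by (intro mult_left_mono sum_exp_le s C0)
    finally show ?thesis by simp
  qed
  have le': "(\<Sum>n<N. c n * w n) \<le> C / s" for N
  proof -
    have "(\<Sum>n<N. c n * w n) \<le> (\<Sum>n\<in>insert 0 {1..N}. c n * w n)"
      using c w(1) by (intro sum_mono2) (auto intro: mult_nonneg_nonneg less_imp_le)
    also have "\<dots> = (\<Sum>n=1..N. c n * w n)" using c by simp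
    finally show ?thesis using le[of N] by simp
  qed
  have nonneg: "c n * w n \<ge> 0" for n using c w(1)[of n] by simp
  show sm: "summable (\<lambda>n. c n * exp (-(s * real n)))"
    using summableI_nonneg_bounded[OF nonneg le'] by (simp add: w_def)
  have "(\<Sum>n. c n * w n) \<le> C / s" using sm by (intro suminf_le_const le') (simp add: w_def)
  thus "s * (\<Sum>n. c n * exp (-(s * real n))) \<le> C" using s by (simp add: w_def field_simps)
qed

section \<open>Periodization of x exp(-x) under multiplication by 4\<close>

definition phi0 :: "real \<Rightarrow> real" where "phi0 x = x * exp (-x)"
definition Tup :: "real \<Rightarrow> real" where "Tup x = (\<Sum>j. phi0 (4 ^ j * x))"
definition Tdown :: "real \<Rightarrow> real" where "Tdown x = (\<Sum>j. phi0 (x / 4 ^ Suc j))"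
text \<open>The sum of \<open>phi0\<close> (4^j x) over all integers j. It is split at j = 0 because
  the two halves converge for different reasons: \<open>phi0\<close> is at most 2/x for large
  arguments and at most x for small ones.\<close>

definition Phi :: "real \<Rightarrow> real" where "Phi x = Tup x + Tdown x"

lemma phi0_nonneg: "x \<ge> 0 \<Longrightarrow> phi0 x \<ge> 0" by (simp add: phi0_def)

lemma phi0_le: "x \<ge> 0 \<Longrightarrow> phi0 x \<le> x"
  by (simp add: phi0_def mult_left_le)

lemma square_le_exp: "x \<ge> 0 \<Longrightarrow> x ^ 2 \<le> 2 * exp (x::real)"
  using exp_lower_Taylor_quadratic[of x] by simp

lemma phi0_le_inverse: "x > 0 \<Longrightarrow> phi0 x \<le> 2 / x"
  using square_le_exp[of x] by (simp add: phi0_def exp_minus field_simps power2_eq_square)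

lemma summable_inv4: "summable (\<lambda>j. c / 4 ^ j :: real)"
  using summable_mult[OF summable_geometric[of "1/4::real"], of c] by (simp add: power_divide)

lemma suminf_inv4: "(\<Sum>j. c / 4 ^ j :: real) = 4 / 3 * c"
proof -
  have "(\<Sum>j. c * (1 / 4) ^ j :: real) = c * (\<Sum>j. (1 / 4) ^ j)"
    by (intro suminf_mult summable_geometric) auto
  thus ?thesis using suminf_geometric[of "1/4::real"] by (simp add: power_divide)
qed

lemma summable_Tup: "x > 0 \<Longrightarrow> summable (\<lambda>j. phi0 (4 ^ j * x))"
  by (rule summable_comparison_test'[OF summable_inv4[of "2 / x"], of 0])
     (use phi0_le_inverse[of "4 ^ _ * x"] phi0_nonneg[of "4 ^ _ * x"] in \<open>auto simp: field_simps\<close>)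

lemma summable_Tdown: "x > 0 \<Longrightarrow> summable (\<lambda>j. phi0 (x / 4 ^ Suc j))"
  by (rule summable_comparison_test'[OF summable_inv4[of "x / 4"], of 0])
     (use phi0_le[of "x / 4 ^ Suc _"] phi0_nonneg[of "x / 4 ^ Suc _"] in \<open>auto simp: field_simps\<close>)

lemma Tup_nonneg: "x > 0 \<Longrightarrow> Tup x \<ge> 0"
  unfolding Tup_def by (intro suminf_nonneg summable_Tup phi0_nonneg) auto

lemma Tdown_nonneg: "x > 0 \<Longrightarrow> Tdown x \<ge> 0"
  unfolding Tdown_def by (intro suminf_nonneg summable_Tdown phi0_nonneg) auto

lemma Tup_split: "x > 0 \<Longrightarrow> Tup x = (\<Sum>j<J. phi0 (4 ^ j * x)) + Tup (4 ^ J * x)"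
  unfolding Tup_def using suminf_split_initial_segment[OF summable_Tup, of x J]
  by (simp add: power_add mult_ac)

lemma Phi_periodic:
  assumes "x > 0"
  shows "Phi (4 * x) = Phi x"
proof -
  have "Tup x = phi0 x + Tup (4 * x)" using Tup_split[OF assms, of 1] by simp
  moreover have "Tdown (4 * x) = phi0 x + Tdown x"
    unfolding Tdown_def using suminf_split_head[OF summable_Tdown[of "4 * x"]] assms by simp
  ultimately show ?thesis by (simp add: Phi_def)
qed

lemma Phi_periodic_power: "x > 0 \<Longrightarrow> Phi (x / 4 ^ k) = Phi x"
proof (induction k)
  case (Suc k)
  thus ?case using Phi_periodic[of "x / 4 ^ Suc k"] by simp
qed simp

text \<open>The majorant has the shape x exp(-x/2) so that, at x = ns and weighted by
  |\<open>pdev n\<close>|/n, it again sums to a Laplace transform, at s/2. The constant 11 rounds up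
  8 * 4/3.\<close>

lemma Tup_le:
  assumes "x \<ge> 1"
  shows "Tup x \<le> 11 * (x * exp (-x / 2))"
proof -
  have "phi0 (4 ^ j * x) \<le> (8 * (x * exp (-x / 2))) / 4 ^ j" for j
  proof -
    define z where "z = 4 ^ j * x"
    have z: "z \<ge> x" using assms by (simp add: z_def)
    have zp: "z > 0" using z assms by simp
    \<comment> \<open>Of the two factors exp(-z/2), one is traded for 8/z^2 to make the sum over j
      converge, and the other keeps the decay in x.\<close>
    have "phi0 z = z * (exp (-z/2) * exp (-z/2))" by (simp add: phi0_def flip: exp_add)
    also have "\<dots> \<le> z * (8 / z ^ 2 * exp (-x/2))"
    proof (intro mult_left_mono mult_mono)
      have "(z / 2) ^ 2 \<le> 2 * exp (z / 2)" using zp by (intro square_le_exp) auto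
      thus "exp (- z / 2) \<le> 8 / z ^ 2" using zp by (simp add: exp_minus field_simps)
    qed (use z zp in auto)
    also have "\<dots> = 8 * exp (-x/2) / z" using zp by (simp add: power2_eq_square)
    also have "\<dots> = 8 * exp (-x/2) / x / 4 ^ j" by (simp add: z_def field_simps)
    also have "\<dots> \<le> 8 * exp (-x/2) * x / 4 ^ j"
    proof (intro divide_right_mono)
      have "8 * exp (-x/2) / x \<le> 8 * exp (-x/2) / 1" using assms by (intro divide_left_mono) auto
      also have "\<dots> \<le> 8 * exp (-x/2) * x" using assms by simp
      finally show "8 * exp (-x/2) / x \<le> 8 * exp (-x/2) * x" .
    qed auto
    finally show ?thesis by (simp add: z_def mult_ac)
  qed
  hence "Tup x \<le> (\<Sum>j. (8 * (x * exp (-x / 2))) / 4 ^ j)"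
    unfolding Tup_def using assms by (intro suminf_le summable_Tup summable_inv4) auto
  also have "\<dots> = 32 / 3 * (x * exp (-x / 2))" by (subst suminf_inv4) simp
  also have "\<dots> \<le> 11 * (x * exp (-x / 2))" using assms by (intro mult_right_mono) auto
  finally show ?thesis .
qed

text \<open>Both \<open>Tdown\<close> and the geometric sum over small scales are at most a third of
  their argument; for arguments up to 1 this brings them under the same majorant as
  \<open>Tup_le\<close>.\<close>

lemma third_le:
  assumes "0 < x" "x \<le> (1::real)"
  shows "x / 3 \<le> 11 * (x * exp (-x / 2))"
proof -
  have "1 / 2 \<le> exp (-x / 2)" using exp_ge_add_one_self[of "-x/2"] assms by simp
  hence "x * (1 / 2) \<le> x * exp (-x / 2)" using assms by (intro mult_left_mono) auto
  thus ?thesis using assms by simp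
qed

lemma Tdown_le:
  assumes "x > 0"
  shows "Tdown x \<le> x / 3"
proof -
  have "Tdown x \<le> (\<Sum>j. (x / 4) / 4 ^ j)"
    unfolding Tdown_def
  proof (intro suminf_le summable_Tdown summable_inv4 assms)
    fix j show "phi0 (x / 4 ^ Suc j) \<le> x / 4 / 4 ^ j" using phi0_le[of "x / 4 ^ Suc j"] assms by simp
  qed
  thus ?thesis by (subst (asm) suminf_inv4) simp
qed

text \<open>Inside the window the J scales miss only the two tails of \<open>Phi\<close>, namely
  \<open>Tup y\<close> and \<open>Tdown x\<close>. Outside it the whole sum is small: it is at most
  \<open>Tup x\<close> for x > 1, and a geometric sum of at most y/3 for y <= 1.\<close>

lemma truncated_periodization:
  fixes x :: real and J :: nat
  assumes "x > 0"
  defines "y \<equiv> 4 ^ J * x"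
  shows "\<bar>(\<Sum>j<J. phi0 (4 ^ j * x)) - (if 1 < y \<and> x \<le> 1 then Phi x else 0)\<bar>
          \<le> 11 * (x * exp (-x / 2)) + 11 * (y * exp (-y / 2))"
proof -
  define S where "S = (\<Sum>j<J. phi0 (4 ^ j * x))"
  have y: "y > 0" "y \<ge> x" using assms by (auto simp: y_def)
  have S: "S = Tup x - Tup y" using Tup_split[OF assms(1), of J] by (simp add: S_def y_def)
  have S0: "S \<ge> 0" unfolding S_def using assms by (intro sum_nonneg phi0_nonneg) auto
  have W: "0 \<le> 11 * (x * exp (-x / 2))" "0 \<le> 11 * (y * exp (-y / 2))" using assms y by auto
  consider "x > 1" | "x \<le> 1" "y > 1" | "y \<le> 1" using y by linarith
  hence "\<bar>S - (if 1 < y \<and> x \<le> 1 then Phi x else 0)\<bar> \<le> 11 * (x * exp (-x / 2)) + 11 * (y * exp (-y / 2))"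
  proof cases
    case 1
    thus ?thesis using S S0 W Tup_nonneg[OF y(1)] Tup_le[of x] by auto
  next
    case 2
    have "\<bar>S - Phi x\<bar> = Tup y + Tdown x"
      using S Tup_nonneg[OF y(1)] Tdown_nonneg[OF assms(1)] by (simp add: Phi_def)
    also have "\<dots> \<le> 11 * (y * exp (-y / 2)) + 11 * (x * exp (-x / 2))"
      using 2 assms Tdown_le[of x] third_le[of x] Tup_le[of y] by linarith
    finally show ?thesis using 2 by simp
  next
    case 3
    have "S \<le> (\<Sum>j<J. 4 ^ j * x)"
      unfolding S_def using assms by (intro sum_mono phi0_le) auto
    also have "\<dots> \<le> y / 3"
    proof -
      have "3 * (\<Sum>j<J. 4 ^ j * x) = (4 ^ J - 1) * x" by (induction J) (auto simp: algebra_simps)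
      thus ?thesis using assms by (simp add: y_def algebra_simps)
    qed
    also have "\<dots> \<le> 11 * (y * exp (-y / 2))" using 3 y by (intro third_le) auto
    finally show ?thesis using 3 S0 W by auto
  qed
  thus ?thesis by (simp add: S_def)
qed

text \<open>In the logarithmic variable both series converge uniformly on bounded intervals only, so
  continuity is shown there and then pointwise.\<close>

lemma continuous_Phi_exp:
  assumes "s > 0"
  shows "continuous_on UNIV (\<lambda>v. Phi (s * exp (v * ln 4)))"
proof -
  define g where "g v = s * exp (v * ln 4)" for v :: real
  have gp: "g v > 0" for v using assms by (simp add: g_def)
  have contg: "continuous_on A g" for A unfolding g_def by (intro continuous_intros)
  have contphi: "continuous_on A (\<lambda>v. phi0 (f v))" if "continuous_on A f" for A and f :: "real \<Rightarrow> real"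
    unfolding phi0_def by (intro continuous_intros that)
  have "continuous_on {-R<..<R} (\<lambda>v. Tup (g v) + Tdown (g v))" for R :: real
  proof -
    define a b where "a = g (-R)" and "b = g R"
    have ab: "a > 0" "b > 0" by (simp_all add: a_def b_def gp)
    have gb: "a \<le> g v" "g v \<le> b" if "v \<in> {-R<..<R}" for v
      using that assms mult_right_mono[of "-R" v "ln 4"] mult_right_mono[of v R "ln 4"]
      by (auto simp: a_def b_def g_def)
    have "uniform_limit {-R<..<R} (\<lambda>n v. \<Sum>j<n. phi0 (4 ^ j * g v)) (\<lambda>v. \<Sum>j. phi0 (4 ^ j * g v)) sequentially"
    proof (rule Weierstrass_m_test[OF _ summable_inv4[of "2 / a"]])
      fix j v assume v: "v \<in> {-R<..<R}"
      have "phi0 (4 ^ j * g v) \<le> 2 / (4 ^ j * g v)" using gp by (intro phi0_le_inverse) auto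
      also have "\<dots> \<le> 2 / (4 ^ j * a)" using gb[OF v] ab by (intro divide_left_mono mult_left_mono mult_pos_pos gp) auto
      finally show "norm (phi0 (4 ^ j * g v)) \<le> 2 / a / 4 ^ j"
        using phi0_nonneg[of "4 ^ j * g v"] gp[of v] by (simp add: mult_ac)
    qed
    hence 1: "continuous_on {-R<..<R} (\<lambda>v. Tup (g v))"
      unfolding Tup_def
      by (rule uniform_limit_theorem[rotated]) (auto intro!: always_eventually continuous_intros contphi contg)
    have "uniform_limit {-R<..<R} (\<lambda>n v. \<Sum>j<n. phi0 (g v / 4 ^ Suc j)) (\<lambda>v. \<Sum>j. phi0 (g v / 4 ^ Suc j)) sequentially"
    proof (rule Weierstrass_m_test[OF _ summable_inv4[of "b / 4"]])
      fix j v assume v: "v \<in> {-R<..<R}"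
      have "phi0 (g v / 4 ^ Suc j) \<le> g v / 4 ^ Suc j" using gp[of v] by (intro phi0_le) auto
      also have "\<dots> \<le> b / 4 ^ Suc j" using gb[OF v] by (intro divide_right_mono) auto
      finally show "norm (phi0 (g v / 4 ^ Suc j)) \<le> b / 4 / 4 ^ j"
        using phi0_nonneg[of "g v / 4 ^ Suc j"] gp[of v] by simp
    qed
    hence 2: "continuous_on {-R<..<R} (\<lambda>v. Tdown (g v))"
      unfolding Tdown_def
      by (rule uniform_limit_theorem[rotated]) (auto intro!: always_eventually continuous_intros contphi contg)
    from 1 2 show ?thesis by (intro continuous_intros)
  qed
  hence "isCont (\<lambda>v. Tup (g v) + Tdown (g v)) v" for v
    by (rule continuous_on_interior[of "{- (\<bar>v\<bar> + 1)<..<\<bar>v\<bar> + 1}"]) (simp add: interior_open, linarith)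
  thus ?thesis by (simp add: continuous_on_eq_continuous_at Phi_def g_def)
qed

section \<open>Deviation of the primes from density 1 along the scales 4^k\<close>

definition pdev :: "nat \<Rightarrow> real" where "pdev n = plog n - (if n = 0 then 0 else 1)"

lemma pdev_0 [simp]: "pdev 0 = 0" by (simp add: pdev_def plog_def)

lemma abs_pdev_le: "\<bar>pdev n\<bar> \<le> plog n + (if n = 0 then 0 else 1)"
  using plog_nonneg[of n] by (auto simp: pdev_def)

lemma sum_plog_le: "(\<Sum>n=1..N. plog n) \<le> 4 * real N"
  using sum_mono[of "{1..N}" plog Lam] plog_le_mangoldt psi_le[of N] unfolding psi_def by fastforce

lemma sum_abs_pdev_le: "(\<Sum>n=1..N. \<bar>pdev n\<bar>) \<le> 5 * real N"
proof -
  have "(\<Sum>n=1..N. \<bar>pdev n\<bar>) \<le> (\<Sum>n=1..N. plog n + 1)"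
  proof (intro sum_mono)
    fix n assume "n \<in> {1..N}"
    thus "\<bar>pdev n\<bar> \<le> plog n + 1" using abs_pdev_le[of n] by simp
  qed
  thus ?thesis using sum_plog_le[of N] by (simp add: sum.distrib)
qed

lemma summable_pdev_exp: "s > 0 \<Longrightarrow> summable (\<lambda>n. \<bar>pdev n\<bar> * exp (-(s * real n)))"
  and pdev_laplace_le: "s > 0 \<Longrightarrow> s * (\<Sum>n. \<bar>pdev n\<bar> * exp (-(s * real n))) \<le> 5"
  using laplace_bound[of "\<lambda>n. \<bar>pdev n\<bar>" 5 s] sum_abs_pdev_le by auto

text \<open>This is h(s) minus the same transform of the constant sequence 1. It equals the sum of
  \<open>pdev n\<close>/n times \<open>phi0\<close> (ns), which is where \<open>phi0\<close> comes
  from.\<close>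

definition lapdev :: "real \<Rightarrow> real" where "lapdev s = s * (\<Sum>n. pdev n * exp (-(s * real n)))"

text \<open>The mass that multiplies the approximation error in
  \<open>periodic_twisted_sum_bound\<close>. The 9 consists of two Mertens errors of 4 and one
  harmonic error of 1.\<close>

lemma window_sum_le:
  fixes M N :: nat and c :: real
  assumes "1 \<le> M" "M \<le> N" "real N \<le> c * real M" "c > 0"
  shows "(\<Sum>n\<in>{M<..N}. \<bar>pdev n\<bar> / real n) \<le> 2 * ln c + 9"
proof -
  have split: "(\<Sum>n\<in>{M<..N}. g n) = (\<Sum>n=1..N. g n) - (\<Sum>n=1..M. g n)" for g :: "nat \<Rightarrow> real"
  proof -
    have "{1..N} = {1..M} \<union> {M<..N}" using assms by auto
    thus ?thesis by (simp only:) (subst sum.union_disjoint, auto)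
  qed
  have "(\<Sum>n\<in>{M<..N}. \<bar>pdev n\<bar> / real n) \<le> (\<Sum>n\<in>{M<..N}. Lam n / real n + 1 / real n)"
  proof (intro sum_mono)
    fix n assume n: "n \<in> {M<..N}"
    have "\<bar>pdev n\<bar> \<le> Lam n + 1" using abs_pdev_le[of n] plog_le_mangoldt[of n] n by simp
    thus "\<bar>pdev n\<bar> / real n \<le> Lam n / real n + 1 / real n"
      by (simp add: divide_right_mono flip: add_divide_distrib)
  qed
  also have "\<dots> = (\<Sum>n\<in>{M<..N}. Lam n / real n) + (\<Sum>n\<in>{M<..N}. 1 / real n)" by (rule sum.distrib)
  also have "(\<Sum>n\<in>{M<..N}. Lam n / real n) \<le> ln (real N) - ln (real M) + 8"
    unfolding split using mertens_first[of N] mertens_first[of M] assms by linarith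
  also have "(\<Sum>n\<in>{M<..N}. 1 / real n) \<le> ln (real N) - ln (real M) + 1"
  proof -
    have "ln (real M) \<le> ln (real M + 1)" using assms by simp
    also have "\<dots> \<le> (\<Sum>n=1..M. 1 / real n)"
      using ln_le_harm[of M] by (simp add: harm_def inverse_eq_divide)
    finally show ?thesis unfolding split using sum_inverse_le[of N] assms by linarith
  qed
  finally have "(\<Sum>n\<in>{M<..N}. \<bar>pdev n\<bar> / real n) \<le> 2 * (ln (real N) - ln (real M)) + 9" by simp
  moreover have "ln (real N) \<le> ln (c * real M)" using assms by (subst ln_le_cancel_iff) auto
  hence "2 * (ln (real N) - ln (real M)) + 9 \<le> 2 * ln c + 9" using assms by (simp add: ln_mult)
  ultimately show ?thesis by (rule order_trans)
qed

lemma le_nat_floor_iff: "x \<ge> (0::real) \<Longrightarrow> n \<le> nat \<lfloor>x\<rfloor> \<longleftrightarrow> real n \<le> x"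
  by linarith

text \<open>Adding the transforms over J consecutive scales replaces \<open>phi0\<close> by its
  truncated periodization, hence by \<open>Phi\<close> on the window 4^(-J) < ns <= 1. The boundary
  error does not grow with J, because only the two ends of the window contribute.\<close>

lemma lapdev_window:
  fixes s :: real and J :: nat
  assumes "s > 0"
  shows "\<bar>(\<Sum>j<J. lapdev (4 ^ j * s)) -
          (\<Sum>n\<in>{nat \<lfloor>1 / (4 ^ J * s)\<rfloor><..nat \<lfloor>1 / s\<rfloor>}. pdev n / real n * Phi (real n * s))\<bar> \<le> 220"
proof -
  define W where "W = {nat \<lfloor>1 / (4 ^ J * s)\<rfloor><..nat \<lfloor>1 / s\<rfloor>}"
  define S where "S x = (\<Sum>j<J. phi0 (4 ^ j * x))" for x
  have W: "n \<in> W \<longleftrightarrow> 1 < 4 ^ J * (real n * s) \<and> real n * s \<le> 1" for n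
  proof -
    have "n \<le> nat \<lfloor>1 / s\<rfloor> \<longleftrightarrow> real n \<le> 1 / s" using assms by (intro le_nat_floor_iff) auto
    moreover have "n \<le> nat \<lfloor>1 / (4 ^ J * s)\<rfloor> \<longleftrightarrow> real n \<le> 1 / (4 ^ J * s)"
      using assms by (intro le_nat_floor_iff) auto
    ultimately show ?thesis using assms unfolding W_def greaterThanAtMost_iff not_le[symmetric]
      by (auto simp: field_simps)
  qed
  have sm: "summable (\<lambda>n. pdev n * exp (-(u * real n)))" if "u > 0" for u
    by (rule summable_rabs_cancel) (use summable_pdev_exp[OF that] in \<open>simp add: abs_mult\<close>)
  have "(\<lambda>n. pdev n / real n * phi0 (4 ^ j * (real n * s))) sums lapdev (4 ^ j * s)" for j
  proof -
    have "(\<lambda>n. 4 ^ j * s * (pdev n * exp (-(4 ^ j * s * real n)))) sums lapdev (4 ^ j * s)"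
      unfolding lapdev_def using assms by (intro sums_mult summable_sums sm) auto
    moreover have "4 ^ j * s * (pdev n * exp (-(4 ^ j * s * real n))) = pdev n / real n * phi0 (4 ^ j * (real n * s))" for n
      by (cases "n = 0") (auto simp: phi0_def field_simps)
    ultimately show ?thesis by simp
  qed
  hence "(\<lambda>n. \<Sum>j<J. pdev n / real n * phi0 (4 ^ j * (real n * s))) sums (\<Sum>j<J. lapdev (4 ^ j * s))"
    by (intro sums_sum) auto
  hence s1: "(\<lambda>n. pdev n / real n * S (real n * s)) sums (\<Sum>j<J. lapdev (4 ^ j * s))"
    by (simp only: S_def sum_distrib_left)
  have s2: "(\<lambda>n. if n \<in> W then pdev n / real n * Phi (real n * s) else 0) sums (\<Sum>n\<in>W. pdev n / real n * Phi (real n * s))"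
    by (rule sums_If_finite_set) (simp add: W_def)
  define d where "d n = pdev n / real n * S (real n * s) - (if n \<in> W then pdev n / real n * Phi (real n * s) else 0)" for n
  define u where "u = 4 ^ J * s"
  have u: "u > 0" using assms by (simp add: u_def)
  have sd: "d sums ((\<Sum>j<J. lapdev (4 ^ j * s)) - (\<Sum>n\<in>W. pdev n / real n * Phi (real n * s)))"
    unfolding d_def by (intro sums_diff s1 s2)
  define e where "e s n = \<bar>pdev n\<bar> * exp (-(s / 2 * real n))" for s :: real and n :: nat
  have dle: "norm (d n) \<le> 11 * (s * e s n) + 11 * (u * e u n)" for n
  proof (cases "n = 0")
    case False
    define x where "x = real n * s"
    have x: "x > 0" using False assms by (simp add: x_def)
    have "d n = pdev n / real n * (S x - (if 1 < 4 ^ J * x \<and> x \<le> 1 then Phi x else 0))"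
      using W[of n] by (simp add: d_def x_def right_diff_distrib)
    also have "norm \<dots> \<le> \<bar>pdev n\<bar> / real n * (11 * (x * exp (-x / 2)) + 11 * (4 ^ J * x * exp (-(4 ^ J * x) / 2)))"
      unfolding norm_mult using truncated_periodization[OF x, of J]
      by (intro mult_mono) (auto simp: S_def)
    also have "\<dots> = 11 * (s * e s n) + 11 * (u * e u n)"
      using False by (simp add: x_def e_def u_def field_simps)
    finally show ?thesis .
  qed (auto simp: d_def e_def)
  have se: "summable (e r)" "r * suminf (e r) \<le> 10" if "r > 0" for r
    using summable_pdev_exp[of "r / 2"] pdev_laplace_le[of "r / 2"] that
    unfolding e_def[abs_def] by auto
  have smD: "summable (\<lambda>n. 11 * (s * e s n) + 11 * (u * e u n))"
    by (intro summable_add summable_mult se assms u)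
  have "norm (suminf d) \<le> (\<Sum>n. 11 * (s * e s n) + 11 * (u * e u n))"
    by (rule norm_suminf_le[OF dle smD])
  also have "\<dots> = 11 * (s * suminf (e s)) + 11 * (u * suminf (e u))"
    using se(1)[OF assms] se(1)[OF u]
    by (subst suminf_add[symmetric]) (auto simp: suminf_mult summable_mult)
  \<comment> \<open>The normalized Laplace transform of |\<open>pdev\<close>| is at most 5;
    evaluating it at half the parameter doubles this to 10.\<close>
  also have "\<dots> \<le> 11 * 10 + 11 * 10" by (intro add_mono mult_left_mono se assms u) auto
  finally show ?thesis using sd by (simp add: sums_iff W_def)
qed

text \<open>A block of J scales is a window of logarithmic length about J ln 4, on which the
  equidistribution bound costs \<open>\<epsilon>\<close> J. It matters that K depends neither on the
  position nor on the length of the block.\<close>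

theorem lapdev_block_sums:
  fixes s0 \<epsilon> :: real
  assumes s0: "0 < s0" "s0 \<le> 1" and "\<epsilon> > 0"
  obtains K where "\<And>i J. \<bar>\<Sum>k\<in>{i<..i+J}. lapdev (s0 / 4 ^ k)\<bar> \<le> \<epsilon> * real J + K"
proof -
  define q where "q v = Phi (s0 * exp (v * ln 4))" for v :: real
  have "q (v + 1) = q v" for v
    using Phi_periodic[of "s0 * exp (v * ln 4)"] s0 by (simp add: q_def ring_distribs exp_add mult_ac)
  moreover have "continuous_on UNIV q" unfolding q_def by (rule continuous_Phi_exp[OF s0(1)])
  ultimately obtain K where K: "\<And>M N. M \<le> N \<Longrightarrow> \<bar>\<Sum>n\<in>{M<..N}. (plog n - 1) / real n * q (ln (real n) / ln 4)\<bar>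
                      \<le> \<epsilon> / 3 * (\<Sum>n\<in>{M<..N}. \<bar>plog n - 1\<bar> / real n) + K"
    using periodic_twisted_sum_bound[of q "\<epsilon> / 3" "ln 4"] \<open>\<epsilon> > 0\<close> by auto
  show ?thesis
  proof (rule that)
    fix i J :: nat
    define s where "s = s0 / 4 ^ (i + J)"
    have s: "s > 0" using s0 by (simp add: s_def)
    define M N where "M = nat \<lfloor>1 / (4 ^ J * s)\<rfloor>" and "N = nat \<lfloor>1 / s\<rfloor>"
    have Js: "4 ^ J * s = s0 / 4 ^ i" by (simp add: s_def power_add)
    have "s0 \<le> 4 ^ i" using s0 one_le_power[of "4::real" i] by linarith
    hence ge: "1 / (4 ^ J * s) \<ge> 1" using s0 by (simp add: Js)
    have le: "1 / (4 ^ J * s) \<le> 1 / s" using s by (intro divide_left_mono) auto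
    have M1: "1 \<le> M" using ge unfolding M_def by linarith
    have MN: "M \<le> N" unfolding M_def N_def by (intro nat_mono floor_mono le)
    have "real N \<le> 1 / s" using s by (simp add: N_def)
    also have "\<dots> = 4 ^ J * (1 / (4 ^ J * s))" by simp
    also have "\<dots> \<le> 4 ^ J * (2 * real M)"
    proof (intro mult_left_mono)
      have "1 / (4 ^ J * s) < real M + 1" unfolding M_def using ge by linarith
      thus "1 / (4 ^ J * s) \<le> 2 * real M" using M1 by linarith
    qed auto
    finally have NM: "real N \<le> (2 * 4 ^ J) * real M" by simp
    have "ln (2 * 4 ^ J :: real) = ln 2 * (2 * real J + 1)"
    proof -
      have "(2 * 4 ^ J :: real) = 2 ^ (2 * J + 1)" by (simp add: power_mult)
      thus ?thesis by (simp only: ln_realpow) (simp add: algebra_simps)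
    qed
    also have "\<dots> \<le> 25 / 36 * (2 * real J + 1)" by (intro mult_right_mono ln2_le_25_over_36) auto
    finally have ln: "2 * ln (2 * 4 ^ J :: real) + 9 \<le> 3 * real J + 11" by (simp add: algebra_simps)
    \<comment> \<open>By periodicity of \<open>Phi\<close> the scale s = s0/4^(i+J) can be replaced
      by s0. Thus one function \<open>q\<close>, and one constant K, serve all blocks.\<close>
    have P: "Phi (real n * s) = q (ln (real n) / ln 4)" if "n \<ge> 1" for n
    proof -
      have "Phi (real n * s) = Phi (real n * s0)"
        using Phi_periodic_power[of "real n * s0" "i + J"] that s0 by (simp add: s_def)
      thus ?thesis using that by (simp add: q_def mult.commute)
    qed
    have "(\<Sum>n\<in>{M<..N}. pdev n / real n * Phi (real n * s)) = (\<Sum>n\<in>{M<..N}. (plog n - 1) / real n * q (ln (real n) / ln 4))"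
      by (intro sum.cong refl) (auto simp: P pdev_def)
    also have "\<bar>\<dots>\<bar> \<le> \<epsilon> / 3 * (\<Sum>n\<in>{M<..N}. \<bar>plog n - 1\<bar> / real n) + K" by (rule K[OF MN])
    also have "(\<Sum>n\<in>{M<..N}. \<bar>plog n - 1\<bar> / real n) = (\<Sum>n\<in>{M<..N}. \<bar>pdev n\<bar> / real n)"
      by (intro sum.cong refl) (auto simp: pdev_def)
    also have "\<dots> \<le> 2 * ln (2 * 4 ^ J) + 9" by (intro window_sum_le M1 MN NM) auto
    also have "\<dots> \<le> 3 * real J + 11" by (rule ln)
    finally have 1: "\<bar>\<Sum>n\<in>{M<..N}. pdev n / real n * Phi (real n * s)\<bar> \<le> \<epsilon> / 3 * (3 * real J + 11) + K"
      using \<open>\<epsilon> > 0\<close> by simp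
    have 2: "\<bar>(\<Sum>j<J. lapdev (4 ^ j * s)) - (\<Sum>n\<in>{M<..N}. pdev n / real n * Phi (real n * s))\<bar> \<le> 220"
      unfolding M_def N_def by (rule lapdev_window[OF s])
    \<comment> \<open>The scales run in opposite directions: j = 0 is the finest one, k = i + J.
      This is why the block excludes i and includes i + J.\<close>
    have 3: "(\<Sum>k\<in>{i<..i+J}. lapdev (s0 / 4 ^ k)) = (\<Sum>j<J. lapdev (4 ^ j * s))"
    proof (rule sum.reindex_bij_witness[where i = "\<lambda>j. i + J - j" and j = "\<lambda>k. i + J - k"], goal_cases)
      case (5 k)
      have "(4::real) ^ (i + J - k) * s = s0 / 4 ^ k"
        using 5 by (simp add: s_def field_simps flip: power_add)
      thus ?case by simp
    qed auto
    show "\<bar>\<Sum>k\<in>{i<..i+J}. lapdev (s0 / 4 ^ k)\<bar> \<le> \<epsilon> * real J + (11 / 3 * \<epsilon> + K + 220)"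
      using 1 2 unfolding 3 by (simp add: algebra_simps abs_le_iff)
  qed
qed

text \<open>Fix J so large that every block of length J has mean at most r/2. Far out, the terms of
  a block differ from the one just before it by at most r/4, so that term is at most 3r/4.\<close>

lemma slowly_varying_block_sums_tendsto_0:
  fixes x :: "nat \<Rightarrow> real"
  assumes slow: "(\<lambda>i. x (Suc i) - x i) \<longlonglongrightarrow> 0"
    and block: "\<And>\<epsilon>. \<epsilon> > 0 \<Longrightarrow> \<exists>K. \<forall>i J. \<bar>\<Sum>k\<in>{i<..i+J}. x k\<bar> \<le> \<epsilon> * real J + K"
  shows "x \<longlonglongrightarrow> 0"
proof (rule LIMSEQ_I)
  fix r :: real assume r: "r > 0"
  obtain K where K: "\<And>i J. \<bar>\<Sum>k\<in>{i<..i+J}. x k\<bar> \<le> r / 4 * real J + K"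
    using block[of "r / 4"] r by auto
  obtain J :: nat where J: "J > 0" "K \<le> r / 4 * real J"
  proof
    show "nat \<lceil>4 * K / r\<rceil> + 1 > 0" by simp
    have "4 * K / r \<le> real (nat \<lceil>4 * K / r\<rceil> + 1)" by linarith
    thus "K \<le> r / 4 * real (nat \<lceil>4 * K / r\<rceil> + 1)" using r by (simp add: field_simps)
  qed
  obtain i0 where i0: "\<And>i. i \<ge> i0 \<Longrightarrow> \<bar>x (Suc i) - x i\<bar> \<le> r / (4 * real J)"
    using LIMSEQ_D[OF slow, of "r / (4 * real J)"] r J by (auto intro: less_imp_le)
  have "\<bar>x i\<bar> < r" if i: "i \<ge> i0" for i
  proof -
    have dev: "\<bar>x (i + j) - x i\<bar> \<le> real j * (r / (4 * real J))" for j
    proof (induction j)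
      case (Suc j)
      have "real (Suc j) * (r / (4 * real J)) = real j * (r / (4 * real J)) + r / (4 * real J)"
        by (simp only: of_nat_Suc distrib_right mult_1)
      moreover have "\<bar>x (Suc (i + j)) - x (i + j)\<bar> \<le> r / (4 * real J)" using i by (intro i0) auto
      ultimately show ?case using Suc unfolding add_Suc_right by linarith
    qed simp
    have "\<bar>\<Sum>k\<in>{i<..i+J}. x k - x i\<bar> \<le> (\<Sum>k\<in>{i<..i+J}. r / 4)"
    proof (intro order_trans[OF sum_abs] sum_mono)
      fix k assume k: "k \<in> {i<..i+J}"
      have "\<bar>x k - x i\<bar> \<le> real (k - i) * (r / (4 * real J))" using dev[of "k - i"] k by simp
      also have "\<dots> \<le> real J * (r / (4 * real J))" using k r by (intro mult_right_mono) auto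
      also have "\<dots> = r / 4" using J by simp
      finally show "\<bar>x k - x i\<bar> \<le> r / 4" .
    qed
    moreover have "(\<Sum>k\<in>{i<..i+J}. x k - x i) = (\<Sum>k\<in>{i<..i+J}. x k) - real J * x i"
      by (simp add: sum_subtractf)
    ultimately have "\<bar>(\<Sum>k\<in>{i<..i+J}. x k) - real J * x i\<bar> \<le> real J * (r / 4)" by simp
    moreover have "\<bar>\<Sum>k\<in>{i<..i+J}. x k\<bar> \<le> 2 * (real J * (r / 4))" using K[of i J] J by (simp add: algebra_simps)
    ultimately have "\<bar>real J * x i\<bar> \<le> 3 * (real J * (r / 4))" by linarith
    hence "real J * \<bar>x i\<bar> \<le> real J * (3 * r / 4)" by (simp add: abs_mult)
    hence "\<bar>x i\<bar> \<le> 3 * r / 4" using J by (simp only: mult_le_cancel_left)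
    thus ?thesis using r by simp
  qed
  thus "\<exists>no. \<forall>n\<ge>no. norm (x n - 0) < r" by auto
qed

section \<open>The Laplace transform of the primes and the product formula\<close>

definition primelap :: "real \<Rightarrow> real" where "primelap s = (\<Sum>n. plog n * exp (-(s * real n)))"

lemma summable_primelap: "s > 0 \<Longrightarrow> summable (\<lambda>n. plog n * exp (-(s * real n)))"
  and primelap_le: "s > 0 \<Longrightarrow> s * primelap s \<le> 4"
  unfolding primelap_def
  using laplace_bound[of plog 4 s] sum_plog_le plog_nonneg by (auto simp: plog_def[of 0])

lemma primelap_nonneg: "s > 0 \<Longrightarrow> primelap s \<ge> 0"
  unfolding primelap_def by (intro suminf_nonneg summable_primelap) (auto simp: plog_nonneg)

lemma primelap_antimono: "0 < s \<Longrightarrow> s \<le> t \<Longrightarrow> primelap t \<le> primelap s"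
  unfolding primelap_def
  by (intro suminf_le summable_primelap mult_left_mono) (auto simp: plog_nonneg mult_right_mono)

lemma sums_exp_Suc:
  assumes "s > (0::real)"
  shows "(\<lambda>n. if n = 0 then 0 else exp (-(s * real n))) sums (1 / (exp s - 1))"
proof -
  have "(\<lambda>n. exp (-s) ^ n) sums (1 / (1 - exp (-s)))"
    using assms by (intro geometric_sums) auto
  hence "(\<lambda>n. exp (-s) * exp (-s) ^ n) sums (exp (-s) * (1 / (1 - exp (-s))))" by (rule sums_mult)
  also have "exp (-s) * (1 / (1 - exp (-s))) = 1 / (exp s - 1)"
    using assms by (simp add: exp_minus field_simps)
  also have "(\<lambda>n. exp (-s) * exp (-s) ^ n) = (\<lambda>n. exp (-(s * real (Suc n))))"
    by (simp add: mult.commute ring_distribs exp_diff exp_minus field_simps flip: exp_of_nat_mult exp_add)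
  finally have "(\<lambda>n. exp (-(s * real (Suc n)))) sums (1 / (exp s - 1))" .
  thus ?thesis
    using sums_Suc[of "\<lambda>n. if n = 0 then 0 else exp (-(s * real n))"] by simp
qed

lemma primelap_eq_lapdev:
  assumes "s > 0"
  shows "s * primelap s = lapdev s + s / (exp s - 1)"
proof -
  have "(\<lambda>n. plog n * exp (-(s * real n)) - (if n = 0 then 0 else exp (-(s * real n)))) sums
          (primelap s - 1 / (exp s - 1))"
    unfolding primelap_def by (intro sums_diff summable_sums summable_primelap sums_exp_Suc assms)
  also have "(\<lambda>n. plog n * exp (-(s * real n)) - (if n = 0 then 0 else exp (-(s * real n)))) = (\<lambda>n. pdev n * exp (-(s * real n)))"
    by (auto simp: pdev_def fun_eq_iff algebra_simps)
  finally have "lapdev s = s * (primelap s - 1 / (exp s - 1))" by (simp add: lapdev_def sums_iff)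
  thus ?thesis by (simp add: algebra_simps)
qed

text \<open>Only the dyadic values s = 2^(-k) are needed. Even and odd exponents form two chains
  under s -> s/4; each chain of normalized values tends to 1, and c is the limit of products of
  neighbours from the two chains.\<close>

theorem primelap_product_limit:
  assumes lim: "(\<lambda>k. (1 / 2 ^ k * primelap (1 / 2 ^ k)) * (1 / 2 ^ Suc k * primelap (1 / 2 ^ Suc k))) \<longlonglongrightarrow> c"
  shows "c = 1"
proof -
  define \<eta> where "\<eta> k = 1 / 2 ^ k * primelap (1 / 2 ^ k)" for k :: nat
  define \<rho> where "\<rho> k = (1 / 2 ^ k) / (exp (1 / 2 ^ k) - 1 :: real)" for k :: nat
  have lim: "(\<lambda>k. \<eta> k * \<eta> (Suc k)) \<longlonglongrightarrow> c" using lim by (simp add: \<eta>_def)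
  have eta: "\<eta> k = lapdev (1 / 2 ^ k) + \<rho> k" for k
    unfolding \<eta>_def \<rho>_def by (rule primelap_eq_lapdev) simp
  have rho: "\<rho> \<longlonglongrightarrow> 1"
  proof -
    have "((\<lambda>s::real. s / (exp s - 1)) \<longlongrightarrow> 1) (at_right 0)" by real_asymp
    moreover have "filterlim (\<lambda>k. 1 / 2 ^ k :: real) (at_right 0) sequentially" by real_asymp
    ultimately show ?thesis unfolding \<rho>_def by (rule filterlim_compose)
  qed
  have nonneg: "\<eta> k \<ge> 0" for k unfolding \<eta>_def by (intro mult_nonneg_nonneg primelap_nonneg) auto
  \<comment> \<open>P increases as s decreases, and only the factor s is halved.\<close>
  have half: "\<eta> (Suc k) \<ge> \<eta> k / 2" for k
    using primelap_antimono[of "1 / 2 ^ Suc k" "1 / 2 ^ k"] by (simp add: \<eta>_def field_simps)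
  have half': "\<eta> (k + j) \<ge> \<eta> k / 2 ^ j" for k j
  proof (induction j)
    case (Suc j)
    have "\<eta> k / 2 ^ Suc j \<le> \<eta> (k + j) / 2" using Suc by (simp add: field_simps)
    also have "\<dots> \<le> \<eta> (k + Suc j)" using half[of "k + j"] by simp
    finally show ?case .
  qed simp
  have blocks: "\<exists>K. \<forall>i J. \<bar>\<Sum>k\<in>{i<..i+J}. lapdev (s0 / 4 ^ k)\<bar> \<le> \<epsilon> * real J + K"
    if "0 < s0" "s0 \<le> 1" "\<epsilon> > 0" for s0 \<epsilon>
    using lapdev_block_sums[OF that] by blast
  \<comment> \<open>A lower bound before any convergence is known: every block of J scales contains
    one where the normalized value is at least 3/4 - 1/2, and from there to the index m at most 2J +
    2 halvings are lost.\<close>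
  obtain \<delta> m0 where \<delta>: "\<delta> > 0" "\<And>m. m \<ge> m0 \<Longrightarrow> \<eta> m \<ge> \<delta>"
  proof -
    obtain K where K: "\<And>i J. \<bar>\<Sum>k\<in>{i<..i+J}. lapdev (1 / 4 ^ k)\<bar> \<le> 1 / 4 * real J + K"
      using blocks[of 1 "1/4"] by auto
    define J where "J = nat \<lceil>4 * K\<rceil> + 1"
    have "J > 0" by (simp add: J_def)
    moreover have "4 * K \<le> real J" unfolding J_def by linarith
    ultimately have J: "J > 0" "K \<le> 1 / 4 * real J" by auto
    obtain k0 where k0: "\<And>k. k \<ge> k0 \<Longrightarrow> \<rho> k \<ge> 3 / 4"
      using order_tendstoD(1)[OF rho, of "3/4"] by (auto simp: eventually_sequentially intro: less_imp_le)
    show ?thesis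
    proof (rule that[of "1 / 4 / 2 ^ (2 * J + 2)" "2 * (k0 + J)"])
      fix m assume m: "m \<ge> 2 * (k0 + J)"
      define i where "i = m div 2 - J"
      have i: "i \<ge> k0" "2 * (i + J) \<le> m" "m < 2 * (i + J) + 2" using m by (auto simp: i_def)
      have "\<exists>k\<in>{i<..i+J}. lapdev (1 / 4 ^ k) \<ge> -1/2"
      proof (rule ccontr)
        assume "\<not> ?thesis"
        hence "(\<Sum>k\<in>{i<..i+J}. lapdev (1 / 4 ^ k)) < (\<Sum>k\<in>{i<..i+J}. -1/2)"
          using J by (intro sum_strict_mono) (auto simp: not_le)
        thus False using K[of i J] J by simp
      qed
      then obtain k where k: "k \<in> {i<..i+J}" "lapdev (1 / 4 ^ k) \<ge> -1/2" by blast
      have "(4::real) ^ k = 2 ^ (2 * k)" by (simp add: power_mult)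
      hence e: "\<eta> (2 * k) \<ge> 1 / 4" using eta[of "2 * k"] k k0[of "2 * k"] i by simp
      have "1 / 4 / 2 ^ (2 * J + 2) \<le> 1 / 4 / (2::real) ^ (m - 2 * k)"
        using k i by (intro divide_left_mono power_increasing) auto
      also have "\<dots> \<le> \<eta> (2 * k) / 2 ^ (m - 2 * k)" using e by (intro divide_right_mono) auto
      also have "\<dots> \<le> \<eta> m" using half'[of "2 * k" "m - 2 * k"] k i by simp
      finally show "1 / 4 / 2 ^ (2 * J + 2) \<le> \<eta> m" .
    qed auto
  qed
  \<comment> \<open>Consecutive products share the factor \<open>\<eta> (Suc k)\<close>. Their
    difference tends to 0, and the shared factor may be divided out because it is at least
    \<open>\<delta>\<close>.\<close>
  have slow: "(\<lambda>k. \<eta> (Suc (Suc k)) - \<eta> k) \<longlonglongrightarrow> 0"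
  proof (rule tendsto_rabs_zero_cancel, rule tendsto_sandwich[where f = "\<lambda>_. 0" and
      h = "\<lambda>k. \<bar>\<eta> (Suc k) * \<eta> (Suc (Suc k)) - \<eta> k * \<eta> (Suc k)\<bar> / \<delta>"])
    have "(\<lambda>k. \<eta> (Suc k) * \<eta> (Suc (Suc k)) - \<eta> k * \<eta> (Suc k)) \<longlonglongrightarrow> c - c"
      by (intro tendsto_diff lim LIMSEQ_Suc[OF lim])
    hence "(\<lambda>k. \<bar>\<eta> (Suc k) * \<eta> (Suc (Suc k)) - \<eta> k * \<eta> (Suc k)\<bar> / \<delta>) \<longlonglongrightarrow> \<bar>c - c\<bar> / \<delta>"
      using \<delta> by (intro tendsto_divide tendsto_rabs tendsto_const) auto
    thus "(\<lambda>k. \<bar>\<eta> (Suc k) * \<eta> (Suc (Suc k)) - \<eta> k * \<eta> (Suc k)\<bar> / \<delta>) \<longlonglongrightarrow> 0" by simp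
    show "\<forall>\<^sub>F k in sequentially. \<bar>\<eta> (Suc (Suc k)) - \<eta> k\<bar> \<le> \<bar>\<eta> (Suc k) * \<eta> (Suc (Suc k)) - \<eta> k * \<eta> (Suc k)\<bar> / \<delta>"
      using eventually_ge_at_top[of m0]
    proof eventually_elim
      case (elim k)
      have "\<delta> * \<bar>\<eta> (Suc (Suc k)) - \<eta> k\<bar> \<le> \<eta> (Suc k) * \<bar>\<eta> (Suc (Suc k)) - \<eta> k\<bar>"
        using \<delta>(2)[of "Suc k"] elim by (intro mult_right_mono) auto
      also have "\<dots> = \<bar>\<eta> (Suc k) * (\<eta> (Suc (Suc k)) - \<eta> k)\<bar>" using nonneg[of "Suc k"] by (simp add: abs_mult)
      also have "\<eta> (Suc k) * (\<eta> (Suc (Suc k)) - \<eta> k) = \<eta> (Suc k) * \<eta> (Suc (Suc k)) - \<eta> k * \<eta> (Suc k)"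
        by (simp add: algebra_simps)
      finally show ?case using \<delta>(1) by (simp add: field_simps)
    qed
  qed auto
  have dev0: "(\<lambda>i. lapdev (1 / 2 ^ (2 * i + r))) \<longlonglongrightarrow> 0" if "r \<le> 1" for r
  proof (rule slowly_varying_block_sums_tendsto_0)
    have "(\<lambda>k. (\<eta> (Suc (Suc k)) - \<eta> k) - (\<rho> (Suc (Suc k)) - \<rho> k)) \<longlonglongrightarrow> 0 - (1 - 1)"
      by (intro tendsto_diff slow rho LIMSEQ_Suc)
    hence "(\<lambda>k. lapdev (1 / 2 ^ Suc (Suc k)) - lapdev (1 / 2 ^ k)) \<longlonglongrightarrow> 0"
      by (simp add: eta)
    moreover have "filterlim (\<lambda>i. 2 * i + r) at_top sequentially"
      by (rule filterlim_at_top_mono[OF filterlim_ident]) auto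
    ultimately have "(\<lambda>i. lapdev (1 / 2 ^ Suc (Suc (2 * i + r))) - lapdev (1 / 2 ^ (2 * i + r))) \<longlonglongrightarrow> 0"
      by (rule filterlim_compose)
    thus "(\<lambda>i. lapdev (1 / 2 ^ (2 * Suc i + r)) - lapdev (1 / 2 ^ (2 * i + r))) \<longlonglongrightarrow> 0" by simp
  next
    fix \<epsilon> :: real assume "\<epsilon> > 0"
    have e: "1 / 2 ^ (2 * k + r) = 1 / 2 ^ r / (4::real) ^ k" for k by (simp add: power_add power_mult)
    show "\<exists>K. \<forall>i J. \<bar>\<Sum>k\<in>{i<..i+J}. lapdev (1 / 2 ^ (2 * k + r))\<bar> \<le> \<epsilon> * real J + K"
      unfolding e using \<open>\<epsilon> > 0\<close> by (intro blocks) auto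
  qed
  have eta_lim: "(\<lambda>i. \<eta> (2 * i + r)) \<longlonglongrightarrow> 1" if "r \<le> 1" for r
  proof -
    have "filterlim (\<lambda>i. 2 * i + r) at_top sequentially"
      by (rule filterlim_at_top_mono[OF filterlim_ident]) auto
    hence "(\<lambda>i. \<rho> (2 * i + r)) \<longlonglongrightarrow> 1" by (rule filterlim_compose[OF rho])
    from tendsto_add[OF dev0[OF that] this] show ?thesis unfolding eta by simp
  qed
  have "(\<lambda>i. \<eta> (2 * i + 0) * \<eta> (2 * i + 1)) \<longlonglongrightarrow> 1 * 1"
    by (intro tendsto_mult eta_lim) auto
  moreover have "(\<lambda>i. \<eta> (2 * i) * \<eta> (Suc (2 * i))) \<longlonglongrightarrow> c"
    by (rule filterlim_compose[OF lim]) (rule filterlim_at_top_mono[OF filterlim_ident], auto)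
  ultimately show ?thesis using LIMSEQ_unique by force
qed

subsection \<open>The mean value of the singular series\<close>

text \<open>Regroups a nonnegative double series by the values of \<open>key\<close>, used with dm
  and with p + 2q. The fibres are cut down to the support of w because a full fibre may be infinite,
  such as dm = 0.\<close>

lemma sums_fibers:
  fixes w :: "nat \<times> nat \<Rightarrow> real" and key :: "nat \<times> nat \<Rightarrow> nat"
  assumes nonneg: "\<And>x. w x \<ge> 0" and rows: "\<And>d. (\<lambda>m. w (d, m)) sums r d" and total: "r sums R"
    and fin: "\<And>n. finite {x. key x = n \<and> w x \<noteq> 0}"
  shows "(\<lambda>n. \<Sum>x | key x = n \<and> w x \<noteq> 0. w x) sums R"
proof -
  have r: "((\<lambda>m. w (d, m)) has_sum r d) UNIV" for d
    by (intro sums_nonneg_imp_has_sum rows nonneg)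
  have "r d \<ge> 0" for d using suminf_nonneg[of "\<lambda>m. w (d, m)"] rows[of d] nonneg by (simp add: sums_iff)
  hence R: "(r has_sum R) UNIV" by (intro sums_nonneg_imp_has_sum total)
  have "w summable_on (UNIV \<times> UNIV)"
    by (rule summable_on_SigmaI[OF r]) (use R nonneg in \<open>auto simp: summable_on_def\<close>)
  hence "(w has_sum R) (UNIV \<times> UNIV)" by (intro has_sum_SigmaI[OF r R])
  moreover have "bij_betw snd (SIGMA n:UNIV. {x. key x = n}) (UNIV \<times> UNIV)"
    by (rule bij_betwI[where g = "\<lambda>x. (key x, x)"]) auto
  ultimately have "((\<lambda>y. w (snd y)) has_sum R) (SIGMA n:UNIV. {x. key x = n})"
    using has_sum_reindex_bij_betw by blast
  hence "((\<lambda>n. \<Sum>x | key x = n \<and> w x \<noteq> 0. w x) has_sum R) UNIV"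
    by (rule has_sum_SigmaD) (rule has_sum_finite_neutralI[OF fin], auto)
  thus ?thesis by (rule has_sum_imp_sums)
qed

lemma sums_nat_power: "\<bar>z\<bar> < (1::real) \<Longrightarrow> (\<lambda>n. real n * z ^ n) sums (z / (1 - z) ^ 2)"
proof -
  assume z: "\<bar>z\<bar> < 1"
  have "(\<lambda>n. z * (real (Suc n) * z ^ n)) sums (z * (1 / (1 - z) ^ 2))"
    using z geometric_deriv_sums[of z] by (intro sums_mult) simp
  hence "(\<lambda>n. real (Suc n) * z ^ Suc n) sums (z / (1 - z) ^ 2)" by (simp add: mult_ac)
  thus ?thesis using sums_Suc[of "\<lambda>n. real n * z ^ n"] by simp
qed

text \<open>For y > 0 the sum of m exp(-ym) over odd m: half the difference of the values of z/(1 -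
  z)^2 at z = exp(-y) and z = -exp(-y).\<close>

definition oddlap :: "real \<Rightarrow> real" where
  "oddlap y = (exp (-y) / (1 - exp (-y)) ^ 2 + exp (-y) / (1 + exp (-y)) ^ 2) / 2"

lemma sums_oddlap:
  assumes "y > 0"
  shows "(\<lambda>n. if odd n then real n * exp (-(y * real n)) else 0) sums oddlap y"
proof -
  define q where "q = exp (-y)"
  have q: "0 < q" "q < 1" using assms by (auto simp: q_def)
  have e: "exp (-(y * real n)) = q ^ n" for n by (simp add: q_def mult.commute flip: exp_of_nat_mult)
  have "(\<lambda>n. (real n * q ^ n - real n * (-q) ^ n) / 2) sums ((q / (1 - q) ^ 2 - (-q) / (1 - (-q)) ^ 2) / 2)"
    using q by (intro sums_divide sums_diff sums_nat_power) auto
  moreover have "(real n * q ^ n - real n * (-q) ^ n) / 2 = (if odd n then real n * q ^ n else 0)" for n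
    by (auto simp: power_minus_odd power_minus_even)
  ultimately show ?thesis unfolding e by (simp add: oddlap_def q_def)
qed

lemma oddlap_tendsto: "((\<lambda>y. y ^ 2 * oddlap y) \<longlongrightarrow> 1 / 2) (at_right 0)"
  unfolding oddlap_def by real_asymp

lemma xexp_le: "x * exp (-(x::real) / 2) \<le> 2"
proof -
  have "x / 2 \<le> exp (x / 2)" using exp_ge_add_one_self[of "x / 2"] by linarith
  thus ?thesis by (simp add: exp_minus field_simps)
qed

lemma oddlap_nonneg: "oddlap y \<ge> 0"
  by (simp add: oddlap_def)

text \<open>Supplies the uniform majorant for the limit under the sum in
  \<open>sing_laplace_tendsto\<close>. Half of the exponential absorbs the factor ym, as x exp(-x/2)
  <= 2; the other half sums to at most 2/y.\<close>

lemma oddlap_bounds: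
  assumes "y > 0"
  shows "0 \<le> y ^ 2 * oddlap y" "y ^ 2 * oddlap y \<le> 4"
proof -
  have q: "exp (-y) < 1" using assms by simp
  show "0 \<le> y ^ 2 * oddlap y" by (simp add: oddlap_def)
  have s: "(\<lambda>n. if n = 0 then 0 else exp (-(y / 2)) ^ n) sums (1 / (1 - exp (-(y/2))) - 1)"
    using geometric_sums[of "exp (-(y/2))"] sums_If_finite_set'[of "\<lambda>n. exp (-(y/2)) ^ n" _ "{0}" _ "\<lambda>_. 0"] assms
    by simp
  have e: "exp (-(y/2)) ^ n = exp (-(y / 2 * real n))" for n by (simp add: mult.commute flip: exp_of_nat_mult)
  have "y * oddlap y \<le> 2 * (1 / (1 - exp (-(y/2))) - 1)"
  proof (rule sums_le)
    show "(\<lambda>n. y * (if odd n then real n * exp (-(y * real n)) else 0)) sums (y * oddlap y)"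
      by (intro sums_mult sums_oddlap assms)
    show "(\<lambda>n. 2 * (if n = 0 then 0 else exp (-(y / 2)) ^ n)) sums (2 * (1 / (1 - exp (-(y/2))) - 1))"
      by (intro sums_mult s)
    fix n :: nat
    have "y * (real n * exp (-(y * real n))) = (y * real n * exp (-(y * real n) / 2)) * exp (-(y / 2 * real n))"
      by (simp flip: exp_add)
    also have "\<dots> \<le> 2 * exp (-(y / 2 * real n))" by (intro mult_right_mono xexp_le) auto
    finally show "y * (if odd n then real n * exp (-(y * real n)) else 0) \<le> 2 * (if n = 0 then 0 else exp (-(y / 2)) ^ n)"
      unfolding e by auto
  qed
  also have "1 / (1 - exp (-(y/2))) - 1 = 1 / (exp (y/2) - 1)"
    using assms by (simp add: exp_minus field_simps)
  also have "\<dots> \<le> 1 / (y / 2)"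
  proof (intro divide_left_mono mult_pos_pos)
    show "y / 2 \<le> exp (y / 2) - 1" using exp_ge_add_one_self[of "y / 2"] by linarith
  qed (use assms in auto)
  finally have "y * (y * oddlap y) \<le> y * (4 / y)" using assms by (intro mult_left_mono) auto
  thus "y ^ 2 * oddlap y \<le> 4" using assms by (simp add: power2_eq_square mult.assoc)
qed

section \<open>The singular series and its divisor expansion\<close>

definition sfac :: "nat \<Rightarrow> real" where "sfac p = (if odd p then 1 / (real p - 2) else 0)"
text \<open>For odd p the factor is (p - 1)/(p - 2), and for p = 2 it is 1. Hence for odd n this is
  the reciprocal of the product occurring in \<open>F\<close>, and \<open>gsing\<close> is its
  Moebius transform.\<close>

definition sing :: "nat \<Rightarrow> real" where "sing n = (\<Prod>p\<in>prime_factors n. 1 + sfac p)"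
definition gsing :: "nat \<Rightarrow> real" where "gsing = sqf_mult sfac"

lemma odd_prime_ge_3: "prime (p::nat) \<Longrightarrow> odd p \<Longrightarrow> real p \<ge> 3"
  using prime_ge_2_nat[of p] by (cases "p = 2") auto

lemma sfac_nonneg: "prime p \<Longrightarrow> sfac p \<ge> 0"
  using odd_prime_ge_3[of p] by (auto simp: sfac_def)

lemma gsing_nonneg: "gsing n \<ge> 0"
  unfolding gsing_def sqf_mult_def by (auto intro!: prod_nonneg sfac_nonneg)

lemma gsing_0 [simp]: "gsing 0 = 0"
  by (simp add: gsing_def sqf_mult_def)

lemma gsing_even: "even n \<Longrightarrow> gsing n = 0"
proof (cases "n = 0")
  case False
  assume "even n"
  hence "2 \<in> prime_factors n" using False by (auto simp: prime_factors_dvd)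
  moreover have "sfac 2 = 0" by (simp add: sfac_def)
  ultimately have "(\<Prod>p\<in>prime_factors n. sfac p) = 0" by (intro prod_zero) auto
  thus ?thesis by (simp add: gsing_def sqf_mult_def)
qed auto

lemma sum_gsing: "n > 0 \<Longrightarrow> (\<Sum>d | d dvd n. gsing d) = sing n"
  unfolding gsing_def sing_def by (rule sum_sqf_mult)

lemma sing_pos: "sing n > 0"
  unfolding sing_def by (intro prod_pos) (auto intro!: add_pos_nonneg sfac_nonneg)

lemma sing_odd:
  assumes "odd n"
  shows "(\<Prod>p\<in>{p. prime p \<and> p dvd n \<and> odd p}. (real p - 2) / (real p - 1)) = 1 / sing n"
proof -
  have n: "n > 0" using assms by (cases n) auto
  have "{p. prime p \<and> p dvd n \<and> odd p} = prime_factors n"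
    using assms n by (auto simp: prime_factors_dvd)
  moreover have "(\<Prod>p\<in>prime_factors n. (real p - 2) / (real p - 1)) = (\<Prod>p\<in>prime_factors n. 1 / (1 + sfac p))"
  proof (intro prod.cong refl)
    fix p assume "p \<in> prime_factors n"
    hence p: "prime p" "p dvd n" by (auto simp: prime_factors_dvd)
    hence "odd p" using assms by auto
    thus "(real p - 2) / (real p - 1) = 1 / (1 + sfac p)"
      using odd_prime_ge_3[OF p(1)] by (simp add: sfac_def field_simps)
  qed
  ultimately show ?thesis by (simp add: sing_def prod_dividef)
qed

definition twfac :: "nat \<Rightarrow> real" where
  "twfac p = (if prime p \<and> odd p then real p * (real p - 2) / (real p - 1)^2 else 1)"

lemma C_tw_eq: "C_tw = prodinf twfac"
  unfolding C_tw_def twfac_def[abs_def] ..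

lemma twfac_pos: "twfac p > 0"
  using odd_prime_ge_3[of p] by (auto simp: twfac_def)

lemma convergent_prod_twfac: "convergent_prod twfac"
proof -
  have "summable (\<lambda>p. norm (twfac p - 1))"
  proof (rule summable_comparison_test[OF exI, of 2])
    show "summable (\<lambda>p. 4 * (1 / real p ^ 2))"
      using inverse_power_summable[of 2] by (intro summable_mult) (simp add: inverse_eq_divide)
    show "\<forall>p\<ge>2. norm (norm (twfac p - 1)) \<le> 4 * (1 / real p ^ 2)"
    proof (intro allI impI)
      fix p :: nat assume p: "p \<ge> 2"
      show "norm (norm (twfac p - 1)) \<le> 4 * (1 / real p ^ 2)"
      proof (cases "prime p \<and> odd p")
        case True
        have "real p * (real p - 2) = (real p - 1) ^ 2 - 1" by (simp add: power2_eq_square algebra_simps)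
        hence "twfac p - 1 = - (1 / (real p - 1) ^ 2)"
          using True p by (simp add: twfac_def diff_divide_distrib)
        hence "norm (norm (twfac p - 1)) = 1 / (real p - 1) ^ 2" by simp
        also have "\<dots> \<le> 1 / (real p / 2) ^ 2"
          using p by (intro divide_left_mono power_mono mult_pos_pos zero_less_power) auto
        also have "\<dots> = 4 * (1 / real p ^ 2)" by (simp add: power_divide)
        finally show ?thesis .
      qed (auto simp: twfac_def)
    qed
  qed
  thus ?thesis by (intro abs_convergent_prod_imp_convergent_prod summable_imp_abs_convergent_prod)
qed

lemma C_tw_nonzero: "C_tw \<noteq> 0"
  unfolding C_tw_eq by (rule prodinf_nonzero[OF convergent_prod_twfac]) (metis twfac_pos less_irrefl)

text \<open>The Euler factor 1 + 1/(p(p - 2)) is the reciprocal of the twin prime factor. Absolute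
  convergence and the value come together: finite Euler products are sums over divisors of
  primorials, so partial sums and products bound each other.\<close>

lemma gsing_sums: "(\<lambda>d. gsing d / real d) sums (1 / C_tw)"
proof -
  define P where "P N = {p. prime p \<and> p \<le> (N::nat)}" for N
  have finP: "finite (P N)" for N by (simp add: P_def)
  define Q where "Q N = (\<Prod>p\<in>P N. 1 + sfac p / real p)" for N
  have Qeq: "Q N = 1 / (\<Prod>p\<le>N. twfac p)" for N
  proof -
    have "(\<Prod>p\<le>N. twfac p) = (\<Prod>p\<in>P N. twfac p)"
      by (intro prod.mono_neutral_right) (auto simp: P_def twfac_def)
    moreover have "Q N = (\<Prod>p\<in>P N. 1 / twfac p)"
      unfolding Q_def
    proof (intro prod.cong refl)
      fix p assume "p \<in> P N"
      hence p: "prime p" by (simp add: P_def)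
      show "1 + sfac p / real p = 1 / twfac p"
      proof (cases "odd p")
        case True
        have "real p \<ge> 3" using p True by (rule odd_prime_ge_3)
        thus ?thesis using p True by (simp add: sfac_def twfac_def divide_simps) (simp add: algebra_simps power2_eq_square)
      qed (auto simp: sfac_def twfac_def)
    qed
    ultimately show ?thesis by (simp add: prod_dividef)
  qed
  have "(\<lambda>N. 1 / (\<Prod>p\<le>N. twfac p)) \<longlonglongrightarrow> 1 / C_tw"
    using convergent_prod_LIMSEQ[OF convergent_prod_twfac] C_tw_nonzero
    by (intro tendsto_intros) (auto simp: C_tw_eq)
  hence Qlim: "Q \<longlonglongrightarrow> 1 / C_tw" unfolding Qeq[abs_def, symmetric] .
  have nonneg: "gsing d / real d \<ge> 0" for d by (simp add: gsing_nonneg)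
  have Qsum: "Q N = (\<Sum>d | d dvd \<Prod>(P N). gsing d / real d)" for N
  proof -
    have pf: "prime_factors (\<Prod>(P N)) = P N"
      by (intro prime_factors_prod_primes finP) (simp add: P_def)
    have "\<Prod>(P N) > 0" by (intro prod_pos) (auto simp: P_def prime_gt_0_nat)
    from sum_sqf_mult[OF this, of "\<lambda>p. sfac p / real p"]
    have "(\<Sum>d | d dvd \<Prod>(P N). sqf_mult (\<lambda>p. sfac p / real p) d) = Q N" by (simp add: pf Q_def)
    moreover have "sqf_mult (\<lambda>p. sfac p / real p) d = gsing d / real d" for d
      unfolding gsing_def sqf_mult_def by (auto simp: prod_dividef simp flip: of_nat_prod)
    ultimately show ?thesis by simp
  qed
  have le_Q: "(\<Sum>d<N. gsing d / real d) \<le> Q N" for N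
    unfolding Qsum
  proof (rule order_trans[OF _ sum_mono2])
    have "(\<Sum>d<N. gsing d / real d) = (\<Sum>d\<in>{d\<in>{..<N}. gsing d \<noteq> 0}. gsing d / real d)"
      by (rule sum.mono_neutral_right) auto
    thus "(\<Sum>d<N. gsing d / real d) \<le> (\<Sum>d\<in>{d\<in>{..<N}. gsing d \<noteq> 0}. gsing d / real d)" by simp
    show "finite {d. d dvd \<Prod>(P N)}"
      by (intro finite_divisors_nat prod_pos) (auto simp: P_def prime_gt_0_nat)
    show "{d \<in> {..<N}. gsing d \<noteq> 0} \<subseteq> {d. d dvd \<Prod>(P N)}"
    proof safe
      fix d assume d: "d < N" "gsing d \<noteq> 0"
      hence eq: "\<Prod>(prime_factors d) = d" by (auto simp: gsing_def sqf_mult_def split: if_splits)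
      have "d > 0" using d by (cases d) auto
      hence "prime_factors d \<subseteq> P N"
        using d by (auto simp: P_def prime_factors_dvd dest: dvd_imp_le)
      hence "\<Prod>(prime_factors d) dvd \<Prod>(P N)" by (intro prod_dvd_prod_subset finP)
      thus "d dvd \<Prod>(P N)" by (simp add: eq)
    qed
  qed (auto simp: gsing_nonneg)
  obtain B where B: "\<And>N. Q N \<le> B"
    using BseqE[OF convergent_imp_Bseq[OF convergentI[OF Qlim]]] by (metis abs_le_D1 real_norm_def)
  have sm: "summable (\<lambda>d. gsing d / real d)"
    by (rule summableI_nonneg_bounded[OF nonneg order_trans[OF le_Q B]])
  have "suminf (\<lambda>d. gsing d / real d) \<le> 1 / C_tw"
    using summable_LIMSEQ[OF sm] Qlim by (rule LIMSEQ_le) (use le_Q in auto)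
  moreover have "Q N \<le> suminf (\<lambda>d. gsing d / real d)" for N
    unfolding Qsum
    by (intro sum_le_suminf sm finite_divisors_nat prod_pos) (auto simp: P_def prime_gt_0_nat gsing_nonneg)
  hence "1 / C_tw \<le> suminf (\<lambda>d. gsing d / real d)"
    by (intro LIMSEQ_le_const2[OF Qlim]) auto
  ultimately show ?thesis using sm by (simp add: sums_iff)
qed

lemma gsing_term_bound:
  assumes "s > 0"
  shows "norm (gsing d / real d * ((s * real d) ^ 2 * oddlap (s * real d))) \<le> 4 * (gsing d / real d)"
proof (cases "d = 0")
  case False
  hence "s * real d > 0" using assms by simp
  note b = oddlap_bounds[OF this]
  have "norm (gsing d / real d * ((s * real d) ^ 2 * oddlap (s * real d)))
      = gsing d / real d * ((s * real d) ^ 2 * oddlap (s * real d))"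
    using oddlap_nonneg gsing_nonneg[of d] by (simp only: real_norm_def) (intro abs_of_nonneg mult_nonneg_nonneg, auto)
  also have "\<dots> \<le> gsing d / real d * 4" using b gsing_nonneg[of d] by (intro mult_left_mono) auto
  finally show ?thesis by (simp add: mult.commute)
qed auto

lemma summable_gsing_oddlap:
  assumes "s > 0"
  shows "summable (\<lambda>d. gsing d * real d * oddlap (s * real d))"
proof -
  have "summable (\<lambda>d. gsing d / real d * ((s * real d) ^ 2 * oddlap (s * real d)))"
  proof (rule summable_comparison_test[OF exI, of 0], intro allI impI)
    show "summable (\<lambda>d. 4 * (gsing d / real d))"
      using gsing_sums by (intro summable_mult) (simp add: sums_iff)
  qed (rule gsing_term_bound[OF assms])
  moreover have "gsing d / real d * ((s * real d) ^ 2 * oddlap (s * real d))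
      = s ^ 2 * (gsing d * real d * oddlap (s * real d))" for d
    by (cases "d = 0") (auto simp: power2_eq_square)
  ultimately show ?thesis using assms by (simp add: summable_cmult_iff)
qed

text \<open>Insert the divisor expansion of \<open>sing\<close> and write n = dm. The restriction to
  odd n becomes one to odd m alone, since \<open>gsing\<close> already vanishes at even d.\<close>

lemma sing_laplace_sums:
  assumes s: "s > 0"
  shows "(\<lambda>n. if odd n then real n * sing n * exp (-(s * real n)) else 0) sums
           (\<Sum>d. gsing d * real d * oddlap (s * real d))"
proof -
  define w where "w = (\<lambda>(d::nat, m::nat). gsing d * real d * (if odd m then real m * exp (-(s * real d * real m)) else 0))"
  define key :: "nat \<times> nat \<Rightarrow> nat" where "key = (\<lambda>(d, m). d * m)"
  have w_nonneg: "w x \<ge> 0" for x by (cases x) (auto simp: w_def gsing_nonneg)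
  have rows: "(\<lambda>m. w (d, m)) sums (gsing d * real d * oddlap (s * real d))" for d
  proof (cases "d = 0")
    case False
    thus ?thesis unfolding w_def prod.case using s by (intro sums_mult sums_oddlap) auto
  qed (auto simp: w_def)
  have tot: "summable (\<lambda>d. gsing d * real d * oddlap (s * real d))"
    by (rule summable_gsing_oddlap[OF s])
  have supp: "{x. key x = n \<and> w x \<noteq> 0} \<subseteq> {..n} \<times> {..n}" for n
  proof
    fix x assume x: "x \<in> {x. key x = n \<and> w x \<noteq> 0}"
    obtain d m where dm: "x = (d, m)" by (cases x)
    hence "d > 0" "m > 0" using x by (auto simp: w_def intro!: Nat.gr0I split: if_splits)
    thus "x \<in> {..n} \<times> {..n}" using x dm by (auto simp: key_def)
  qed
  have "(\<lambda>n. \<Sum>x | key x = n \<and> w x \<noteq> 0. w x) sums (\<Sum>d. gsing d * real d * oddlap (s * real d))"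
    by (rule sums_fibers[OF w_nonneg rows summable_sums[OF tot]]) (rule finite_subset[OF supp], simp)
  moreover have "(\<Sum>x | key x = n \<and> w x \<noteq> 0. w x) = (if odd n then real n * sing n * exp (-(s * real n)) else 0)" for n
  proof (cases "odd n")
    case True
    hence n: "n > 0" by (cases n) auto
    have "(\<Sum>x | key x = n \<and> w x \<noteq> 0. w x) = (\<Sum>x\<in>(\<lambda>d. (d, n div d)) ` {d. d dvd n}. w x)"
    proof (intro sum.mono_neutral_left ballI)
      show "finite ((\<lambda>d. (d, n div d)) ` {d. d dvd n})" using n by simp
      show "{x. key x = n \<and> w x \<noteq> 0} \<subseteq> (\<lambda>d. (d, n div d)) ` {d. d dvd n}"
      proof safe
        fix d m assume x: "n = key (d, m)" "w (d, m) \<noteq> 0"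
        hence "n = d * m" "d > 0" using n by (auto simp: key_def intro: Nat.gr0I)
        thus "(d, m) \<in> (\<lambda>da. (da, key (d, m) div da)) ` {da. da dvd key (d, m)}" by (auto simp: key_def)
      qed
    qed (auto simp: key_def)
    also have "\<dots> = (\<Sum>d | d dvd n. w (d, n div d))" by (subst sum.reindex) (auto simp: inj_on_def)
    also have "\<dots> = (\<Sum>d | d dvd n. gsing d * (real n * exp (-(s * real n))))"
    proof (intro sum.cong refl)
      fix d assume "d \<in> {d. d dvd n}"
      then obtain m where m: "n = d * m" by auto
      thus "w (d, n div d) = gsing d * (real n * exp (-(s * real n)))"
        using True n by (auto simp: w_def mult_ac)
    qed
    also have "\<dots> = sing n * (real n * exp (-(s * real n)))"
      using n by (simp add: sum_gsing flip: sum_distrib_right)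
    finally show ?thesis using True by (simp add: mult_ac)
  next
    case False
    have empty: "{x. key x = n \<and> w x \<noteq> 0} = {}"
      using False gsing_even by (auto simp: key_def w_def split: if_splits)
    show ?thesis unfolding empty using False by simp
  qed
  ultimately show ?thesis by simp
qed

text \<open>Termwise limit by Tannery's theorem. The factor 1/2 is the density of the odd numbers,
  and the sum of \<open>gsing d\<close>/d is the mean of the singular series over them.\<close>

theorem sing_laplace_tendsto:
  "((\<lambda>s. s ^ 2 * (\<Sum>n. if odd n then real n * sing n * exp (-(s * real n)) else 0)) \<longlongrightarrow> 1 / (2 * C_tw)) (at_right 0)"
proof -
  define a where "a d s = gsing d / real d * ((s * real d) ^ 2 * oddlap (s * real d))" for d :: nat and s :: real
  have lim: "((\<lambda>s. a d s) \<longlongrightarrow> gsing d / real d * (1 / 2)) (at_right 0)" for d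
  proof (cases "d = 0")
    case False
    hence "filterlim (\<lambda>s. s * real d) (at_right 0) (at_right 0)" by real_asymp
    from filterlim_compose[OF oddlap_tendsto this] show ?thesis
      unfolding a_def by (intro tendsto_intros)
  qed (auto simp: a_def)
  have sm: "summable (\<lambda>d. 4 * (gsing d / real d))" using gsing_sums by (intro summable_mult) (simp add: sums_iff)
  have "\<forall>\<^sub>F s::real in at_right 0. s > 0" by (simp add: eventually_at_right_less)
  hence "\<forall>\<^sub>F x in at_top \<times>\<^sub>F at_right 0. True \<and> snd x > (0::real)"
    by (intro eventually_prodI) auto
  hence bound: "\<forall>\<^sub>F (d, s) in at_top \<times>\<^sub>F at_right 0. norm (a d s) \<le> 4 * (gsing d / real d)"
  proof eventually_elim
    case (elim x)
    obtain d s where x: "x = (d, s)" by (cases x)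
    have "norm (a d s) \<le> 4 * (gsing d / real d)"
      unfolding a_def using elim x by (intro gsing_term_bound) auto
    thus ?case by (simp add: x)
  qed
  have "((\<lambda>s. \<Sum>d. a d s) \<longlongrightarrow> (\<Sum>d. gsing d / real d * (1 / 2))) (at_right 0)"
    using tannerys_theorem[OF lim bound sm] by simp
  also have "(\<Sum>d. gsing d / real d * (1 / 2)) = 1 / (2 * C_tw)"
    using sums_mult2[OF gsing_sums, of "1/2"] by (simp add: sums_iff)
  finally show ?thesis
  proof (rule Lim_transform_eventually)
    show "\<forall>\<^sub>F s in at_right 0. (\<Sum>d. a d s) = s ^ 2 * (\<Sum>n. if odd n then real n * sing n * exp (-(s * real n)) else 0)"
      using eventually_at_right_less[of "0::real"]
    proof eventually_elim
      case (elim s)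
      have "a d s = s ^ 2 * (gsing d * real d * oddlap (s * real d))" for d
        by (cases "d = 0") (auto simp: a_def power2_eq_square)
      hence "(\<Sum>d. a d s) = s ^ 2 * (\<Sum>d. gsing d * real d * oddlap (s * real d))"
        using summable_gsing_oddlap[OF elim] by (simp add: suminf_mult)
      thus ?case using sing_laplace_sums[OF elim] by (simp add: sums_iff)
    qed
  qed
qed

subsection \<open>Weighted representation counts\<close>

text \<open>Multiplying the coefficients by a convergent sequence multiplies the limit: any fixed
  initial segment contributes O(s^2), and beyond it r is uniformly close to L.\<close>

lemma laplace_abelian:
  fixes v r :: "nat \<Rightarrow> real"
  assumes v: "\<And>n. v n \<ge> 0" and sm: "\<forall>s>0. summable (\<lambda>n. v n * exp (-(s * real n)))"
    and lim: "((\<lambda>s. s ^ 2 * (\<Sum>n. v n * exp (-(s * real n)))) \<longlongrightarrow> V) (at_right 0)"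
    and r: "r \<longlonglongrightarrow> L"
  shows "\<And>s. s > 0 \<Longrightarrow> summable (\<lambda>n. r n * v n * exp (-(s * real n)))"
    and "((\<lambda>s. s ^ 2 * (\<Sum>n. r n * v n * exp (-(s * real n)))) \<longlongrightarrow> L * V) (at_right 0)"
proof -
  define e where "e s n = v n * exp (-(s * real n))" for s n
  have e: "e s n \<ge> 0" for s n using v by (simp add: e_def)
  have sme: "summable (e s)" if "s > 0" for s using sm that by (simp add: e_def[abs_def])
  have "Bseq r" using r by (intro convergent_imp_Bseq convergentI)
  then obtain B where B: "B > 0" "\<And>n. \<bar>r n\<bar> \<le> B" unfolding Bseq_def by auto
  have smr: "summable (\<lambda>n. r n * e s n)" if "s > 0" for s
  proof (rule summable_comparison_test[OF exI, of 0], intro allI impI)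
    show "norm (r n * e s n) \<le> B * e s n" for n
      using B(2)[of n] e[of s n] by (simp add: abs_mult mult_right_mono)
  qed (intro summable_mult sme that)
  show "summable (\<lambda>n. r n * v n * exp (-(s * real n)))" if "s > 0" for s
    using smr[OF that] by (simp add: e_def mult.assoc)
  define V' where "V' = \<bar>V\<bar> + 1"
  have V': "V' > 0" by (simp add: V'_def)
  have lime: "((\<lambda>s. s ^ 2 * suminf (e s)) \<longlongrightarrow> V) (at_right 0)" using lim by (simp add: e_def[abs_def])
  have "((\<lambda>s. s ^ 2 * (\<Sum>n. (r n - L) * e s n)) \<longlongrightarrow> 0) (at_right 0)"
  proof (rule tendstoI)
    fix \<epsilon> :: real assume \<epsilon>: "\<epsilon> > 0"
    define \<epsilon>' where "\<epsilon>' = \<epsilon> / (2 * V')"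
    have \<epsilon>': "\<epsilon>' > 0" using \<epsilon> V' by (simp add: \<epsilon>'_def)
    obtain N where N: "\<And>n. n \<ge> N \<Longrightarrow> \<bar>r n - L\<bar> \<le> \<epsilon>'"
      using LIMSEQ_D[OF r \<epsilon>'] by (auto intro: less_imp_le)
    define C where "C = (\<Sum>n<N. \<bar>r n - L\<bar> * v n)"
    have "((\<lambda>s. s ^ 2 * C) \<longlongrightarrow> 0 ^ 2 * C) (at_right 0)" by (intro tendsto_intros)
    hence ev1: "\<forall>\<^sub>F s in at_right 0. s ^ 2 * C < \<epsilon> / 2" using \<epsilon> by (intro order_tendstoD(2)) auto
    have ev2: "\<forall>\<^sub>F s in at_right 0. s ^ 2 * suminf (e s) < V'"
      using lime by (rule order_tendstoD(2)) (simp add: V'_def abs_if)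
    have ev3: "\<forall>\<^sub>F s::real in at_right 0. s > 0" by (rule eventually_at_right_less)
    show "\<forall>\<^sub>F s in at_right 0. dist (s ^ 2 * (\<Sum>n. (r n - L) * e s n)) 0 < \<epsilon>"
      using ev1 ev2 ev3
    proof eventually_elim
      case (elim s)
      define g where "g n = \<epsilon>' * e s n + (if n \<in> {..<N} then \<bar>r n - L\<bar> * v n else 0)" for n
      have g: "g sums (\<epsilon>' * suminf (e s) + C)"
        unfolding g_def C_def
        by (intro sums_add sums_mult summable_sums sme elim sums_If_finite_set) auto
      have "norm ((r n - L) * e s n) \<le> g n" for n
      proof (cases "n < N")
        case True
        have "e s n \<le> v n" using v[of n] elim by (simp add: e_def mult_left_le)
        hence "\<bar>r n - L\<bar> * e s n \<le> \<bar>r n - L\<bar> * v n" by (intro mult_left_mono) auto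
        moreover have "\<epsilon>' * e s n \<ge> 0" using \<epsilon>' e[of s n] by simp
        ultimately show ?thesis using True e[of s n] by (simp add: g_def abs_mult)
      next
        case False
        hence "\<bar>r n - L\<bar> * e s n \<le> \<epsilon>' * e s n" by (intro mult_right_mono N e) auto
        thus ?thesis using False e[of s n] by (simp add: g_def abs_mult)
      qed
      hence "norm (\<Sum>n. (r n - L) * e s n) \<le> suminf g"
        using g by (intro norm_suminf_le) (auto simp: sums_iff)
      hence "s ^ 2 * \<bar>\<Sum>n. (r n - L) * e s n\<bar> \<le> s ^ 2 * (\<epsilon>' * suminf (e s) + C)"
        using g by (intro mult_left_mono) (auto simp: sums_iff)
      also have "\<dots> = \<epsilon>' * (s ^ 2 * suminf (e s)) + s ^ 2 * C" by (simp add: algebra_simps)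
      also have "\<dots> < \<epsilon>' * V' + \<epsilon> / 2" using elim \<epsilon>' by (intro add_strict_mono mult_strict_left_mono) auto
      also have "\<dots> = \<epsilon>" using V' by (simp add: \<epsilon>'_def)
      finally show ?case by (simp add: dist_real_def abs_mult)
    qed
  qed
  hence "((\<lambda>s. s ^ 2 * (\<Sum>n. (r n - L) * e s n) + L * (s ^ 2 * suminf (e s))) \<longlongrightarrow> 0 + L * V) (at_right 0)"
    by (intro tendsto_add tendsto_mult tendsto_const lime)
  hence "((\<lambda>s. s ^ 2 * (\<Sum>n. (r n - L) * e s n) + L * (s ^ 2 * suminf (e s))) \<longlongrightarrow> L * V) (at_right 0)" by simp
  thus "((\<lambda>s. s ^ 2 * (\<Sum>n. r n * v n * exp (-(s * real n)))) \<longlongrightarrow> L * V) (at_right 0)"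
  proof (rule Lim_transform_eventually)
    show "\<forall>\<^sub>F s in at_right 0. s ^ 2 * (\<Sum>n. (r n - L) * e s n) + L * (s ^ 2 * suminf (e s)) =
             s ^ 2 * (\<Sum>n. r n * v n * exp (-(s * real n)))"
      using eventually_at_right_less[of "0::real"]
    proof eventually_elim
      case (elim s)
      have "(\<lambda>n. r n * e s n - L * e s n) sums ((\<Sum>n. r n * e s n) - L * suminf (e s))"
        by (intro sums_diff sums_mult summable_sums smr sme elim)
      hence "(\<Sum>n. (r n - L) * e s n) = (\<Sum>n. r n * e s n) - L * suminf (e s)"
        by (simp add: sums_iff left_diff_distrib)
      thus ?case by (simp add: e_def mult.assoc right_diff_distrib mult.left_commute)
    qed
  qed
qed

definition ppairs :: "nat \<Rightarrow> (nat \<times> nat) set" where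
  "ppairs n = {(p, q). prime p \<and> prime q \<and> n = p + 2 * q}"

definition wpairs :: "nat \<Rightarrow> real" where
  "wpairs n = (\<Sum>(p, q)\<in>ppairs n. ln (real p) * ln (real q))"

lemma l_conv_card: "l n = card (ppairs n)"
  by (simp add: l_def ppairs_def)

lemma ppairs_subset: "ppairs n \<subseteq> {1..n} \<times> {1..n}"
  by (auto simp: ppairs_def dest: prime_ge_1_nat)

lemma finite_ppairs: "finite (ppairs n)"
  by (rule finite_subset[OF ppairs_subset]) auto

lemma wpairs_le: "wpairs n \<le> real (l n) * ln (real n) ^ 2"
proof -
  have "wpairs n \<le> (\<Sum>x\<in>ppairs n. ln (real n) * ln (real n))"
    unfolding wpairs_def
  proof (intro sum_mono)
    fix x assume "x \<in> ppairs n"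
    then obtain p q where x: "x = (p, q)" "p \<in> {1..n}" "q \<in> {1..n}" using ppairs_subset[of n] by (cases x) auto
    have "ln (real p) * ln (real q) \<le> ln (real n) * ln (real n)" using x by (intro mult_mono) auto
    thus "(case x of (p, q) \<Rightarrow> ln (real p) * ln (real q)) \<le> ln (real n) * ln (real n)" by (simp add: x)
  qed
  thus ?thesis by (simp add: l_conv_card power2_eq_square)
qed

lemma card_nat_less_le: "X \<ge> 0 \<Longrightarrow> real (card {p::nat. 1 \<le> p \<and> real p < X}) \<le> X"
proof -
  assume X: "X \<ge> 0"
  have "{p::nat. 1 \<le> p \<and> real p < X} \<subseteq> {1..nat \<lfloor>X\<rfloor>}" using X by (auto simp: le_nat_floor)
  hence "card {p::nat. 1 \<le> p \<and> real p < X} \<le> card {1..nat \<lfloor>X\<rfloor>}" by (intro card_mono) auto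
  thus ?thesis using X by simp linarith
qed

text \<open>A pair is determined by either entry, so at most 2 n^(1-\<epsilon>) pairs have an entry
  below n^(1-\<epsilon>). For all others both logarithms are at least (1 - \<epsilon>) ln n.\<close>

lemma wpairs_ge:
  assumes n: "n \<ge> 1" and \<epsilon>: "0 < \<epsilon>" "\<epsilon> < 1"
  shows "(1 - \<epsilon>) ^ 2 * (real (l n) * ln (real n) ^ 2) \<le> wpairs n + 2 * real n powr (1 - \<epsilon>) * ln (real n) ^ 2"
proof -
  define X where "X = real n powr (1 - \<epsilon>)"
  have X: "X > 0" using n by (simp add: X_def)
  have lnX: "ln X = (1 - \<epsilon>) * ln (real n)" using n by (simp add: X_def ln_powr)
  have ln0: "ln (real n) \<ge> 0" using n by simp
  define G where "G = {x \<in> ppairs n. X \<le> real (fst x) \<and> X \<le> real (snd x)}"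
  define S where "S = {p::nat. 1 \<le> p \<and> real p < X}"
  have finS: "finite S"
  proof (rule finite_subset)
    show "S \<subseteq> {..nat \<lceil>X\<rceil>}" unfolding S_def by (auto simp: less_imp_le) linarith
  qed auto
  define A B where "A = {x \<in> ppairs n. real (fst x) < X}" and "B = {x \<in> ppairs n. real (snd x) < X}"
  have "card A \<le> card S"
  proof (rule card_inj_on_le[where f = fst])
    show "inj_on fst A" by (auto simp: inj_on_def A_def ppairs_def)
    show "fst ` A \<subseteq> S" using ppairs_subset[of n] by (auto simp: A_def S_def)
  qed (rule finS)
  moreover have "card B \<le> card S"
  proof (rule card_inj_on_le[where f = snd])
    show "inj_on snd B" by (auto simp: inj_on_def B_def ppairs_def)
    show "snd ` B \<subseteq> S" using ppairs_subset[of n] by (auto simp: B_def S_def)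
  qed (rule finS)
  moreover have "real (card S) \<le> X" unfolding S_def using X by (intro card_nat_less_le) auto
  moreover have "card (ppairs n) \<le> card G + (card A + card B)"
  proof -
    have "ppairs n \<subseteq> G \<union> (A \<union> B)" by (auto simp: G_def A_def B_def)
    hence "card (ppairs n) \<le> card (G \<union> (A \<union> B))"
      using finite_ppairs[of n] by (intro card_mono) (auto simp: G_def A_def B_def)
    also have "\<dots> \<le> card G + (card A + card B)"
      using card_Un_le[of G "A \<union> B"] card_Un_le[of A B] by linarith
    finally show ?thesis .
  qed
  ultimately have l: "real (l n) \<le> real (card G) + 2 * X" unfolding l_conv_card by linarith
  have "real (card G) * ((1 - \<epsilon>) * ln (real n)) ^ 2 = (\<Sum>x\<in>G. ((1 - \<epsilon>) * ln (real n)) * ((1 - \<epsilon>) * ln (real n)))"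
    by (simp add: power2_eq_square)
  also have "\<dots> \<le> (\<Sum>(p, q)\<in>G. ln (real p) * ln (real q))"
  proof (intro sum_mono)
    fix x assume "x \<in> G"
    then obtain p q where x: "x = (p, q)" "X \<le> real p" "X \<le> real q" by (cases x) (auto simp: G_def)
    have "ln X \<le> ln (real p)" "ln X \<le> ln (real q)" using x X by auto
    moreover have "0 \<le> (1 - \<epsilon>) * ln (real n)" using \<epsilon> ln0 by simp
    ultimately have "((1 - \<epsilon>) * ln (real n)) * ((1 - \<epsilon>) * ln (real n)) \<le> ln (real p) * ln (real q)"
      unfolding lnX by (intro mult_mono) linarith+
    thus "((1 - \<epsilon>) * ln (real n)) * ((1 - \<epsilon>) * ln (real n)) \<le> (case x of (p, q) \<Rightarrow> ln (real p) * ln (real q))"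
      by (simp add: x)
  qed
  also have "\<dots> \<le> wpairs n"
    unfolding wpairs_def
  proof (intro sum_mono2)
    show "finite (ppairs n)" by (rule finite_ppairs)
    fix x assume "x \<in> ppairs n - G"
    thus "0 \<le> (case x of (p, q) \<Rightarrow> ln (real p) * ln (real q))"
      using ppairs_subset[of n] by (cases x) auto
  qed (auto simp: G_def)
  finally have G: "real (card G) * ((1 - \<epsilon>) * ln (real n)) ^ 2 \<le> wpairs n" .
  have "(1 - \<epsilon>) ^ 2 * (real (l n) * ln (real n) ^ 2) = real (l n) * ((1 - \<epsilon>) * ln (real n)) ^ 2"
    by (simp add: power_mult_distrib)
  also have "\<dots> \<le> (real (card G) + 2 * X) * ((1 - \<epsilon>) * ln (real n)) ^ 2"
    by (intro mult_right_mono l) auto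
  also have "\<dots> \<le> wpairs n + 2 * X * ((1 - \<epsilon>) * ln (real n)) ^ 2" using G by (simp add: algebra_simps)
  also have "((1 - \<epsilon>) * ln (real n)) ^ 2 \<le> ln (real n) ^ 2"
  proof (intro power_mono)
    show "(1 - \<epsilon>) * ln (real n) \<le> ln (real n)" using \<epsilon> ln0 by (intro mult_left_le_one_le) auto
  qed (use \<epsilon> ln0 in auto)
  finally show ?thesis using X by (simp add: X_def)
qed

lemma wpairs_laplace_sums:
  assumes s: "s > 0"
  shows "(\<lambda>n. if odd n then wpairs n * exp (-(s * real n)) else 0) sums
           ((primelap s - ln 2 * exp (-(2 * s))) * primelap (2 * s))"
proof -
  \<comment> \<open>p + 2q is odd exactly when p is, so keeping the odd n removes the prime 2 from
    the first factor only.\<close>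
  define po where "po p = (if odd p then plog p else 0)" for p :: nat
  define w where "w = (\<lambda>(p::nat, q::nat). po p * exp (-(s * real p)) * (plog q * exp (-(2 * s * real q))))"
  define key :: "nat \<times> nat \<Rightarrow> nat" where "key = (\<lambda>(p, q). p + 2 * q)"
  have w_nonneg: "w x \<ge> 0" for x by (cases x) (auto simp: w_def po_def plog_nonneg)
  have rows: "(\<lambda>q. w (p, q)) sums (po p * exp (-(s * real p)) * primelap (2 * s))" for p
    unfolding w_def prod.case primelap_def using s by (intro sums_mult summable_sums summable_primelap) auto
  have "(\<lambda>p. po p * exp (-(s * real p))) sums (primelap s - ln 2 * exp (-(2 * s)))"
  proof -
    have "(\<lambda>p. plog p * exp (-(s * real p)) - (if p \<in> {2} then plog p * exp (-(s * real p)) else 0)) sums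
        (primelap s - (\<Sum>p\<in>{2}. plog p * exp (-(s * real p))))"
      unfolding primelap_def
      by (intro sums_diff summable_sums summable_primelap s sums_If_finite_set) auto
    moreover have "plog p * exp (-(s * real p)) - (if p \<in> {2} then plog p * exp (-(s * real p)) else 0)
        = po p * exp (-(s * real p))" for p
      using prime_odd_nat[of p] prime_ge_2_nat[of p] by (cases "p = 2") (auto simp: po_def plog_def)
    ultimately show ?thesis by (simp add: plog_def mult.commute)
  qed
  hence tot: "(\<lambda>p. po p * exp (-(s * real p)) * primelap (2 * s)) sums
      ((primelap s - ln 2 * exp (-(2 * s))) * primelap (2 * s))" by (rule sums_mult2)
  have fin: "finite {x. key x = n \<and> w x \<noteq> 0}" for n
  proof (rule finite_subset)
    show "{x. key x = n \<and> w x \<noteq> 0} \<subseteq> {..n} \<times> {..n}" by (auto simp: key_def)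
  qed auto
  have "(\<lambda>n. \<Sum>x | key x = n \<and> w x \<noteq> 0. w x) sums ((primelap s - ln 2 * exp (-(2 * s))) * primelap (2 * s))"
    by (rule sums_fibers[OF w_nonneg rows tot fin])
  moreover have "(\<Sum>x | key x = n \<and> w x \<noteq> 0. w x) = (if odd n then wpairs n * exp (-(s * real n)) else 0)" for n
  proof (cases "odd n")
    case True
    have "(\<Sum>x | key x = n \<and> w x \<noteq> 0. w x) = (\<Sum>x\<in>ppairs n. w x)"
    proof (intro sum.mono_neutral_left ballI finite_ppairs)
      show "{x. key x = n \<and> w x \<noteq> 0} \<subseteq> ppairs n"
        by (auto simp: key_def w_def ppairs_def po_def plog_def split: if_splits)
    qed (auto simp: key_def ppairs_def)
    also have "\<dots> = (\<Sum>(p, q)\<in>ppairs n. ln (real p) * ln (real q) * exp (-(s * real n)))"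
    proof (intro sum.cong refl)
      fix x assume x: "x \<in> ppairs n"
      then obtain p q where pq: "x = (p, q)" "prime p" "prime q" "n = p + 2 * q" by (auto simp: ppairs_def)
      hence "odd p" using True by auto
      have "exp (-(s * real n)) = exp (-(s * real p)) * exp (-(2 * s * real q))"
        by (simp add: pq algebra_simps flip: exp_add)
      thus "w x = (case x of (p, q) \<Rightarrow> ln (real p) * ln (real q) * exp (-(s * real n)))"
        using pq \<open>odd p\<close> by (simp add: w_def po_def plog_def)
    qed
    also have "\<dots> = wpairs n * exp (-(s * real n))"
      by (simp add: wpairs_def sum_distrib_right case_prod_unfold)
    finally show ?thesis using True by simp
  next
    case False
    hence empty: "{x. key x = n \<and> w x \<noteq> 0} = {}" by (auto simp: key_def w_def po_def split: if_splits)
    show ?thesis unfolding empty using False by simp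
  qed
  ultimately show ?thesis by simp
qed

section \<open>Comparison of the two evaluations\<close>

theorem theorem4:
  fixes L :: real
  assumes "(\<lambda>k. F (2 * k + 1)) \<longlonglongrightarrow> L"
  shows "L = C_tw"
proof -
  \<comment> \<open>The hypothesis concerns odd arguments only; the value L at even ones yields a
    full convergent sequence, and the weight \<open>v\<close> vanishes there.\<close>
  define r where "r n = (if odd n then F n else L)" for n
  define v where "v n = (if odd n then real n * sing n else 0)" for n
  define u where "u n = (if odd n then real (l n) * ln (real n) ^ 2 else 0)" for n
  define \<tau> where "\<tau> = L / (2 * C_tw)"
  have r: "r \<longlonglongrightarrow> L"
  proof (rule LIMSEQ_I)
    fix e :: real assume e: "e > 0"
    obtain K where K: "\<And>k. k \<ge> K \<Longrightarrow> norm (F (2 * k + 1) - L) < e" using LIMSEQ_D[OF assms e] by blast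
    have "norm (r n - L) < e" if n: "n \<ge> 2 * K + 1" for n
    proof (cases "odd n")
      case True
      then obtain k where "n = 2 * k + 1" by (auto elim: oddE)
      thus ?thesis using K[of k] n by (simp add: r_def)
    qed (use e in \<open>auto simp: r_def\<close>)
    thus "\<exists>no. \<forall>n\<ge>no. norm (r n - L) < e" by blast
  qed
  have v0: "v n \<ge> 0" for n using sing_pos[of n] by (auto simp: v_def)
  have ve: "v n * exp (-(s * real n)) = (if odd n then real n * sing n * exp (-(s * real n)) else 0)" for n s
    by (simp add: v_def)
  have smv: "\<forall>s>0. summable (\<lambda>n. v n * exp (-(s * real n)))"
    unfolding ve using sing_laplace_sums by (auto simp: sums_iff)
  have vlim: "((\<lambda>s. s ^ 2 * (\<Sum>n. v n * exp (-(s * real n)))) \<longlongrightarrow> 1 / (2 * C_tw)) (at_right 0)"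
    unfolding ve by (rule sing_laplace_tendsto)
  \<comment> \<open>The singular series in the weight cancels the product in \<open>F\<close>,
    leaving l(n) ln^2 n.\<close>
  have rv: "r n * v n = u n" for n
  proof (cases "odd n")
    case True
    hence "n > 0" by (cases n) auto
    thus ?thesis using True sing_pos[of n] by (simp add: r_def v_def u_def F_def sing_odd)
  qed (auto simp: v_def u_def)
  note ab = laplace_abelian[OF v0 smv vlim r, unfolded rv]
  have smu: "summable (\<lambda>n. u n * exp (-(s * real n)))" if "s > 0" for s
    using that by (rule ab(1))
  define T where "T s = s ^ 2 * (\<Sum>n. u n * exp (-(s * real n)))" for s
  have T: "(T \<longlongrightarrow> \<tau>) (at_right 0)"
    using ab(2) by (simp add: T_def[abs_def] \<tau>_def)
  define D where "D s = s ^ 2 * ((primelap s - ln 2 * exp (-(2 * s))) * primelap (2 * s))" for s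
  define a where "a n = (if odd n then wpairs n else 0)" for n
  have a_sums: "(\<lambda>n. a n * exp (-(s * real n))) sums ((primelap s - ln 2 * exp (-(2 * s))) * primelap (2 * s))"
    if "s > 0" for s
  proof -
    have "a n * exp (-(s * real n)) = (if odd n then wpairs n * exp (-(s * real n)) else 0)" for n
      by (simp add: a_def)
    thus ?thesis using wpairs_laplace_sums[OF that] by simp
  qed
  have D_le: "D s \<le> T s" if "s > 0" for s
    unfolding D_def T_def
  proof (intro mult_left_mono sums_le[OF _ a_sums[OF that] summable_sums[OF smu[OF that]]])
    show "a n * exp (-(s * real n)) \<le> u n * exp (-(s * real n))" for n
      using wpairs_le[of n] by (intro mult_right_mono) (auto simp: a_def u_def)
  qed auto
  have \<tau>: "\<tau> \<ge> 0"
  proof (rule tendsto_lowerbound[OF T])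
    show "\<forall>\<^sub>F s in at_right 0. 0 \<le> T s"
      using eventually_at_right_less[of "0::real"]
    proof eventually_elim
      case (elim s)
      show ?case unfolding T_def by (intro mult_nonneg_nonneg suminf_nonneg smu elim) (auto simp: u_def)
    qed
  qed simp
  have D: "(D \<longlongrightarrow> \<tau>) (at_right 0)"
  proof (rule order_tendstoI)
    fix b assume "\<tau> < b"
    from order_tendstoD(2)[OF T this] eventually_at_right_less[of "0::real"]
    show "\<forall>\<^sub>F s in at_right 0. D s < b"
      by eventually_elim (use D_le in \<open>auto intro: le_less_trans\<close>)
  next
    fix b assume b: "b < \<tau>"
    have "((\<lambda>\<epsilon>. (1 - \<epsilon>) ^ 2 * \<tau>) \<longlongrightarrow> (1 - 0) ^ 2 * \<tau>) (at_right 0)" by (intro tendsto_intros)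
    hence "\<forall>\<^sub>F \<epsilon> in at_right 0. b < (1 - \<epsilon>) ^ 2 * \<tau>" using b by (intro order_tendstoD(1)) auto
    moreover have "\<forall>\<^sub>F \<epsilon>::real in at_right 0. \<epsilon> < 1 \<and> 0 < \<epsilon>"
      by (intro eventually_conj eventually_at_right_less order_tendstoD(2)[OF tendsto_ident_at]) auto
    ultimately have "\<exists>\<epsilon>. b < (1 - \<epsilon>) ^ 2 * \<tau> \<and> \<epsilon> < 1 \<and> 0 < \<epsilon>"
      using eventually_happens'[OF trivial_limit_at_right_real] eventually_conj by blast
    then obtain \<epsilon> where \<epsilon>: "b < (1 - \<epsilon>) ^ 2 * \<tau>" "\<epsilon> < 1" "0 < \<epsilon>" by blast
    \<comment> \<open>The error of \<open>wpairs_ge\<close> divided by n. It tends to 0, so the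
      Abelian lemma with weight n makes its contribution vanish for each fixed
      \<open>\<epsilon>\<close>.\<close>
    define z where "z n = 2 * real n powr (-\<epsilon>) * ln (real n) ^ 2" for n
    have z: "z \<longlonglongrightarrow> 0" unfolding z_def using \<epsilon> by real_asymp
    have nat_sums: "(\<lambda>n. real n * exp (-(s * real n))) sums (exp (-s) / (1 - exp (-s)) ^ 2)" if "s > 0" for s
      using sums_nat_power[of "exp (-s)"] that by (simp add: mult.commute flip: exp_of_nat_mult)
    have nat_lim: "((\<lambda>s. s ^ 2 * (\<Sum>n. real n * exp (-(s * real n)))) \<longlongrightarrow> 1) (at_right 0)"
    proof (rule Lim_transform_eventually)
      show "((\<lambda>s::real. s ^ 2 * (exp (-s) / (1 - exp (-s)) ^ 2)) \<longlongrightarrow> 1) (at_right 0)" by real_asymp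
      show "\<forall>\<^sub>F s::real in at_right 0. s ^ 2 * (exp (-s) / (1 - exp (-s)) ^ 2) = s ^ 2 * (\<Sum>n. real n * exp (-(s * real n)))"
        using eventually_at_right_less[of "0::real"]
        by eventually_elim (use nat_sums in \<open>simp add: sums_iff\<close>)
    qed
    have smn: "\<forall>s>0. summable (\<lambda>n. real n * exp (-(s * real n)))"
      using nat_sums by (auto simp: sums_iff)
    note zb = laplace_abelian[OF of_nat_0_le_iff smn nat_lim z]
    define Er where "Er s = s ^ 2 * (\<Sum>n. z n * real n * exp (-(s * real n)))" for s
    have Er: "(Er \<longlongrightarrow> 0) (at_right 0)" using zb(2) by (simp add: Er_def[abs_def])
    have "((\<lambda>s. (1 - \<epsilon>) ^ 2 * T s - Er s) \<longlongrightarrow> (1 - \<epsilon>) ^ 2 * \<tau> - 0) (at_right 0)"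
      by (intro tendsto_intros T Er)
    hence "\<forall>\<^sub>F s in at_right 0. b < (1 - \<epsilon>) ^ 2 * T s - Er s" using \<epsilon> by (intro order_tendstoD(1)) auto
    with eventually_at_right_less[of "0::real"]
    show "\<forall>\<^sub>F s in at_right 0. b < D s"
    proof eventually_elim
      case (elim s)
      have "(1 - \<epsilon>) ^ 2 * (\<Sum>n. u n * exp (-(s * real n))) \<le>
            (primelap s - ln 2 * exp (-(2 * s))) * primelap (2 * s) + (\<Sum>n. z n * real n * exp (-(s * real n)))"
      proof (rule sums_le)
        show "(\<lambda>n. (1 - \<epsilon>) ^ 2 * (u n * exp (-(s * real n)))) sums ((1 - \<epsilon>) ^ 2 * (\<Sum>n. u n * exp (-(s * real n))))"
          by (intro sums_mult summable_sums smu elim)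
        show "(\<lambda>n. a n * exp (-(s * real n)) + z n * real n * exp (-(s * real n))) sums
          ((primelap s - ln 2 * exp (-(2 * s))) * primelap (2 * s) + (\<Sum>n. z n * real n * exp (-(s * real n))))"
          by (intro sums_add a_sums summable_sums zb(1) elim)
        fix n
        have "(1 - \<epsilon>) ^ 2 * u n \<le> a n + z n * real n"
        proof (cases "odd n")
          case True
          hence n: "n \<ge> 1" by (cases n) auto
          have "real n powr (1 - \<epsilon>) = real n powr (-\<epsilon>) * real n"
            using n powr_add[of "real n" "-\<epsilon>" 1] by (simp add: add.commute)
          thus ?thesis using wpairs_ge[OF n \<epsilon>(3,2)] True by (simp add: a_def u_def z_def mult_ac)
        qed (auto simp: a_def u_def z_def)
        hence "(1 - \<epsilon>) ^ 2 * u n * exp (-(s * real n)) \<le> (a n + z n * real n) * exp (-(s * real n))"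
          by (intro mult_right_mono) auto
        thus "(1 - \<epsilon>) ^ 2 * (u n * exp (-(s * real n))) \<le> a n * exp (-(s * real n)) + z n * real n * exp (-(s * real n))"
          by (simp add: distrib_right mult.assoc)
      qed
      hence "s ^ 2 * ((1 - \<epsilon>) ^ 2 * (\<Sum>n. u n * exp (-(s * real n)))) \<le> s ^ 2 * ((primelap s - ln 2 * exp (-(2 * s))) * primelap (2 * s) + (\<Sum>n. z n * real n * exp (-(s * real n))))"
        by (intro mult_left_mono) auto
      hence "(1 - \<epsilon>) ^ 2 * T s \<le> D s + Er s"
        by (simp add: T_def D_def Er_def distrib_left mult.left_commute)
      thus ?case using elim by linarith
    qed
  qed
  \<comment> \<open>Restores the prime 2, which was removed by parity; its term is O(s) because the
    normalized transform at 2s is at most 4.\<close>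
  have "((\<lambda>s. s * primelap s * (2 * s * primelap (2 * s))) \<longlongrightarrow> 2 * \<tau> + 0) (at_right 0)"
  proof (rule Lim_transform_eventually)
    have "((\<lambda>s. s * ln 2 * exp (-(2 * s)) * (2 * s * primelap (2 * s))) \<longlongrightarrow> 0) (at_right 0)"
    proof (rule tendsto_sandwich)
      show "((\<lambda>_. 0) \<longlongrightarrow> (0::real)) (at_right 0)" by simp
      show "((\<lambda>s. s * ln 2 * exp (-(2 * s)) * 4 :: real) \<longlongrightarrow> 0) (at_right 0)" by real_asymp
      show "\<forall>\<^sub>F s in at_right 0. 0 \<le> s * ln 2 * exp (-(2 * s)) * (2 * s * primelap (2 * s))"
        using eventually_at_right_less[of "0::real"] by eventually_elim (simp add: primelap_nonneg)
      show "\<forall>\<^sub>F s in at_right 0. s * ln 2 * exp (-(2 * s)) * (2 * s * primelap (2 * s)) \<le> s * ln 2 * exp (-(2 * s)) * 4"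
        using eventually_at_right_less[of "0::real"]
      proof eventually_elim
        case (elim s)
        thus ?case by (intro mult_left_mono primelap_le) auto
      qed
    qed
    thus "((\<lambda>s. 2 * D s + s * ln 2 * exp (-(2 * s)) * (2 * s * primelap (2 * s))) \<longlongrightarrow> 2 * \<tau> + 0) (at_right 0)"
      by (intro tendsto_intros D)
    show "\<forall>\<^sub>F s in at_right 0. 2 * D s + s * ln 2 * exp (-(2 * s)) * (2 * s * primelap (2 * s)) = s * primelap s * (2 * s * primelap (2 * s))"
      by (rule always_eventually) (simp add: D_def power2_eq_square algebra_simps)
  qed
  moreover have "filterlim (\<lambda>k. 1 / 2 ^ Suc k :: real) (at_right 0) sequentially" by real_asymp
  ultimately have "(\<lambda>k. 1 / 2 ^ Suc k * primelap (1 / 2 ^ Suc k) * (2 * (1 / 2 ^ Suc k) * primelap (2 * (1 / 2 ^ Suc k)))) \<longlonglongrightarrow> 2 * \<tau> + 0"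
    by (rule filterlim_compose)
  hence "(\<lambda>k. (1 / 2 ^ k * primelap (1 / 2 ^ k)) * (1 / 2 ^ Suc k * primelap (1 / 2 ^ Suc k))) \<longlonglongrightarrow> 2 * \<tau>"
    by (simp add: mult_ac)
  hence "2 * \<tau> = 1" by (rule primelap_product_limit)
  thus ?thesis using C_tw_nonzero by (simp add: \<tau>_def field_simps)
qed

end
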